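(* Let $\mathcal{H}$ be a nonzero Hilbert space, $1<p<2$ and $q=p/(p-1)$. Then for every $(\zeta,\eta,Z,H)\in\mathcal{H}\times\mathcal{H}\times[0,\infty)\times[0,\infty)$ with $Z\ge|\zeta|^p$ and $H\ge|\eta|^q$, $$\mathbb{B}_p(\zeta,\eta,Z,H)=\mathcal{B}_p(\zeta,\eta,Z,H),$$ where the functions $\mathbb{B}_p$ and $\mathcal{B}_p$ are defined in the context.
   Context: $|\cdot|$ denotes the norm of $\mathcal{H}$ (and $|I|$ the length of an interval $I$). Let $\mathcal{D}=\{(\zeta,\eta,Z,H)\in\mathcal{H}\times\mathcal{H}\times[0,\infty)\times[0,\infty): Z\ge|\zeta|^p,\ H\ge|\eta|^q\}$. Definition of $\mathbb{B}_p$. Let $\mathfrak{D}$ be the family of dyadic subintervals of $[0,1)$ (including $[0,1)$ itself); for $I\in\mathfrak{D}$ let $I_-$, $I_+$ be its left and right halves, and for an integrable $\varphi$ on $[0,1)$ let $\varphi_I=\frac1{|I|}\int_I\varphi$. For $(\zeta,\eta,Z,H)\in\mathcal{D}$, $$\mathbb{B}_p(\zeta,\eta,Z,H)=\frac14\sup\sum_{I\in\mathfrak{D}}|\varphi_{I_+}-\varphi_{I_-}||\psi_{I_-}-\psi_{I_+}||I|,$$ where the supremum is over all integrable $\varphi,\psi:[0,1)\to\mathcal{H}$ with $\varphi_{[0,1)}=\zeta$, $\psi_{[0,1)}=\eta$, $(|\varphi|^p)_{[0,1)}\le Z$ and $(|\psi|^q)_{[0,1)}\le H$. Definition of $\mathcal{B}_p:\mathcal{D}\to\mathbb{R}$.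 - If $|\eta|^qZ\ge|\zeta|^pH$, then $$\mathcal{B}_p(\zeta,\eta,Z,H)=\frac{(H-|\eta|^q)^{1/q}(Z-|\zeta|^p)^{1/p}}{p-1}.$$ - If $|\eta|^qZ<|\zeta|^pH$ and $Z>|\zeta|^p$, then $$\mathcal{B}_p(\zeta,\eta,Z,H)=\gamma Z^{1/p}H^{1/q}-|\zeta||\eta|Y,$$ where $(\gamma,Y)$, $0\le Y<\gamma<(p-1)^{-1}$, is the unique solution (it exists and is unique) of the system $$\frac{(1-(p-1)Y)(1+Y)^{p-1}}{(1-(p-1)\gamma)(1+\gamma)^{p-1}}=\frac{Z}{|\zeta|^p},\qquad \frac{Y(1+Y)^{p-2}}{\gamma(1+\gamma)^{p-2}}=\left(\frac{|\eta|^qZ}{|\zeta|^pH}\right)^{1/q}.$$ - If $|\eta|^qZ<|\zeta|^pH$ and $Z=|\zeta|^p$, then $\mathcal{B}_p(\zeta,\eta,Z,H)=0$. *)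

theory Defs
  imports "HOL-Analysis.Analysis"
begin

text \<open>
  The library's Bochner integral is restricted to second countable (separable) codomains. A Hilbert
  space need not be separable, so the same definition is repeated here without that sort
  constraint; on second countable codomains it is the library's notion.
\<close>

inductive has_strong_integral ::
    "'a measure \<Rightarrow> ('a \<Rightarrow> 'b::real_normed_vector) \<Rightarrow> 'b \<Rightarrow> bool"
  for M f y where
  "f \<in> borel_measurable M \<Longrightarrow>
    (\<And>i. Bochner_Integration.simple_bochner_integrable M (s i)) \<Longrightarrow>
    (\<lambda>i. \<integral>\<^sup>+x. ennreal (norm (f x - s i x)) \<partial>M) \<longlonglongrightarrow> 0 \<Longrightarrow>
    (\<lambda>i. Bochner_Integration.simple_bochner_integral M (s i)) \<longlonglongrightarrow> y \<Longrightarrow>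
    has_strong_integral M f y"

lemma has_strong_integral_iff_has_bochner_integral:
  fixes f :: "'a \<Rightarrow> 'b::{real_normed_vector, second_countable_topology}"
  shows "has_strong_integral M f x \<longleftrightarrow> has_bochner_integral M f x"
  unfolding has_strong_integral.simps has_bochner_integral.simps by simp

definition strong_integrable :: "'a measure \<Rightarrow> ('a \<Rightarrow> 'b::real_normed_vector) \<Rightarrow> bool" where
  "strong_integrable M f \<longleftrightarrow> (\<exists>x. has_strong_integral M f x)"

definition strong_integral :: "'a measure \<Rightarrow> ('a \<Rightarrow> 'b::real_normed_vector) \<Rightarrow> 'b" where
  "strong_integral M f = (THE x. has_strong_integral M f x)"

definition average :: "real set \<Rightarrow> (real \<Rightarrow> 'b::real_normed_vector) \<Rightarrow> 'b" where
  "average I f = (1 / measure lebesgue I) *\<^sub>R strong_integral (lebesgue_on I) f"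

text \<open>
  The dyadic subintervals of \<open>[0,1)\<close> are the \<open>dyadic n k\<close> with \<open>k < 2 ^ n\<close>, each arising from exactly
  one such pair; the halves of \<open>dyadic n k\<close> are \<open>dyadic (n+1) (2*k)\<close> and \<open>dyadic (n+1) (2*k+1)\<close>.
\<close>

definition dyadic :: "nat \<Rightarrow> nat \<Rightarrow> real set" where
  "dyadic n k = {real k / 2 ^ n ..< real (k + 1) / 2 ^ n}"

definition dyadic_indices :: "(nat \<times> nat) set" where
  "dyadic_indices = {(n, k). k < 2 ^ n}"

definition jump :: "(real \<Rightarrow> 'b::real_normed_vector) \<Rightarrow> nat \<Rightarrow> nat \<Rightarrow> 'b" where
  "jump f n k =
     average (dyadic (n + 1) (2 * k + 1)) f - average (dyadic (n + 1) (2 * k)) f"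

definition admissible ::
    "real \<Rightarrow> real \<Rightarrow> 'b \<Rightarrow> 'b \<Rightarrow> real \<Rightarrow> real \<Rightarrow>
     ((real \<Rightarrow> 'b::real_normed_vector) \<times> (real \<Rightarrow> 'b)) set" where
  "admissible p q \<zeta> \<eta> Z H = {(\<phi>, \<psi>).
     strong_integrable (lebesgue_on {0..<1}) \<phi> \<and>
     strong_integrable (lebesgue_on {0..<1}) \<psi> \<and>
     average {0..<1} \<phi> = \<zeta> \<and>
     average {0..<1} \<psi> = \<eta> \<and>
     (\<integral>\<^sup>+x. ennreal (norm (\<phi> x) powr p) \<partial>lebesgue_on {0..<1}) \<le> ennreal Z \<and>
     (\<integral>\<^sup>+x. ennreal (norm (\<psi> x) powr q) \<partial>lebesgue_on {0..<1}) \<le> ennreal H}"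

definition bellman_sup ::
    "real \<Rightarrow> real \<Rightarrow> 'b::real_normed_vector \<Rightarrow> 'b \<Rightarrow> real \<Rightarrow> real \<Rightarrow> ennreal" where
  "bellman_sup p q \<zeta> \<eta> Z H =
     ennreal (1 / 4) *
     (SUP (\<phi>, \<psi>) \<in> admissible p q \<zeta> \<eta> Z H.
        \<Sum>\<^sub>\<infinity>(n, k)\<in>dyadic_indices.
          ennreal (norm (jump \<phi> n k) * norm (jump \<psi> n k)
                   * measure lebesgue (dyadic n k)))"

definition bellman_system ::
    "real \<Rightarrow> real \<Rightarrow> 'b::real_normed_vector \<Rightarrow> 'b \<Rightarrow> real \<Rightarrow> real \<Rightarrow> real \<Rightarrow> real \<Rightarrow> bool" where
  "bellman_system p q \<zeta> \<eta> Z H \<gamma> Y \<longleftrightarrow>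
     0 \<le> Y \<and> Y < \<gamma> \<and> \<gamma> < 1 / (p - 1) \<and>
     ((1 - (p - 1) * Y) * (1 + Y) powr (p - 1)) / ((1 - (p - 1) * \<gamma>) * (1 + \<gamma>) powr (p - 1))
       = Z / norm \<zeta> powr p \<and>
     (Y * (1 + Y) powr (p - 2)) / (\<gamma> * (1 + \<gamma>) powr (p - 2))
       = ((norm \<eta> powr q * Z) / (norm \<zeta> powr p * H)) powr (1 / q)"

definition bellman_explicit ::
    "real \<Rightarrow> real \<Rightarrow> 'b::real_normed_vector \<Rightarrow> 'b \<Rightarrow> real \<Rightarrow> real \<Rightarrow> real" where
  "bellman_explicit p q \<zeta> \<eta> Z H =
     (if norm \<eta> powr q * Z \<ge> norm \<zeta> powr p * H then
        (H - norm \<eta> powr q) powr (1 / q) * (Z - norm \<zeta> powr p) powr (1 / p) / (p - 1)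
      else if Z > norm \<zeta> powr p then
        (let (\<gamma>, Y) = (THE (\<gamma>, Y). bellman_system p q \<zeta> \<eta> Z H \<gamma> Y)
         in \<gamma> * Z powr (1 / p) * H powr (1 / q) - norm \<zeta> * norm \<eta> * Y)
      else 0)"

end

theory Submission
  imports Defs
begin

text \<open>
  Upper bound. Rotating the Haar coefficients of \<open>\<phi>\<close> towards those of \<open>\<psi>\<close> produces a martingale
  \<open>g\<close> whose steps are as long as those of \<open>\<phi>\<close>, and the sum becomes the mean of \<open>g \<bullet> \<psi>\<close> minus
  \<open>g0 \<bullet> \<eta>\<close>, where the starting point \<open>g0\<close> is free. By Young's inequality it remains to estimate
  the mean of \<open>norm g powr p - c * norm \<phi> powr p\<close>, which is at most \<open>U \<zeta> g0\<close> for every function \<open>U\<close> that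
  dominates \<open>norm y powr p - c * norm x powr p\<close> and satisfies the midpoint inequality along all
  directions \<open>(h, k)\<close> with \<open>norm h = norm k\<close>. Multiples of Burkholder's function serve for
  \<open>norm g0 \<le> norm \<zeta> / (p - 1)\<close>, truncated versions of it beyond. The second equation of the system
  selects the best \<open>norm g0\<close>, namely \<open>Y * norm \<zeta>\<close>.

  Lower bound. Gluing shows that the supremum is superadditive under midpoints, with gain
  \<open>\<bar>x1 - x2\<bar> * \<bar>y1 - y2\<bar> / 4\<close>, hence along arbitrary segments with gain \<open>l (1 - l) \<bar>x1 - x2\<bar> \<bar>y1 - y2\<bar>\<close>.
  For \<open>\<eta> = 0\<close>, repeated small self-similar splittings give the value \<open>\<gamma> Z^(1/p) H^(1/q)\<close>. One
  further splitting between such a point and a point where both functions are constant reaches the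
  regime of the system; in the other regime one sends a vanishing proportion of the mass to points
  with \<open>\<eta> = 0\<close> and huge \<open>Z\<close> and \<open>H\<close>.
\<close>

section \<open>Zigzag-concave functions\<close>

text \<open>Jumps enter the sum only through their lengths, so scalar step functions along two fixed
  unit vectors suffice as examples in any Hilbert space. The upper bound is proved on finite trees,
  with Jensen's inequality at the depth where they stop; martingale convergence never enters.
  Concavity of Burkholder's function is not checked by differentiation. The function is a
  superposition of saddles \<open>(norm y)^2 - (norm x)^2\<close>, cut off outside diamonds. A
  saddle is neutral along steps with \<open>norm h = norm k\<close>, which makes each member of the
  family elementary. The regimes differ in where the majorant must touch its obstacle. A multiple of
  Burkholder's function touches along a whole line of slope \<open>\<gamma>\<close>, and the first
  equation of the system says that the cost at the start is the one on that line. If the best start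
  lies beyond the extreme slope \<open>1 / (p - 1)\<close>, the majorant must touch at the start
  itself, which the quadratic core of the truncated functions allows; for nonzero
  \<open>\<eta>\<close> the condition separating the regimes says on which side of that slope the
  best start lies.\<close>

definition zigzag_concave :: "('a::real_inner \<Rightarrow> 'a \<Rightarrow> real) \<Rightarrow> bool" where
  "zigzag_concave U \<longleftrightarrow>
     (\<forall>x y h k. norm k = norm h \<longrightarrow> U (x + h) (y + k) + U (x - h) (y - k) \<le> 2 * U x y)"

lemma zigzag_concaveD:
  "zigzag_concave U \<Longrightarrow> norm k = norm h \<Longrightarrow> U (x + h) (y + k) + U (x - h) (y - k) \<le> 2 * U x y"
  by (auto simp: zigzag_concave_def)

lemma zigzag_concave_add:
  "zigzag_concave U \<Longrightarrow> zigzag_concave V \<Longrightarrow> zigzag_concave (\<lambda>x y. U x y + V x y)"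
  unfolding zigzag_concave_def by (smt (verit, ccfv_threshold))

lemma zigzag_concave_cmult:
  assumes "zigzag_concave U" "0 \<le> (c::real)"
  shows "zigzag_concave (\<lambda>x y. c * U x y)"
  unfolding zigzag_concave_def
proof (intro allI impI)
  fix x y h k :: 'a assume "norm k = norm h"
  then have "c * (U (x + h) (y + k) + U (x - h) (y - k)) \<le> c * (2 * U x y)"
    using assms by (intro mult_left_mono zigzag_concaveD) auto
  then show "c * U (x + h) (y + k) + c * U (x - h) (y - k) \<le> 2 * (c * U x y)"
    by (simp add: algebra_simps)
qed

lemma zigzag_concave_limit:
  assumes "\<And>R. 0 < R \<Longrightarrow> zigzag_concave (U R)"
    and "\<And>x y. ((\<lambda>R. U R x y) \<longlongrightarrow> V x y) (at_right (0::real))"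
  shows "zigzag_concave V"
  unfolding zigzag_concave_def
proof (intro allI impI)
  fix x y h k :: 'a assume *: "norm k = norm h"
  have "eventually (\<lambda>R. U R (x + h) (y + k) + U R (x - h) (y - k) \<le> 2 * U R x y) (at_right 0)"
    using assms(1) * by (auto simp: eventually_at_right_less intro!: eventually_mono[OF eventually_at_right_less] zigzag_concaveD)
  then show "V (x + h) (y + k) + V (x - h) (y - k) \<le> 2 * V x y"
    by (rule tendsto_le[rotated 3]) (auto intro!: tendsto_intros assms(2))
qed

text \<open>Parallelogram identity: the two increments cancel, equality holds, and \<open>c\<close>
  may have either sign. Multiples of the saddle can thus be added or removed freely, which is how
  the tail of the integral over \<open>t\<close> is discarded.\<close>

lemma zigzag_concave_norm_diff:
  "zigzag_concave (\<lambda>x y. c * ((norm y)\<^sup>2 - (norm x)\<^sup>2))"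
  unfolding zigzag_concave_def
proof (intro allI impI)
  fix x y h k :: 'a assume *: "norm k = norm h"
  have "(norm (y+k))\<^sup>2 + (norm (y-k))\<^sup>2 = 2*(norm y)\<^sup>2 + 2 * (norm k)\<^sup>2"
    "(norm (x+h))\<^sup>2 + (norm (x-h))\<^sup>2 = 2*(norm x)\<^sup>2 + 2 * (norm h)\<^sup>2"
    by (simp_all add: dot_square_norm[symmetric] inner_simps)
  then have "(norm (y+k))\<^sup>2 - (norm (x+h))\<^sup>2 + ((norm (y-k))\<^sup>2 - (norm (x-h))\<^sup>2) = 2*((norm y)\<^sup>2 - (norm x)\<^sup>2)"
    using * by simp
  then have "c * ((norm (y+k))\<^sup>2 - (norm (x+h))\<^sup>2 + ((norm (y-k))\<^sup>2 - (norm (x-h))\<^sup>2)) = c * (2*((norm y)\<^sup>2 - (norm x)\<^sup>2))"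
    by simp
  then show "c * ((norm (y + k))\<^sup>2 - (norm (x + h))\<^sup>2) + c * ((norm (y - k))\<^sup>2 - (norm (x - h))\<^sup>2)
      \<le> 2 * (c * ((norm y)\<^sup>2 - (norm x)\<^sup>2))"
    by (simp add: algebra_simps)
qed

lemma zigzag_concave_affine_norm:
  assumes "b \<le> 0"
  shows "zigzag_concave (\<lambda>(x::'a::real_inner) (y::'a). a + b * norm x)"
  unfolding zigzag_concave_def
proof (intro allI impI)
  fix x h :: 'a
  have "norm (2 *\<^sub>R x) \<le> norm (x + h) + norm (x - h)"
    using norm_triangle_ineq[of "x+h" "x-h"] by (simp add: scaleR_2)
  then have "b * (norm (x + h) + norm (x - h)) \<le> b * (2 * norm x)"
    using assms by (intro mult_left_mono_neg) auto
  then show "a + b * norm (x + h) + (a + b * norm (x - h)) \<le> 2 * (a + b * norm x)"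
    by (simp add: algebra_simps)
qed

section \<open>Saddles cut off outside a diamond, and their superposition\<close>

text \<open>The outer formula is \<open>(t - norm x)^2 - (norm x)^2\<close>, the saddle with
  \<open>norm y\<close> replaced by its boundary value \<open>t - norm x\<close>. The function is
  thus continuous, and outside the diamond it does not depend on \<open>y\<close>.\<close>

definition zigzag_disc :: "real \<Rightarrow> 'a::real_inner \<Rightarrow> 'a \<Rightarrow> real" where
  "zigzag_disc t x y =
     (if norm x + norm y \<le> t then (norm y)\<^sup>2 - (norm x)\<^sup>2 else t\<^sup>2 - 2 * t * norm x)"

lemma zigzag_disc_le_affine:
  assumes "0 \<le> t"
  shows "zigzag_disc t x y \<le> t\<^sup>2 - 2 * t * norm x"
proof -
  have "(norm y)\<^sup>2 \<le> (t - norm x)\<^sup>2" if "norm x + norm y \<le> t"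
    using that by (intro power_mono) auto
  then show ?thesis by (auto simp: zigzag_disc_def power2_eq_square algebra_simps)
qed

text \<open>Along these steps the saddle is affine, so as long as the step stays in the diamond both
  sides agree. Once it leaves, the claim amounts to
  \<open>norm (y + k) \<ge> \<bar>t - norm (x + h)\<bar>\<close>; equal step lengths give this when
  \<open>norm (x + h) > t\<close>.\<close>

lemma zigzag_disc_le_tangent:
  fixes x y h k :: "'a::real_inner"
  assumes "0 \<le> t" "norm x + norm y \<le> t" "norm k = norm h"
  shows "zigzag_disc t (x + h) (y + k) \<le> (norm y)\<^sup>2 - (norm x)\<^sup>2 + 2 * (y \<bullet> k) - 2 * (x \<bullet> h)"
proof -
  have eq: "(norm (y+k))\<^sup>2 - (norm (x+h))\<^sup>2 = (norm y)\<^sup>2 - (norm x)\<^sup>2 + 2 * (y \<bullet> k) - 2 * (x \<bullet> h)"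
    using assms(3) by (simp add: norm_eq power2_norm_eq_inner inner_simps inner_commute)
  have "t\<^sup>2 - 2 * t * norm (x+h) \<le> (norm (y+k))\<^sup>2 - (norm (x+h))\<^sup>2" if out: "\<not> norm (x+h) + norm (y+k) \<le> t"
  proof (cases "norm (x+h) \<le> t")
    case True
    then have "(t - norm (x+h))\<^sup>2 \<le> (norm (y+k))\<^sup>2" using out by (intro power_mono) auto
    then show ?thesis by (simp add: power2_eq_square algebra_simps)
  next
    case False
    have "norm (x+h) - norm x \<le> norm h" "norm k \<le> norm (y+k) + norm y"
      using norm_triangle_ineq[of x h] norm_triangle_ineq4[of "y+k" y] by auto
    then have "norm (x+h) - t \<le> norm (y+k)" using assms by linarith
    then have "(norm (x+h) - t)\<^sup>2 \<le> (norm (y+k))\<^sup>2" using False by (intro power_mono) auto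
    then show ?thesis by (simp add: power2_eq_square algebra_simps)
  qed
  then show ?thesis using eq by (auto simp: zigzag_disc_def)
qed

text \<open>For a centre in the diamond the linear terms of the two tangent bounds cancel. For a
  centre outside, the outer formula is a global majorant, concave in \<open>x\<close> and exact at
  the centre.\<close>

lemma zigzag_concave_disc:
  assumes "0 \<le> t"
  shows "zigzag_concave (zigzag_disc t :: 'a::real_inner \<Rightarrow> 'a \<Rightarrow> real)"
  unfolding zigzag_concave_def
proof (intro allI impI)
  fix x y h k :: 'a assume *: "norm k = norm h"
  show "zigzag_disc t (x + h) (y + k) + zigzag_disc t (x - h) (y - k) \<le> 2 * zigzag_disc t x y"
  proof (cases "norm x + norm y \<le> t")
    case True
    then show ?thesis
      using zigzag_disc_le_tangent[OF assms True *] zigzag_disc_le_tangent[OF assms True, of "-k" "-h"] *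
      by (simp add: zigzag_disc_def)
  next
    case False
    have "zigzag_disc t (x + h) (y + k) + zigzag_disc t (x - h) (y - k)
        \<le> t\<^sup>2 + (- 2 * t) * norm (x + h) + (t\<^sup>2 + (-2 * t) * norm (x - h))"
      using zigzag_disc_le_affine[OF assms, of "x+h" "y+k"] zigzag_disc_le_affine[OF assms, of "x-h" "y-k"]
      by simp
    also have "\<dots> \<le> 2 * (t\<^sup>2 + (-2 * t) * norm x)"
      using zigzag_concaveD[OF zigzag_concave_affine_norm[of "-2*t" "t\<^sup>2"] *] assms by simp
    finally show ?thesis using False by (simp add: zigzag_disc_def)
  qed
qed

text \<open>
  This is \<open>\<integral>\<^sub>R\<^sup>\<infinity> t powr (p - 3) * zigzag_disc t x y dt\<close>; the identity is used only up to a finite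
  upper limit, see \<open>zigzag_disc_integral\<close>.
\<close>

definition burk_trunc :: "real \<Rightarrow> real \<Rightarrow> 'a::real_inner \<Rightarrow> 'a \<Rightarrow> real" where
  "burk_trunc p R x y =
     (let r = norm x + norm y in
      if r \<le> R then R powr (p - 2) / (2 - p) * ((norm y)\<^sup>2 - (norm x)\<^sup>2)
      else 2 / (p * (2 - p)) * (r powr (p - 1) * (norm y - norm x / (p - 1)))
           - R powr p / p + 2 * norm x * R powr (p - 1) / (p - 1))"

lemma has_integral_powr_shift:
  fixes a b s :: real
  assumes "0 < a" "a \<le> b" "s \<noteq> - 1"
  shows "((\<lambda>t. t powr s) has_integral (b powr (s + 1) - a powr (s + 1)) / (s + 1)) {a..b}"
proof -
  have "((\<lambda>t. t powr s) has_integral (b powr (s + 1) / (s + 1) - a powr (s + 1) / (s + 1))) {a..b}"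
  proof (rule fundamental_theorem_of_calculus)
    fix t assume t: "t \<in> {a..b}"
    have "((\<lambda>t. t powr (s + 1) / (s + 1)) has_real_derivative t powr s) (at t within {a..b})"
      using t assms by (auto intro!: derivative_eq_intros)
    then show "((\<lambda>t. t powr (s + 1) / (s + 1)) has_vector_derivative t powr s) (at t within {a..b})"
      by (simp add: has_real_derivative_iff_has_vector_derivative)
  qed (use assms in auto)
  then show ?thesis by (simp add: diff_divide_distrib)
qed

text \<open>Past \<open>norm x + norm y\<close> the integrand is a multiple of the saddle, so
  stopping at \<open>T\<close> costs exactly a saddle term. This avoids an improper integral and
  loses nothing, saddles being neutral.\<close>

lemma zigzag_disc_integral:
  assumes p: "1 < p" "p < 2" and R: "0 < R" "R \<le> T" and T: "norm x + norm y \<le> T"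
  shows "((\<lambda>t. t powr (p - 3) * zigzag_disc t x y) has_integral
           burk_trunc p R x y - T powr (p - 2) / (2 - p) * ((norm y)\<^sup>2 - (norm x)\<^sup>2)) {R..T}"
proof -
  define D where "D = (norm y)\<^sup>2 - (norm x)\<^sup>2"
  have outer: "((\<lambda>t. t powr (p - 3) * zigzag_disc t x y) has_integral
      (S powr (p-2) - T powr (p - 2)) / (2 - p) * D) {S..T}"
    if "0 < S" "S \<le> T" "norm x + norm y \<le> S" for S
  proof -
    have "((\<lambda>t. t powr (p - 3) * D) has_integral
      (T powr (p - 3 + 1) - S powr (p - 3 + 1)) / (p - 3 + 1) * D) {S..T}"
      using that p by (intro has_integral_mult_left has_integral_powr_shift) auto
    moreover have "(T powr (p - 3 + 1) - S powr (p - 3 + 1)) / (p - 3 + 1) = (S powr (p-2) - T powr (p - 2)) / (2 - p)"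
      using p by (simp add: divide_simps algebra_simps)
    ultimately have "((\<lambda>t. t powr (p - 3) * D) has_integral (S powr (p-2) - T powr (p - 2)) / (2 - p) * D) {S..T}"
      by (simp only:)
    then show ?thesis
      by (rule has_integral_eq[rotated]) (use that in \<open>auto simp: zigzag_disc_def D_def\<close>)
  qed
  show ?thesis
  proof (cases "norm x + norm y \<le> R")
    case True
    then show ?thesis using outer[OF R True] by (simp add: burk_trunc_def D_def algebra_simps diff_divide_distrib)
  next
    case False
    define r where "r = norm x + norm y"
    define a where "a = norm x"
    have r: "R < r" "r \<le> T" "0 < r" using False R T by (auto simp: r_def)
    have y: "norm y = r - a" by (simp add: r_def a_def)
    have "((\<lambda>t. t powr (p - 1) - 2 * a * t powr (p - 2)) has_integral
       (r powr (p - 1 + 1) - R powr (p - 1 + 1)) / (p - 1 + 1)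
       - 2 * a * ((r powr (p - 2 + 1) - R powr (p - 2 + 1)) / (p - 2 + 1))) {R..r}"
      using r R p by (intro has_integral_diff has_integral_mult_right has_integral_powr_shift) auto
    then have inner: "((\<lambda>t. t powr (p - 3) * zigzag_disc t x y) has_integral
       (r powr (p - 1 + 1) - R powr (p - 1 + 1)) / (p - 1 + 1)
       - 2 * a * ((r powr (p - 2 + 1) - R powr (p - 2 + 1)) / (p - 2 + 1))) {R..r}"
    \<comment> \<open>At \<open>t = r\<close> the definition takes the saddle branch; removing this
      point lets the outer formula be used throughout.\<close>
    proof (rule has_integral_spike[of "{r}", rotated 2])
      fix t assume t: "t \<in> {R..r} - {r}"
      then have e: "t powr (p - 1) = t powr (p - 3) * t\<^sup>2" "t powr (p - 2) = t powr (p - 3) * t"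
        using R powr_add[of t "p - 3" 2] powr_add[of t "p - 3" 1] by (auto simp: powr_numeral)
      have d: "zigzag_disc t x y = t\<^sup>2 - 2 * t * a"
        using t by (auto simp: zigzag_disc_def r_def a_def)
      show "t powr (p - 3) * zigzag_disc t x y = t powr (p - 1) - 2 * a * t powr (p - 2)"
        unfolding e d
        by (simp add: algebra_simps)
    qed auto
    have "((\<lambda>t. t powr (p - 3) * zigzag_disc t x y) has_integral
       ((r powr (p - 1 + 1) - R powr (p - 1 + 1)) / (p - 1 + 1)
       - 2 * a * ((r powr (p - 2 + 1) - R powr (p - 2 + 1)) / (p - 2 + 1))
       + (r powr (p-2) - T powr (p - 2)) / (2 - p) * D)) {R..T}"
      using r outer[of r] by (intro has_integral_combine[OF _ _ inner]) (auto simp: r_def)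
    moreover have "(r powr (p - 1 + 1) - R powr (p - 1 + 1)) / (p - 1 + 1)
       - 2 * a * ((r powr (p - 2 + 1) - R powr (p - 2 + 1)) / (p - 2 + 1))
       + (r powr (p-2) - T powr (p - 2)) / (2 - p) * D
       = burk_trunc p R x y - T powr (p - 2) / (2 - p) * D"
    proof -
      have e: "r powr p = r powr (p-1) * r" "r powr (p - 1) = r powr (p - 2) * r"
        using r powr_add[of r "p - 1" 1] powr_add[of r "p - 2" 1] by auto
      have D: "D = r * (r - 2 * a)" by (simp add: D_def y a_def[symmetric] power2_eq_square algebra_simps)
      define s where "s = r powr (p - 2)"
      have "s * r * r / p - 2 * a * (s * r) / (p - 1) + s / (2 - p) * (r * (r - 2 * a))
          = 2 / (p * (2 - p)) * (s * r * (r - a - a / (p - 1)))"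
        using p by (simp add: divide_simps) (simp add: algebra_simps)
      then show ?thesis
        using False by (simp add: burk_trunc_def Let_def r_def[symmetric] a_def[symmetric] y e D s_def[symmetric]
             diff_divide_distrib algebra_simps)
    qed
    ultimately show ?thesis by (simp add: D_def)
  qed
qed

lemma zigzag_concave_burk_trunc:
  assumes p: "1 < p" "p < 2" and R: "0 < R"
  shows "zigzag_concave (burk_trunc p R :: 'a::real_inner \<Rightarrow> 'a \<Rightarrow> real)"
  unfolding zigzag_concave_def
proof (intro allI impI)
  fix x y h k :: 'a assume *: "norm k = norm h"
  \<comment> \<open>Large enough for the integral identity to hold with the same \<open>T\<close> at
    the centre and at both endpoints.\<close>
  define T where "T = R + (norm x + norm h) + (norm y + norm k)"
  have T: "R \<le> T" "norm x + norm y \<le> T" "norm (x+h) + norm (y+k) \<le> T" "norm (x-h) + norm (y-k) \<le> T"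
    using norm_triangle_ineq[of x h] norm_triangle_ineq[of y k] norm_triangle_ineq4[of x h] norm_triangle_ineq4[of y k] R
    unfolding T_def by (auto simp del: norm_triangle_ineq norm_triangle_ineq4)
  define E where "E = T powr (p - 2) / (2 - p)"
  have "burk_trunc p R (x+h) (y+k) - E * ((norm (y+k))\<^sup>2 - (norm (x+h))\<^sup>2)
      + (burk_trunc p R (x-h) (y-k) - E * ((norm (y-k))\<^sup>2 - (norm (x-h))\<^sup>2))
      \<le> 2 * (burk_trunc p R x y - E * ((norm y)\<^sup>2 - (norm x)\<^sup>2))"
  proof (rule has_integral_le)
    fix t assume t: "t \<in> {R..T}"
    have "zigzag_disc t (x + h) (y + k) + zigzag_disc t (x - h) (y - k) \<le> 2 * zigzag_disc t x y"
      using zigzag_concaveD[OF zigzag_concave_disc *] t R by simp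
    then have "t powr (p - 3) * (zigzag_disc t (x + h) (y + k) + zigzag_disc t (x - h) (y - k)) \<le> t powr (p - 3) * (2 * zigzag_disc t x y)"
      by (intro mult_left_mono) auto
    then show "t powr (p - 3) * zigzag_disc t (x + h) (y + k) + t powr (p - 3) * zigzag_disc t (x - h) (y - k)
      \<le> 2 * (t powr (p - 3) * zigzag_disc t x y)"
      by (simp add: algebra_simps)
  next
    show "((\<lambda>t. t powr (p - 3) * zigzag_disc t (x + h) (y + k) + t powr (p - 3) * zigzag_disc t (x - h) (y - k)) has_integral
        burk_trunc p R (x+h) (y+k) - E * ((norm (y+k))\<^sup>2 - (norm (x+h))\<^sup>2)
      + (burk_trunc p R (x-h) (y-k) - E * ((norm (y-k))\<^sup>2 - (norm (x-h))\<^sup>2))) {R..T}"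
      unfolding E_def by (intro has_integral_add zigzag_disc_integral p R T)
    show "((\<lambda>t. 2 * (t powr (p - 3) * zigzag_disc t x y)) has_integral
        2 * (burk_trunc p R x y - E * ((norm y)\<^sup>2 - (norm x)\<^sup>2))) {R..T}"
      unfolding E_def by (rule has_integral_mult_right, rule zigzag_disc_integral[OF p R T(1,2)])
  qed
  then show "burk_trunc p R (x + h) (y + k) + burk_trunc p R (x - h) (y - k) \<le> 2 * burk_trunc p R x y"
    using zigzag_concaveD[OF zigzag_concave_norm_diff[of E] *, where x = x and y = y] by (simp add: algebra_simps)
qed

definition burkholder :: "real \<Rightarrow> 'a::real_inner \<Rightarrow> 'a \<Rightarrow> real" where
  "burkholder p x y = (norm x + norm y) powr (p - 1) * (norm y - norm x / (p - 1))"

text \<open>As the cutoff \<open>R\<close> tends to 0, the lower-order terms of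
  \<open>burk_trunc\<close> vanish because \<open>p > 1\<close>. The origin is treated apart since
  it lies in the quadratic branch for every \<open>R\<close>.\<close>

lemma zigzag_concave_burkholder:
  assumes p: "1 < p" "p < 2"
  shows "zigzag_concave (burkholder p :: 'a::real_inner \<Rightarrow> 'a \<Rightarrow> real)"
proof -
  have "zigzag_concave (\<lambda>x y::'a. 2 / (p * (2 - p)) * burkholder p x y)"
  proof (rule zigzag_concave_limit[OF zigzag_concave_burk_trunc[OF p]])
    fix x y :: 'a
    show "((\<lambda>R. burk_trunc p R x y) \<longlongrightarrow> 2 / (p * (2 - p)) * burkholder p x y) (at_right 0)"
    proof (cases "norm x + norm y = 0")
      case True
      then have "x = 0" "y = 0" using norm_ge_zero[of x] norm_ge_zero[of y]
        by (metis add_nonneg_eq_0_iff norm_eq_zero)+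
      then have "eventually (\<lambda>R. burk_trunc p R x y = 2 / (p * (2 - p)) * burkholder p x y) (at_right 0)"
        by (intro eventually_mono[OF eventually_at_right_less]) (auto simp: burk_trunc_def burkholder_def)
      then show ?thesis by (rule tendsto_eventually)
    next
      case False
      define r where "r = norm x + norm y"
      have r: "0 < r" using False norm_ge_zero[of x] norm_ge_zero[of y] unfolding r_def by linarith
      have "eventually (\<lambda>R. R \<in> {0<..<r}) (at_right 0)" using r by (rule eventually_at_right_real)
      then have ev: "eventually (\<lambda>R. 2 / (p * (2 - p)) * burkholder p x y
           - R powr p / p + 2 * norm x * R powr (p - 1) / (p - 1) = burk_trunc p R x y) (at_right 0)"
        by eventually_elim (auto simp: burk_trunc_def burkholder_def Let_def r_def)
      have z: "((\<lambda>R. R powr s) \<longlongrightarrow> 0) (at_right (0::real))" if "0 < s" for s :: real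
      proof -
        have "((\<lambda>R. R powr s) \<longlongrightarrow> 0 powr s) (at_right (0::real))"
          using that by (intro tendsto_powr') (auto intro!: tendsto_intros eventually_mono[OF eventually_at_right_less])
        then show ?thesis by simp
      qed
      have "((\<lambda>R. 2 / (p * (2 - p)) * burkholder p x y
           - R powr p / p + 2 * norm x * R powr (p - 1) / (p - 1)) \<longlongrightarrow> 2 / (p * (2 - p)) * burkholder p x y
           - 0 / p + 2 * norm x * 0 / (p - 1)) (at_right 0)"
        using p by (intro tendsto_intros z) auto
      then show ?thesis using ev by (simp add: tendsto_cong)
    qed
  qed
  then have "zigzag_concave (\<lambda>x y::'a. (p * (2 - p)) / 2 * (2 / (p * (2 - p)) * burkholder p x y))"
    by (rule zigzag_concave_cmult) (use p in auto)
  moreover have "(\<lambda>x y::'a. (p * (2 - p)) / 2 * (2 / (p * (2 - p)) * burkholder p x y)) = burkholder p"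
    using p by (auto simp: fun_eq_iff)
  ultimately show ?thesis by (simp only:)
qed

text \<open>
  With these constants \<open>burk_const p g * burkholder p\<close> touches its obstacle
  \<open>norm y powr p - young_const p g * norm x powr p\<close> along \<open>norm y = g * norm x\<close>.
\<close>

definition young_const :: "real \<Rightarrow> real \<Rightarrow> real" where
  "young_const p g = g powr (p - 2) * (1 + (2 - p) * g) / (p - 1)"

definition burk_const :: "real \<Rightarrow> real \<Rightarrow> real" where
  "burk_const p g = (g / (1 + g)) powr (p - 2)"

section \<open>Minimising the excess of Burkholder's function over its obstacle\<close>

lemma burk_excess_deriv:
  fixes p a b :: real
  assumes p: "1 < p" "p < 2" and "0 \<le> a" "0 < b"
  shows "((\<lambda>b. A * ((a + b) powr (p - 1) * (b - a / (p - 1))) - b powr p) has_real_derivative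
           p * b * (A * (a + b) powr (p - 2) - b powr (p - 2))) (at b)"
proof -
  have e: "(a + b) powr (p - 1) = (a + b) powr (p - 2) * (a + b)" "b powr (p - 1) = b powr (p - 2) * b"
    using assms powr_add[of "a + b" "p - 2" 1] powr_add[of b "p - 2" 1] by auto
  have "((\<lambda>b. A * ((a + b) powr (p - 1) * (b - a / (p - 1))) - b powr p) has_real_derivative
          (A * ((p - 1) * (a + b) powr (p - 1 - 1) * (b - a / (p - 1)) + (a + b) powr (p - 1)) - p * b powr (p - 1))) (at b)"
    using assms by (auto intro!: derivative_eq_intros)
  moreover have "A * ((p - 1) * (a + b) powr (p - 1 - 1) * (b - a / (p - 1)) + (a + b) powr (p - 1)) - p * b powr (p - 1)
     = p * b * (A * (a + b) powr (p - 2) - b powr (p - 2))"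
    unfolding e using p by (simp add: divide_simps) (simp add: algebra_simps)
  ultimately show ?thesis by simp
qed

lemma burk_excess_continuous:
  fixes p a u v :: real
  assumes p: "1 < p" "p < 2" and "0 \<le> a" "0 \<le> u"
  shows "continuous_on {u..v} (\<lambda>b. A * ((a + b) powr (p - 1) * (b - a / (p - 1))) - b powr p)"
  using assms by (intro continuous_intros continuous_on_powr') auto

text \<open>The constant is made so that its product with \<open>(a + b) powr (p - 2)\<close> is a
  power of \<open>g / (1 + g) * (a + b)\<close>, which equals \<open>b\<close> exactly when
  \<open>b = g * a\<close>. With \<open>burk_excess_deriv\<close> this locates the minimum of the
  excess.\<close>

lemma burk_const_powr_le_iff:
  assumes p: "p < 2" and "0 < g" "0 \<le> a" "0 < b"
  shows "burk_const p g * (a + b) powr (p - 2) \<le> b powr (p - 2) \<longleftrightarrow> b \<le> g * a"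
    and "b powr (p - 2) \<le> burk_const p g * (a + b) powr (p - 2) \<longleftrightarrow> g * a \<le> b"
proof -
  have e: "burk_const p g * (a + b) powr (p - 2) = (g / (1 + g) * (a + b)) powr (p - 2)"
    unfolding burk_const_def using assms by (subst powr_mult[symmetric]) auto
  have pos: "0 < g / (1 + g) * (a + b)" using assms by auto
  have "u powr (p - 2) \<le> v powr (p - 2) \<longleftrightarrow> v \<le> u" if "0 < u" "0 < v" for u v :: real
    using that p powr_less_mono2_neg[of "p-2" u v] powr_less_mono2_neg[of "p-2" v u]
    by (metis diff_less_0_iff_less less_eq_real_def linorder_not_le order_less_asym)
  then show "burk_const p g * (a + b) powr (p - 2) \<le> b powr (p - 2) \<longleftrightarrow> b \<le> g * a"
    "b powr (p - 2) \<le> burk_const p g * (a + b) powr (p - 2) \<longleftrightarrow> g * a \<le> b"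
    unfolding e using pos assms by (simp_all add: divide_simps) (simp_all add: algebra_simps)
qed

lemma burk_excess_mono:
  fixes p g a :: real
  assumes p: "1 < p" "p < 2" and g: "0 < g" and a: "0 \<le> a"
    and b: "g * a \<le> b1" "b1 \<le> b2"
  shows "burk_const p g * ((a + b1) powr (p - 1) * (b1 - a / (p - 1))) - b1 powr p
       \<le> burk_const p g * ((a + b2) powr (p - 1) * (b2 - a / (p - 1))) - b2 powr p"
proof (cases "b1 = b2")
  case False
  have b0: "0 \<le> b1" using b g a by (meson mult_nonneg_nonneg order.trans less_imp_le)
  show ?thesis
  proof (rule DERIV_nonneg_imp_increasing_open[where f = "\<lambda>b. burk_const p g * ((a + b) powr (p - 1) * (b - a / (p - 1))) - b powr p"])
    fix b assume *: "b1 < b" "b < b2"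
    then show "\<exists>y. ((\<lambda>b. burk_const p g * ((a + b) powr (p - 1) * (b - a / (p - 1))) - b powr p) has_real_derivative y) (at b) \<and> 0 \<le> y"
      using b b0 burk_const_powr_le_iff(2)[OF p(2) g a, of b] p
        burk_excess_deriv[OF p a, of b "burk_const p g"]
      by (intro exI[of _ "p * b * (burk_const p g * (a + b) powr (p - 2) - b powr (p - 2))"]) auto
  qed (use b False b0 burk_excess_continuous[OF p a] in auto)
qed auto

lemma burk_excess_antimono:
  fixes p g a :: real
  assumes p: "1 < p" "p < 2" and g: "0 < g" and a: "0 \<le> a"
    and b: "0 \<le> b1" "b1 \<le> b2" "b2 \<le> g * a"
  shows "burk_const p g * ((a + b2) powr (p - 1) * (b2 - a / (p - 1))) - b2 powr p
       \<le> burk_const p g * ((a + b1) powr (p - 1) * (b1 - a / (p - 1))) - b1 powr p"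
proof (cases "b1 = b2")
  case False
  show ?thesis
  proof (rule DERIV_nonpos_imp_decreasing_open[where f = "\<lambda>b. burk_const p g * ((a + b) powr (p - 1) * (b - a / (p - 1))) - b powr p"])
    fix b assume *: "b1 < b" "b < b2"
    then show "\<exists>y. ((\<lambda>b. burk_const p g * ((a + b) powr (p - 1) * (b - a / (p - 1))) - b powr p) has_real_derivative y) (at b) \<and> y \<le> 0"
      using b burk_const_powr_le_iff(1)[OF p(2) g a, of b] p
        burk_excess_deriv[OF p a, of b "burk_const p g"]
      by (intro exI[of _ "p * b * (burk_const p g * (a + b) powr (p - 2) - b powr (p - 2))"])
        (auto simp: mult_le_0_iff)
  qed (use b False burk_excess_continuous[OF p a] in auto)
qed auto

text \<open>Where \<open>young_const\<close> comes from: it is minus the minimal excess for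
  \<open>a = 1\<close>, and homogeneity of degree \<open>p\<close> does the rest.\<close>

lemma burk_excess_min:
  fixes p g a :: real
  assumes p: "1 < p" "p < 2" and g: "0 < g" and a: "0 \<le> a"
  shows "burk_const p g * ((a + g * a) powr (p - 1) * (g * a - a / (p - 1))) - (g * a) powr p = - young_const p g * a powr p"
proof (cases "a = 0")
  case False
  then have a: "0 < a" using a by simp
  have e1: "burk_const p g = g powr (p - 2) * (1 + g) powr (2 - p)"
    using g powr_minus_divide[of "1 + g" "p - 2"] by (simp add: burk_const_def powr_divide)
  have e2: "(a + g * a) powr (p - 1) = (1 + g) powr (p - 1) * a powr (p - 1)"
    using g a by (simp add: powr_mult[symmetric] algebra_simps)
  have e3: "(1 + g) powr (2 - p) * (1 + g) powr (p - 1) = 1 + g"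
    using g by (simp add: powr_add[symmetric])
  have e4: "a powr p = a powr (p - 1) * a" "g powr p = g powr (p - 2) * g\<^sup>2"
    using a g powr_add[of a "p - 1" 1] powr_add[of g "p - 2" 2] by (auto simp: powr_numeral)
  have "burk_const p g * ((a + g * a) powr (p - 1) * (g * a - a / (p - 1))) =
     g powr (p - 2) * ((1 + g) powr (2 - p) * (1 + g) powr (p - 1)) * a powr (p - 1) * (g * a - a / (p - 1))"
    unfolding e1 e2 by (simp only: ac_simps)
  also have "\<dots> = g powr (p - 2) * a powr (p - 1) * ((1 + g) * (g * a - a / (p - 1)))" unfolding e3 by simp
  also have "(1 + g) * (g * a - a / (p - 1)) = a * (g\<^sup>2 - (1 + (2 - p) * g) / (p - 1))"
    using p by (simp add: divide_simps) (simp add: algebra_simps power2_eq_square)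
  finally show ?thesis
    using g a unfolding young_const_def powr_mult e4 by (simp add: algebra_simps)
qed auto

lemma burkholder_majorant:
  assumes p: "1 < p" "p < 2" and g: "0 < g"
  shows "norm y powr p - young_const p g * norm x powr p \<le> burk_const p g * burkholder p x y"
proof -
  have "- young_const p g * norm x powr p \<le> burk_const p g * ((norm x + norm y) powr (p - 1) * (norm y - norm x / (p - 1))) - norm y powr p"
    using burk_excess_mono[OF p g, of "norm x" "g * norm x" "norm y"] burk_excess_antimono[OF p g, of "norm x" "norm y" "g * norm x"]
      burk_excess_min[OF p g, of "norm x"] by (cases "norm y \<le> g * norm x") auto
  then show ?thesis by (simp add: burkholder_def)
qed

text \<open>This is the slope at which \<open>burkholder\<close> itself vanishes. The constants
  become the classical ones: the norming factor of Burkholder's function and the p-th power of the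
  best constant \<open>1 / (p - 1)\<close>.\<close>

lemma burk_const_endpoint:
  assumes p: "1 < p"
  shows "burk_const p (1 / (p - 1)) = p powr (2 - p)"
    and "young_const p (1 / (p - 1)) = (p - 1) powr (- p)"
proof -
  have "(1 / (p - 1)) / (1 + 1 / (p - 1)) = 1 / p" using p by (simp add: divide_simps)
  then have "burk_const p (1 / (p - 1)) = (1 / p) powr (p - 2)" by (simp add: burk_const_def)
  also have "\<dots> = p powr (2 - p)" using p by (simp add: powr_divide powr_minus_divide[symmetric])
  finally show "burk_const p (1 / (p - 1)) = p powr (2 - p)" .
  have "young_const p (1 / (p - 1)) = (1 / (p - 1)) powr (p - 2) * (1 / (p - 1) * (1 / (p - 1)))"
    using p by (simp add: young_const_def divide_simps)
  also have "\<dots> = (1 / (p - 1)) powr p"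
    using p powr_add[of "1 / (p - 1)" "p - 2" 2] by (simp add: powr_numeral power2_eq_square)
  also have "\<dots> = (p - 1) powr (- p)" using p by (simp add: powr_divide powr_minus_divide)
  finally show "young_const p (1 / (p - 1)) = (p - 1) powr (- p)" .
qed

text \<open>With \<open>X = norm \<zeta> powr p\<close> the hypothesis is the first equation of the
  system without denominators. It equates the value at the start with \<open>Z\<close> times the
  value on the line of slope \<open>g\<close>, where the majorant touches, so the cost collapses to
  \<open>g powr p * Z\<close>.\<close>

lemma burkholder_start_value:
  assumes p: "1 < p" "p < 2" and g: "0 < g"
    and eq: "Z * ((1 - (p - 1) * g) * (1 + g) powr (p - 1)) = X * ((1 - (p - 1) * Y) * (1 + Y) powr (p - 1))"
  shows "burk_const p g * (X * ((1 + Y) powr (p - 1) * (Y - 1 / (p - 1)))) + young_const p g * Z = g powr p * Z"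
proof -
  have "X * ((1 + Y) powr (p - 1) * (Y - 1 / (p - 1))) = - (X * ((1 - (p - 1) * Y) * (1 + Y) powr (p - 1))) / (p - 1)"
    using p by (simp add: divide_simps) (simp add: algebra_simps)
  also have "\<dots> = Z * ((1 + g) powr (p - 1) * (g - 1 / (p - 1)))"
    unfolding eq[symmetric] using p by (simp add: divide_simps) (simp add: algebra_simps)
  finally have "burk_const p g * (X * ((1 + Y) powr (p - 1) * (Y - 1 / (p - 1)))) =
     Z * (burk_const p g * ((1 + g * 1) powr (p - 1) * (g * 1 - 1 / (p - 1))))" by simp
  also have "burk_const p g * ((1 + g * 1) powr (p - 1) * (g * 1 - 1 / (p - 1))) = g powr p - young_const p g"
    using burk_excess_min[OF p g, of 1] by simp
  finally show ?thesis by (simp add: algebra_simps)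
qed

lemma powr_two_mult: "0 \<le> x \<Longrightarrow> x powr (p - 2) * x\<^sup>2 = x powr p"
  for x :: real
  using powr_add[of x "p - 2" 2] by (cases "x = 0") (auto simp: powr_numeral)

lemma powr_one_mult: "0 \<le> x \<Longrightarrow> x powr (p - 1) * x = x powr p"
  for x :: real
  using powr_add[of x "p - 1" 1] by (cases "x = 0") auto

text \<open>As a function of \<open>b^2\<close> the left side is the concave power
  \<open>p / 2\<close>; the right side is its tangent at \<open>t^2\<close>.\<close>

lemma powr_le_square_tangent:
  fixes b t p :: real
  assumes "0 < p" "p < 2" "0 < t" "0 \<le> b"
  shows "b powr p \<le> p / 2 * t powr (p - 2) * b\<^sup>2 + (1 - p / 2) * t powr p"
proof (cases "b = 0")
  case False
  have "(b\<^sup>2) powr (p / 2) * (t\<^sup>2) powr (1 - p / 2) \<le> p / 2 * b\<^sup>2 + (1 - p / 2) * t\<^sup>2"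
    using assms False by (intro Youngs_inequality_0) auto
  then have "t powr (p - 2) * ((b\<^sup>2) powr (p / 2) * (t\<^sup>2) powr (1 - p / 2))
      \<le> t powr (p - 2) * (p / 2 * b\<^sup>2 + (1 - p / 2) * t\<^sup>2)"
    by (intro mult_left_mono) auto
  moreover have "(b\<^sup>2) powr (p / 2) = b powr p" "(t\<^sup>2) powr (1 - p / 2) = t powr (2 - p)"
    using assms False by (simp_all add: powr_powr right_diff_distrib flip: powr_numeral)
  moreover have "t powr (p - 2) * (b powr p * t powr (2 - p)) = b powr p"
    using assms by (simp add: powr_add[symmetric])
  moreover have "t powr (p - 2) * (p / 2 * b\<^sup>2 + (1 - p / 2) * t\<^sup>2)
      = p / 2 * t powr (p - 2) * b\<^sup>2 + (1 - p / 2) * (t powr (p - 2) * t\<^sup>2)"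
    by (simp add: algebra_simps)
  ultimately show ?thesis using powr_two_mult[of t p] assms by simp
qed (use assms in auto)

text \<open>
  For a starting point with \<open>norm x = a0\<close>, \<open>norm y = t\<close> the majorant is a truncated Burkholder
  function plus the tangent at \<open>a0\<close> of the function \<open>crit p t\<close>.
\<close>

definition crit :: "real \<Rightarrow> real \<Rightarrow> real \<Rightarrow> real" where
  "crit p t a = p / 2 * t powr (p - 2) * a\<^sup>2 - (p - 1) powr (- p) * a powr p + (1 - p / 2) * t powr p"

definition crit_deriv :: "real \<Rightarrow> real \<Rightarrow> real \<Rightarrow> real" where
  "crit_deriv p t a = p * (t powr (p - 2) * a - (p - 1) powr (- p) * a powr (p - 1))"

lemma crit_has_deriv:
  assumes "0 < a"
  shows "(crit p t has_real_derivative crit_deriv p t a) (at a)"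
  unfolding crit_def crit_deriv_def
  using assms by (auto intro!: derivative_eq_intros simp: algebra_simps)

text \<open>Concavity of \<open>crit p t\<close> up to the exit point. The second derivative
  compares \<open>t powr (p - 2)\<close> with a multiple of \<open>x powr (p - 2)\<close>; as
  \<open>p < 2\<close>, the worst case is \<open>x = (p - 1) * t\<close>, where the ratio is still
  \<open>1 / (p - 1) > 1\<close>.\<close>

lemma crit_deriv_antimono:
  assumes p: "1 < p" "p < 2" and t: "0 < t" and a: "0 \<le> a" "a \<le> b" "b \<le> (p - 1) * t"
  shows "crit_deriv p t b \<le> crit_deriv p t a"
proof (rule DERIV_nonpos_imp_decreasing_open[where f = "crit_deriv p t"])
  fix x assume x: "a < x" "x < b"
  have "(crit_deriv p t has_real_derivative p * (t powr (p - 2) - (p - 1) powr (- p) * ((p - 1) * x powr (p - 2)))) (at x)"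
    unfolding crit_deriv_def using x a by (auto intro!: derivative_eq_intros)
  moreover have "t powr (p - 2) \<le> (p - 1) powr (- p) * ((p - 1) * x powr (p - 2))"
  proof -
    have "((p - 1) * t) powr (p - 2) \<le> x powr (p - 2)"
      using x a p by (intro powr_mono2') auto
    then have "(p - 1) powr (- p) * ((p - 1) * ((p - 1) * t) powr (p - 2)) \<le> (p - 1) powr (- p) * ((p - 1) * x powr (p - 2))"
      using p by (intro mult_left_mono) auto
    moreover have "(p - 1) powr (- p) * ((p - 1) * ((p - 1) * t) powr (p - 2)) = t powr (p - 2) * (1 / (p - 1))"
    proof -
      have "(p - 1) powr (- p) * ((p - 1) powr 1 * (p - 1) powr (p - 2)) = (p - 1) powr (-1)"
        by (simp only: powr_add[symmetric]) simp
      then have "(p - 1) powr (- p) * ((p - 1) * (p - 1) powr (p - 2)) = 1 / (p - 1)"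
        using p by (simp add: powr_minus_divide)
      moreover have "(p - 1) powr (- p) * ((p - 1) * ((p - 1) * t) powr (p - 2))
          = (p - 1) powr (- p) * ((p - 1) * (p - 1) powr (p - 2)) * t powr (p - 2)"
        using p t by (simp add: powr_mult)
      ultimately show ?thesis by (simp only: mult.commute)
    qed
    moreover have "t powr (p - 2) * 1 \<le> t powr (p - 2) * (1 / (p - 1))"
      using p by (intro mult_left_mono) auto
    ultimately show ?thesis by simp
  qed
  ultimately show "\<exists>y. (crit_deriv p t has_real_derivative y) (at x) \<and> y \<le> 0"
    using p by (metis diff_le_0_iff_le less_eq_real_def mult_le_0_iff order.strict_trans zero_less_one)
next
  show "continuous_on {a..b} (crit_deriv p t)"
    unfolding crit_deriv_def using a p by (intro continuous_intros continuous_on_powr') auto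
qed (use a in auto)

lemma crit_deriv_nonpos:
  assumes "1 < p" "p < 2" "0 < t" "0 \<le> a" "a \<le> (p - 1) * t"
  shows "crit_deriv p t a \<le> 0"
  using crit_deriv_antimono[of p t 0 a] assms by (simp add: crit_deriv_def)

lemma crit_le_tangent:
  assumes p: "1 < p" "p < 2" and t: "0 < t"
    and a0: "0 \<le> a0" "a0 \<le> (p - 1) * t" and a: "0 \<le> a" "a \<le> (p - 1) * t"
  shows "crit p t a \<le> crit p t a0 + crit_deriv p t a0 * (a - a0)"
proof -
  define D where "D = (\<lambda>x. crit p t x - crit_deriv p t a0 * x)"
  have der: "(D has_real_derivative crit_deriv p t x - crit_deriv p t a0) (at x)" if "0 < x" for x
    unfolding D_def using that by (auto intro!: derivative_eq_intros crit_has_deriv)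
  have cont: "continuous_on {u..v} D" if "0 \<le> u" for u v
    unfolding D_def crit_def using that p by (intro continuous_intros continuous_on_powr') auto
  have "D a \<le> D a0"
  proof (cases "a \<le> a0")
    case True
    show ?thesis
    proof (rule DERIV_nonneg_imp_increasing_open[OF True _ cont])
      fix x assume "a < x" "x < a0"
      then show "\<exists>y. (D has_real_derivative y) (at x) \<and> 0 \<le> y"
        using a a0 crit_deriv_antimono[OF p t, of x a0] by (intro exI[of _ "crit_deriv p t x - crit_deriv p t a0"] conjI der) auto
    qed (use a in auto)
  next
    case False
    show ?thesis
    proof (rule DERIV_nonpos_imp_decreasing_open[OF _ _ cont])
      fix x assume "a0 < x" "x < a"
      then show "\<exists>y. (D has_real_derivative y) (at x) \<and> y \<le> 0"
        using a a0 crit_deriv_antimono[OF p t, of a0 x] by (intro exI[of _ "crit_deriv p t x - crit_deriv p t a0"] conjI der) auto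
    qed (use False a0 in auto)
  qed
  then show ?thesis by (simp add: D_def algebra_simps)
qed

text \<open>The tangent at the exit point is exactly minus the terms by which the outer branch of
  the scaled \<open>burk_trunc\<close> differs from Burkholder's function. In
  \<open>exit_majorant\<close> it therefore cancels \<open>K\<close>.\<close>

lemma crit_tangent_at_exit:
  assumes p: "1 < p" "p < 2" and t: "0 < t"
  shows "crit p t ((p - 1) * t) + crit_deriv p t ((p - 1) * t) * (a - (p - 1) * t)
       = (2 - p) * p\<^sup>2 * t powr (p - 2) * t\<^sup>2 / 2 - p\<^sup>2 * (2 - p) * t powr (p - 2) * t * a / (p - 1)"
proof -
  have e: "(p - 1) powr (- p) * ((p - 1) * t) powr p = t powr (p - 2) * t\<^sup>2"
    "(p - 1) powr (- p) * ((p - 1) * t) powr (p - 1) = t powr (p - 2) * t / (p - 1)"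
  proof -
    have "(p - 1) powr (- p) * (p - 1) powr p = 1" using p by (simp add: powr_add[symmetric])
    then show "(p - 1) powr (- p) * ((p - 1) * t) powr p = t powr (p - 2) * t\<^sup>2"
      using t p by (simp add: powr_mult powr_two_mult)
    have "(p - 1) powr (- p) * (p - 1) powr (p - 1) = (p - 1) powr (- 1)"
      by (simp only: powr_add[symmetric]) simp
    then have "(p - 1) powr (- p) * (p - 1) powr (p - 1) = 1 / (p - 1)"
      using p by (simp add: powr_minus_divide)
    moreover have "(p - 1) powr (- p) * ((p - 1) * t) powr (p - 1)
        = (p - 1) powr (- p) * (p - 1) powr (p - 1) * (t powr (p - 2) * t)"
      using t p powr_add[of t "p - 2" 1] by (simp add: powr_mult)
    ultimately show "(p - 1) powr (- p) * ((p - 1) * t) powr (p - 1) = t powr (p - 2) * t / (p - 1)"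
      by simp
  qed
  have e2: "t powr p = t powr (p - 2) * t\<^sup>2" using t by (simp add: powr_two_mult)
  show ?thesis unfolding crit_def crit_deriv_def e e2
    using p by (simp add: divide_simps) (simp add: algebra_simps power2_eq_square)
qed

text \<open>Burkholder's function with this constant touches the obstacle along
  \<open>norm y = norm x / (p - 1)\<close>. To touch it at a start above that line, a truncated
  function is used: in its quadratic core the excess over \<open>b powr p\<close> is least at
  \<open>b = t\<close> for every \<open>a\<close>. What remains is the concave function
  \<open>crit p t\<close> of \<open>a\<close>, which is absorbed by its tangent at
  \<open>a0\<close>.\<close>

lemma exit_majorant:
  fixes p t a0 :: real
  assumes p: "1 < p" "p < 2" and t: "0 < t" and a0: "0 \<le> a0" "a0 \<le> (p - 1) * t"
  shows "\<exists>U::'a::real_inner \<Rightarrow> 'a \<Rightarrow> real. zigzag_concave U \<and>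
     (\<forall>x y. norm y powr p - (p - 1) powr (- p) * norm x powr p \<le> U x y) \<and>
     (\<forall>x y. norm x = a0 \<longrightarrow> norm y = t \<longrightarrow> U x y = t powr p - (p - 1) powr (- p) * a0 powr p)"
proof -
  define s where "s = t powr (p - 2)"
  \<comment> \<open>\<open>A\<close> is the norming factor at slope \<open>1 / (p - 1)\<close>.
    \<open>C\<close> scales \<open>burk_trunc\<close> so that its outer branch has leading
    coefficient \<open>A\<close>; the saddle in the core then has the coefficient
    \<open>p / 2 * s\<close> of \<open>powr_le_square_tangent\<close>.\<close>
  define A where "A = p powr (2 - p)"
  define C where "C = A * p * (2 - p) / 2"
  define l where "l = (\<lambda>a. crit p t a0 + crit_deriv p t a0 * (a - a0))"
  \<comment> \<open>Radius \<open>p * t\<close>: the line \<open>norm y = norm x / (p - 1)\<close>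
    leaves the diamond exactly at \<open>norm x = (p - 1) * t\<close>,
    \<open>norm y = t\<close>.\<close>
  define U where "U = (\<lambda>(x::'a) (y::'a). C * burk_trunc p (p * t) x y + l (norm x))"
  have C0: "0 \<le> C" using p by (simp add: C_def A_def)
  have "zigzag_concave U"
  proof -
    have "zigzag_concave (\<lambda>(x::'a) (y::'a). (crit p t a0 - crit_deriv p t a0 * a0) + crit_deriv p t a0 * norm x)"
      using crit_deriv_nonpos[OF p t a0] by (rule zigzag_concave_affine_norm)
    then have "zigzag_concave (\<lambda>(x::'a) (y::'a). l (norm x))" by (simp add: l_def algebra_simps)
    then show ?thesis unfolding U_def using p t
      by (intro zigzag_concave_add zigzag_concave_cmult zigzag_concave_burk_trunc C0) auto
  qed
  moreover define \<phi>1 where "\<phi>1 = (\<lambda>a b. p / 2 * s * (b\<^sup>2 - a\<^sup>2))"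
  define K where "K = (\<lambda>a. - ((2 - p) * p\<^sup>2 * s * t\<^sup>2 / 2) + p\<^sup>2 * (2 - p) * s * t * a / (p - 1))"
  define \<phi>2 where "\<phi>2 = (\<lambda>a b. A * ((a + b) powr (p - 1) * (b - a / (p - 1))) + K a)"
  have As: "A * (p * t) powr (p - 2) = s"
  proof -
    have "A * p powr (p - 2) = 1" using p by (simp add: A_def powr_add[symmetric])
    then show ?thesis using p t by (simp add: powr_mult s_def)
  qed
  have burk: "C * burk_trunc p (p * t) x y = (if norm x + norm y \<le> p * t then \<phi>1 (norm x) (norm y) else \<phi>2 (norm x) (norm y))"
    for x y :: 'a
  proof -
    have 1: "C * ((p * t) powr (p - 2) / (2 - p) * D) = p / 2 * s * D" for D
    proof -
      have "C * ((p * t) powr (p - 2) / (2 - p) * D) = p / 2 * (A * (p * t) powr (p - 2)) * D"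
        using p by (simp add: C_def divide_simps)
      then show ?thesis by (simp add: As)
    qed
    have 2: "C * (p * t) powr p = p / 2 * (2 - p) * s * (p * t)\<^sup>2" "C * (p * t) powr (p - 1) = p / 2 * (2 - p) * s * (p * t)"
    proof -
      have "(p * t) powr p = (p * t) powr (p - 2) * (p * t)\<^sup>2" "(p * t) powr (p - 1) = (p * t) powr (p - 2) * (p * t)"
        using p t powr_two_mult[of "p * t" p] powr_add[of "p * t" "p - 2" 1] by auto
      then show "C * (p * t) powr p = p / 2 * (2 - p) * s * (p * t)\<^sup>2" "C * (p * t) powr (p - 1) = p / 2 * (2 - p) * s * (p * t)"
        unfolding As[symmetric] C_def by simp_all
    qed
    have "C * (2 / (p * (2 - p)) * W - (p * t) powr p / p + 2 * n * (p * t) powr (p - 1) / (p - 1)) = A * W + K n" for W n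
    proof -
      have "C * (2 / (p * (2 - p)) * W - (p * t) powr p / p + 2 * n * (p * t) powr (p - 1) / (p - 1))
        = C * (2 / (p * (2 - p))) * W - (C * (p * t) powr p) / p + 2 * n * (C * (p * t) powr (p - 1)) / (p - 1)"
        by (simp add: algebra_simps)
      also have "C * (2 / (p * (2 - p))) = A" using p by (simp add: C_def)
      finally show ?thesis unfolding 2 K_def using p by (simp add: divide_simps) (simp add: algebra_simps power2_eq_square)
    qed
    then show ?thesis using 1 by (auto simp: burk_trunc_def \<phi>1_def \<phi>2_def Let_def)
  qed
  have match: "\<phi>1 a b = \<phi>2 a b" if "a + b = p * t" for a b
  proof -
    have b: "b = p * t - a" using that by simp
    have e: "A * ((a + b) powr (p - 1) * (b - a / (p - 1))) = s * (p * t) * (b - a / (p - 1))"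
      unfolding that As[symmetric] using p t powr_add[of "p * t" "p - 2" 1] by simp
    show ?thesis unfolding \<phi>1_def \<phi>2_def K_def e unfolding b
      using p by (simp add: divide_simps) (simp add: algebra_simps power2_eq_square)
  qed
  note ends = burk_const_endpoint[OF p(1), folded A_def]
  have g: "0 < 1 / (p - 1)" using p by simp
  have \<phi>2_mono: "\<phi>2 a b1 - b1 powr p \<le> \<phi>2 a b2 - b2 powr p" if "0 \<le> a" "a / (p - 1) \<le> b1" "b1 \<le> b2" for a b1 b2
    using burk_excess_mono[OF p g, of a b1 b2] that unfolding ends \<phi>2_def by simp
  have \<phi>2_min: "- ((p - 1) powr (- p) * a powr p) + K a \<le> \<phi>2 a b - b powr p" if "0 \<le> a" "0 \<le> b" for a b
    using burk_excess_min[OF p g, of a] burk_excess_mono[OF p g, of a "1 / (p - 1) * a" b]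
      burk_excess_antimono[OF p g, of a b "1 / (p - 1) * a"] that
    unfolding ends \<phi>2_def by (cases "b \<le> 1 / (p - 1) * a") auto
  have \<phi>1_min: "- (p / 2 * s * a\<^sup>2) - (1 - p / 2) * t powr p \<le> \<phi>1 a b - b powr p" if "0 \<le> b" for a b
    using powr_le_square_tangent[of p t b] p t that unfolding \<phi>1_def s_def by (simp add: algebra_simps)
  have \<phi>1_antimono: "\<phi>1 a b2 - b2 powr p \<le> \<phi>1 a b1 - b1 powr p" if "0 \<le> b1" "b1 \<le> b2" "b2 \<le> t" for a b1 b2
  proof (rule DERIV_nonpos_imp_decreasing_open[where f = "\<lambda>b. \<phi>1 a b - b powr p"])
    fix b assume b: "b1 < b" "b < b2"
    have "((\<lambda>b. \<phi>1 a b - b powr p) has_real_derivative p * (s * b - b powr (p - 1))) (at b)"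
      unfolding \<phi>1_def using b that by (auto intro!: derivative_eq_intros simp: algebra_simps)
    moreover have "s * b \<le> b powr (p - 1)"
    proof -
      have "s \<le> b powr (p - 2)" unfolding s_def using b that p by (intro powr_mono2') auto
      then have "s * b \<le> b powr (p - 2) * b" using b that by (intro mult_right_mono) auto
      then show ?thesis using powr_add[of b "p - 2" 1] b that by simp
    qed
    ultimately show "\<exists>y. ((\<lambda>b. \<phi>1 a b - b powr p) has_real_derivative y) (at b) \<and> y \<le> 0"
      using p by (metis diff_le_0_iff_le less_eq_real_def mult_le_0_iff order.strict_trans zero_less_one)
  next
    show "continuous_on {b1..b2} (\<lambda>b. \<phi>1 a b - b powr p)"
      unfolding \<phi>1_def using that p by (intro continuous_intros continuous_on_powr') auto
  qed (use that in auto)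
  have "norm y powr p - (p - 1) powr (- p) * norm x powr p \<le> U x y" for x y :: 'a
  proof -
    define a b where "a = norm x" and "b = norm y"
    have ab: "0 \<le> a" "0 \<le> b" by (auto simp: a_def b_def)
    define V where "V = (if a + b \<le> p * t then \<phi>1 a b else \<phi>2 a b)"
    have "b powr p - (p - 1) powr (- p) * a powr p \<le> V + l a"
    proof (cases "a \<le> (p - 1) * t")
      case True
      then have at: "t \<le> p * t - a" "a / (p - 1) \<le> t" using p by (auto simp: field_simps)
      have "- (p / 2 * s * a\<^sup>2) - (1 - p / 2) * t powr p \<le> V - b powr p"
      proof (cases "a + b \<le> p * t")
        \<comment> \<open>Outside the diamond the excess has only grown since the boundary point
          \<open>b = p * t - a\<close>, where the branches agree.\<close>
        case False
        then show ?thesis using \<phi>1_min[of "p * t - a" a] match[of a "p * t - a"] \<phi>2_mono[of a "p * t - a" b] at ab t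
          by (simp add: V_def)
      qed (use \<phi>1_min ab in \<open>simp add: V_def\<close>)
      moreover have "crit p t a \<le> l a" unfolding l_def by (rule crit_le_tangent[OF p t a0 ab(1) True])
      ultimately show ?thesis by (simp add: crit_def s_def)
    next
      \<comment> \<open>Beyond the exit point the outer branch is bounded by its minimum and
        \<open>l\<close> by the exit tangent, which cancels \<open>K\<close>.\<close>
      case False
      have "- ((p - 1) powr (- p) * a powr p) + K a \<le> V - b powr p"
      proof (cases "a + b \<le> p * t")
        case True
        then show ?thesis using \<phi>1_antimono[of b "p * t - a" a] match[of a "p * t - a"] \<phi>2_min[of a "p * t - a"] False ab
          by (simp add: V_def algebra_simps)
      qed (use \<phi>2_min ab in \<open>simp add: V_def\<close>)
      moreover have "0 \<le> K a + l a"
      proof -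
        let ?e = "(p - 1) * t"
        have "crit p t ?e \<le> l ?e" unfolding l_def using p t by (intro crit_le_tangent[OF p t a0]) auto
        moreover have "crit_deriv p t ?e * (a - ?e) \<le> crit_deriv p t a0 * (a - ?e)"
          using False crit_deriv_antimono[OF p t a0(1,2)] by (intro mult_right_mono) auto
        ultimately have "crit p t ?e + crit_deriv p t ?e * (a - ?e) \<le> l a" unfolding l_def by (simp add: algebra_simps)
        then show ?thesis unfolding crit_tangent_at_exit[OF p t] K_def s_def by simp
      qed
      ultimately show ?thesis by simp
    qed
    then show ?thesis unfolding U_def burk V_def a_def b_def .
  qed
  moreover have "U x y = t powr p - (p - 1) powr (- p) * a0 powr p" if "norm x = a0" "norm y = t" for x y :: 'a
  proof -
    have "a0 + t \<le> p * t" using a0 by (simp add: algebra_simps)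
    moreover have "s * t\<^sup>2 = t powr p" using t by (simp add: s_def powr_two_mult)
    ultimately show ?thesis using that by (simp add: U_def burk l_def \<phi>1_def crit_def s_def[symmetric] algebra_simps)
  qed
  ultimately show ?thesis by blast
qed

section \<open>Sums over dyadic trees\<close>

text \<open>Weights are relative to the node \<open>(n, k)\<close>, which counts with weight 1
  whatever \<open>n\<close> is. Nodes carry arbitrary vectors instead of averages, so that
  inductions need only midpoint relations.\<close>

primrec tree_sum ::
    "(nat \<Rightarrow> nat \<Rightarrow> 'a::real_normed_vector) \<Rightarrow> (nat \<Rightarrow> nat \<Rightarrow> 'a) \<Rightarrow> nat \<Rightarrow> nat \<Rightarrow> nat \<Rightarrow> real" where
  "tree_sum F G 0 n k = 0"
| "tree_sum F G (Suc N) n k =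
     norm (F (n + 1) (2 * k + 1) - F (n + 1) (2 * k)) * norm (G (n + 1) (2 * k + 1) - G (n + 1) (2 * k))
     + (tree_sum F G N (n + 1) (2 * k) + tree_sum F G N (n + 1) (2 * k + 1)) / 2"

lemma sum_lessThan_add: "(\<Sum>j<a + b. f j) = (\<Sum>j<a. f j) + (\<Sum>j<b. f (a + j))"
  for f :: "nat \<Rightarrow> 'b::comm_monoid_add"
  by (induction b) (auto simp: add.assoc)

lemma tree_sum_eq:
  "tree_sum F G N n k = (\<Sum>m<N. \<Sum>j<2 ^ m.
     norm (F (n + m + 1) (2 * (2 ^ m * k + j) + 1) - F (n + m + 1) (2 * (2 ^ m * k + j))) *
     norm (G (n + m + 1) (2 * (2 ^ m * k + j) + 1) - G (n + m + 1) (2 * (2 ^ m * k + j))) / 2 ^ m)"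
proof (induction N arbitrary: n k)
  case (Suc N)
  define D where "D = (\<lambda>n k. norm (F (n + 1) (2 * k + 1) - F (n + 1) (2 * k)) * norm (G (n + 1) (2 * k + 1) - G (n + 1) (2 * k)))"
  have IH: "tree_sum F G N n k = (\<Sum>m<N. \<Sum>j<2 ^ m. D (n + m) (2 ^ m * k + j) / 2 ^ m)" for n k
    by (simp add: Suc.IH D_def)
  have "(\<Sum>j<2 ^ Suc m. D (n + Suc m) (2 ^ Suc m * k + j) / 2 ^ Suc m) =
     ((\<Sum>j<2 ^ m. D (n + 1 + m) (2 ^ m * (2 * k) + j) / 2 ^ m)
      + (\<Sum>j<2 ^ m. D (n + 1 + m) (2 ^ m * (2 * k + 1) + j) / 2 ^ m)) / 2" for m
  proof -
    have "(\<Sum>j<2 ^ Suc m. f j) = (\<Sum>j<2 ^ m. f j) + (\<Sum>j<2 ^ m. f (2 ^ m + j))" for f :: "nat \<Rightarrow> real"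
      using sum_lessThan_add[of f "2 ^ m" "2 ^ m"] by (simp add: mult_2)
    then show ?thesis
      by (simp only:) (simp add: sum_divide_distrib[symmetric] add_divide_distrib algebra_simps)
  qed
  then have "(\<Sum>m<Suc N. \<Sum>j<2 ^ m. D (n + m) (2 ^ m * k + j) / 2 ^ m) =
     D n k + (tree_sum F G N (n + 1) (2 * k) + tree_sum F G N (n + 1) (2 * k + 1)) / 2"
    unfolding IH sum.lessThan_Suc_shift
    by (simp only: sum.distrib sum_divide_distrib[symmetric]) simp
  then show ?case by (simp add: D_def)
qed simp

lemma exists_aligned:
  fixes h w :: "'a::real_inner"
  shows "\<exists>v. norm v = norm h \<and> v \<bullet> w = norm h * norm w"
proof (cases "w = 0")
  case False
  then show ?thesis
    by (intro exI[of _ "(norm h / norm w) *\<^sub>R w"]) (auto simp: power2_norm_eq_inner[symmetric] power2_eq_square)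
next
  case True
  then show ?thesis by (intro exI[of _ h]) auto
qed

text \<open>
  Adding \<open>g \<bullet> G n k\<close> encodes the transformed martingale: it starts at \<open>g\<close>, and in each step it
  moves by a vector as long as the step of \<open>F\<close>, in the direction of the step of \<open>G\<close>.
\<close>

lemma tree_sum_upper_bound:
  fixes F G :: "nat \<Rightarrow> nat \<Rightarrow> 'a::real_inner"
  assumes U: "zigzag_concave U"
    and maj: "\<And>x y. norm y powr p - c * norm x powr p \<le> U x y"
    and young: "\<And>a b. 0 \<le> a \<Longrightarrow> 0 \<le> b \<Longrightarrow> a * b \<le> \<kappa> * a powr p + \<mu> * b powr q"
    and nonneg: "0 \<le> c" "0 \<le> \<kappa>" "0 \<le> \<mu>"
    and F: "\<And>n k. k < 2 ^ n \<Longrightarrow> 2 *\<^sub>R F n k = F (n + 1) (2 * k) + F (n + 1) (2 * k + 1)"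
    and G: "\<And>n k. k < 2 ^ n \<Longrightarrow> 2 *\<^sub>R G n k = G (n + 1) (2 * k) + G (n + 1) (2 * k + 1)"
    and Zf: "\<And>n k. k < 2 ^ n \<Longrightarrow> 2 * Zf n k = Zf (n + 1) (2 * k) + Zf (n + 1) (2 * k + 1)"
    and Hf: "\<And>n k. k < 2 ^ n \<Longrightarrow> 2 * Hf n k = Hf (n + 1) (2 * k) + Hf (n + 1) (2 * k + 1)"
    and FZ: "\<And>n k. k < 2 ^ n \<Longrightarrow> norm (F n k) powr p \<le> Zf n k"
    and GH: "\<And>n k. k < 2 ^ n \<Longrightarrow> norm (G n k) powr q \<le> Hf n k"
    and k: "k < 2 ^ n"
  shows "tree_sum F G N n k / 4 + g \<bullet> G n k \<le> \<kappa> * (U (F n k) g + c * Zf n k) + \<mu> * Hf n k"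
  using k
proof (induction N arbitrary: n k g)
  case 0
  \<comment> \<open>Stopping at a leaf: only here are Young's inequality and the majorant property
    used.\<close>
  have "g \<bullet> G n k \<le> norm g * norm (G n k)" by (rule norm_cauchy_schwarz)
  also have "\<dots> \<le> \<kappa> * norm g powr p + \<mu> * norm (G n k) powr q" by (intro young) auto
  also have "\<dots> \<le> \<kappa> * (U (F n k) g + c * Zf n k) + \<mu> * Hf n k"
  proof (intro add_mono mult_left_mono nonneg GH 0)
    show "norm g powr p \<le> U (F n k) g + c * Zf n k"
      using maj[of g "F n k"] mult_left_mono[OF FZ[OF 0] nonneg(1)] by linarith
  qed
  finally show ?case by simp
next
  case (Suc N)
  define h where "h = (1 / 2) *\<^sub>R (F (n + 1) (2 * k + 1) - F (n + 1) (2 * k))"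
  define w where "w = G (n + 1) (2 * k + 1) - G (n + 1) (2 * k)"
  obtain v where v: "norm v = norm h" "v \<bullet> w = norm h * norm w" using exists_aligned by blast
  have Fh: "F (n + 1) (2 * k + 1) = F n k + h" "F (n + 1) (2 * k) = F n k - h"
  proof -
    have "2 *\<^sub>R (F n k + h) = 2 *\<^sub>R F (n + 1) (2 * k + 1)" "2 *\<^sub>R (F n k - h) = 2 *\<^sub>R F (n + 1) (2 * k)"
      using F[OF Suc.prems] unfolding h_def scaleR_add_right scaleR_diff_right by (simp_all add: scaleR_2)
    then show "F (n + 1) (2 * k + 1) = F n k + h" "F (n + 1) (2 * k) = F n k - h"
      by (metis scaleR_cancel_left zero_neq_numeral)+
  qed
  have Gw: "(g + v) \<bullet> G (n + 1) (2 * k + 1) + (g - v) \<bullet> G (n + 1) (2 * k) = 2 * (g \<bullet> G n k) + norm h * norm w"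
  proof -
    have "(g + v) \<bullet> G (n + 1) (2 * k + 1) + (g - v) \<bullet> G (n + 1) (2 * k) =
      g \<bullet> (G (n + 1) (2 * k) + G (n + 1) (2 * k + 1)) + v \<bullet> w"
      by (simp add: w_def inner_simps)
    then show ?thesis unfolding G[OF Suc.prems, symmetric] v(2) by simp
  qed
  have jump: "norm (F (n + 1) (2 * k + 1) - F (n + 1) (2 * k)) = 2 * norm h" by (simp add: h_def)
  have "tree_sum F G N (n + 1) (2 * k + 1) / 4 + (g + v) \<bullet> G (n + 1) (2 * k + 1)
      \<le> \<kappa> * (U (F n k + h) (g + v) + c * Zf (n + 1) (2 * k + 1)) + \<mu> * Hf (n + 1) (2 * k + 1)"
    using Suc.IH[of "2 * k + 1" "n + 1" "g + v"] Suc.prems unfolding Fh by simp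
  moreover have "tree_sum F G N (n + 1) (2 * k) / 4 + (g - v) \<bullet> G (n + 1) (2 * k)
      \<le> \<kappa> * (U (F n k - h) (g - v) + c * Zf (n + 1) (2 * k)) + \<mu> * Hf (n + 1) (2 * k)"
    using Suc.IH[of "2 * k" "n + 1" "g - v"] Suc.prems unfolding Fh by simp
  moreover have "\<kappa> * (U (F n k + h) (g + v) + c * Zf (n + 1) (2 * k + 1)) + \<kappa> * (U (F n k - h) (g - v) + c * Zf (n + 1) (2 * k))
      \<le> 2 * (\<kappa> * (U (F n k) g + c * Zf n k))"
  proof -
    have "U (F n k + h) (g + v) + U (F n k - h) (g - v) + c * (Zf (n + 1) (2 * k) + Zf (n + 1) (2 * k + 1))
       \<le> 2 * U (F n k) g + c * (2 * Zf n k)"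
      using zigzag_concaveD[OF U v(1)] unfolding Zf[OF Suc.prems, symmetric] by simp
    from mult_left_mono[OF this nonneg(2)] show ?thesis by (simp add: algebra_simps)
  qed
  moreover have "\<mu> * Hf (n + 1) (2 * k + 1) + \<mu> * Hf (n + 1) (2 * k) = 2 * (\<mu> * Hf n k)"
    using arg_cong[OF Hf[OF Suc.prems], of "\<lambda>x. \<mu> * x"] by (simp add: algebra_simps)
  \<comment> \<open>Linear bookkeeping with \<open>d\<close> for \<open>norm h * norm w\<close>. The
    full jump of \<open>F\<close> is \<open>2 * h\<close>, so a node contributes
    \<open>2 * d / 4\<close>, half of the gain \<open>d\<close> that the rotated step adds to the
    two inner products. The factor 1 / 4 in \<open>bellman_sup\<close> fits exactly.\<close>
  moreover have "t1 / 4 + i1 \<le> a1 + b1 \<Longrightarrow> t2 / 4 + i2 \<le> a2 + b2 \<Longrightarrow> a1 + a2 \<le> 2 * a \<Longrightarrow>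
      b1 + b2 = 2 * b \<Longrightarrow> i1 + i2 = 2 * i + d \<Longrightarrow> (2 * d + (t2 + t1) / 2) / 4 + i \<le> a + b"
    for t1 t2 i1 i2 a1 a2 b1 b2 a b i d :: real
    by (simp add: field_simps)
  ultimately show ?case using Gw unfolding tree_sum.simps jump w_def[symmetric] mult.assoc by blast
qed

lemma lebesgue_dyadic: "dyadic n k \<in> sets lebesgue" "measure lebesgue (dyadic n k) = 1 / 2 ^ n"
  "emeasure lebesgue (dyadic n k) = ennreal (1 / 2 ^ n)"
proof -
  have "real k / 2 ^ n \<le> real (k + 1) / 2 ^ n" by (simp add: divide_right_mono)
  then show e: "emeasure lebesgue (dyadic n k) = ennreal (1 / 2 ^ n)"
    by (simp add: dyadic_def diff_divide_distrib[symmetric])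
  then show "measure lebesgue (dyadic n k) = 1 / 2 ^ n" by (simp add: measure_def)
qed (auto simp: dyadic_def)

abbreviation haar_sum :: "(real \<Rightarrow> 'a::real_normed_vector) \<Rightarrow> (real \<Rightarrow> 'a) \<Rightarrow> ennreal" where
  "haar_sum \<phi> \<psi> \<equiv> (\<Sum>\<^sub>\<infinity>(n, k)\<in>dyadic_indices.
     ennreal (norm (jump \<phi> n k) * norm (jump \<psi> n k) * measure lebesgue (dyadic n k)))"

lemma dyadic_sum_eq:
  fixes \<phi> \<psi> :: "real \<Rightarrow> 'a::real_normed_vector"
  shows "(\<Sum>(n, k)\<in>(SIGMA n:{..<N}. {..<2 ^ n}).
        ennreal (norm (jump \<phi> n k) * norm (jump \<psi> n k) * measure lebesgue (dyadic n k)))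
    = ennreal (tree_sum (\<lambda>n k. average (dyadic n k) \<phi>) (\<lambda>n k. average (dyadic n k) \<psi>) N 0 0)"
proof -
  have "(\<Sum>(n, k)\<in>(SIGMA n:{..<N}. {..<2 ^ n}).
        norm (jump \<phi> n k) * norm (jump \<psi> n k) * measure lebesgue (dyadic n k))
     = tree_sum (\<lambda>n k. average (dyadic n k) \<phi>) (\<lambda>n k. average (dyadic n k) \<psi>) N 0 0"
    unfolding tree_sum_eq by (subst sum.Sigma[symmetric]) (auto simp: jump_def lebesgue_dyadic)
  then show ?thesis by (simp add: case_prod_unfold sum_ennreal)
qed

lemma dyadic_infsum_le:
  fixes \<phi> \<psi> :: "real \<Rightarrow> 'a::real_normed_vector"
  assumes "\<And>N. tree_sum (\<lambda>n k. average (dyadic n k) \<phi>) (\<lambda>n k. average (dyadic n k) \<psi>) N 0 0 \<le> B"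
  shows "haar_sum \<phi> \<psi> \<le> ennreal B"
proof (rule infsum_le_finite_sums)
  fix A assume A: "finite A" "A \<subseteq> dyadic_indices"
  \<comment> \<open>\<open>insert 0\<close> keeps \<open>Max\<close> meaningful for empty
    \<open>A\<close>.\<close>
  define N where "N = Suc (Max (insert 0 (fst ` A)))"
  have "A \<subseteq> (SIGMA n:{..<N}. {..<2 ^ n})"
  proof
    fix z assume z: "z \<in> A"
    then have "fst z \<le> Max (insert 0 (fst ` A))" using A by (intro Max_ge) auto
    then have "fst z < N" by (simp add: N_def)
    then show "z \<in> (SIGMA n:{..<N}. {..<2 ^ n})" using A z by (auto simp: dyadic_indices_def)
  qed
  then have "(\<Sum>(n, k)\<in>A. ennreal (norm (jump \<phi> n k) * norm (jump \<psi> n k) * measure lebesgue (dyadic n k)))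
    \<le> (\<Sum>(n, k)\<in>(SIGMA n:{..<N}. {..<2 ^ n}). ennreal (norm (jump \<phi> n k) * norm (jump \<psi> n k) * measure lebesgue (dyadic n k)))"
    by (intro sum_mono2) auto
  also have "\<dots> \<le> ennreal B" unfolding dyadic_sum_eq by (intro ennreal_leI assms)
  finally show "(\<Sum>(n, k)\<in>A. ennreal (norm (jump \<phi> n k) * norm (jump \<psi> n k) * measure lebesgue (dyadic n k))) \<le> ennreal B" .
qed (rule nonneg_summable_on_complete, simp)

lemma dyadic_infsum_ge:
  fixes \<phi> \<psi> :: "real \<Rightarrow> 'a::real_normed_vector"
  shows "ennreal (tree_sum (\<lambda>n k. average (dyadic n k) \<phi>) (\<lambda>n k. average (dyadic n k) \<psi>) N 0 0)
     \<le> haar_sum \<phi> \<psi>"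
proof -
  have "(SIGMA n:{..<N}. {..<2 ^ n}) \<subseteq> dyadic_indices" by (auto simp: dyadic_indices_def)
  then show ?thesis
    unfolding dyadic_sum_eq[symmetric]
    by (subst infsum_finite[symmetric], simp, intro infsum_mono_neutral nonneg_summable_on_complete) auto
qed

section \<open>Strong integrals in Hilbert spaces\<close>

abbreviation "strong_simple \<equiv> Bochner_Integration.simple_bochner_integrable"

abbreviation "strong_simple_integral \<equiv> Bochner_Integration.simple_bochner_integral"

text \<open>In a non-separable space measurability of a difference is not automatic. But
  \<open>s\<close> has finitely many values, and for each of them only \<open>norm (f x - y)\<close>
  with a fixed \<open>y\<close> occurs.\<close>

lemma borel_measurable_norm_diff_simple:
  fixes f s :: "'a \<Rightarrow> 'b::real_normed_vector"
  assumes f: "f \<in> borel_measurable M" and s: "simple_function M s"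
  shows "(\<lambda>x. norm (f x - s x)) \<in> borel_measurable M"
proof (rule measurable_compose_countable'[where f = "\<lambda>y x. norm (f x - y)" and g = s and I = "s ` space M"])
  fix y
  show "(\<lambda>x. norm (f x - y)) \<in> borel_measurable M"
    by (rule borel_measurable_continuous_on[OF _ f]) (auto intro!: continuous_intros)
next
  have fin: "finite (s ` space M)" using s by (rule simple_functionD)
  then show "countable (s ` space M)" by (rule countable_finite)
  show "s \<in> measurable M (count_space (s ` space M))"
    using s by (subst measurable_count_space_eq2[OF fin]) (auto simp: simple_function_def)
qed

lemma simple_bochner_integral_dist_le:
  fixes f s t :: "'a \<Rightarrow> 'b::real_normed_vector"
  assumes f: "f \<in> borel_measurable M"
    and s: "strong_simple M s"
    and t: "strong_simple M t"
  shows "ennreal (dist (strong_simple_integral M s) (strong_simple_integral M t)) \<le>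
    (\<integral>\<^sup>+ x. norm (f x - s x) \<partial>M) + (\<integral>\<^sup>+ x. norm (f x - t x) \<partial>M)"
proof -
  have st: "simple_function M s" "simple_function M t"
    using s t by (auto elim: simple_bochner_integrable.cases)
  have "ennreal (dist (strong_simple_integral M s) (strong_simple_integral M t))
     = norm (strong_simple_integral M (\<lambda>x. s x - t x))"
    using s t by (subst simple_bochner_integral_diff) (auto simp: dist_norm)
  also have "\<dots> \<le> strong_simple_integral M (\<lambda>x. norm (s x - t x))"
    using simple_bochner_integrable_compose2[of "(-)" M s t] s t
    by (auto intro!: simple_bochner_integral_norm_bound)
  also have "\<dots> = (\<integral>\<^sup>+x. norm (s x - t x) \<partial>M)"
    using simple_bochner_integrable_compose2[of "\<lambda>x y. norm (x - y)" M s t] s t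
    by (auto intro!: simple_bochner_integral_eq_nn_integral)
  also have "\<dots> \<le> (\<integral>\<^sup>+x. ennreal (norm (f x - s x)) + ennreal (norm (f x - t x)) \<partial>M)"
  proof (intro nn_integral_mono)
    fix x
    have "norm (s x - t x) \<le> norm (f x - s x) + norm (f x - t x)"
      by (metis dual_order.refl norm_diff_triangle_le norm_minus_commute)
    then show "ennreal (norm (s x - t x)) \<le> ennreal (norm (f x - s x)) + ennreal (norm (f x - t x))"
      by (metis ennreal_leI ennreal_plus norm_ge_zero)
  qed
  also have "\<dots> = (\<integral>\<^sup>+ x. norm (f x - s x) \<partial>M) + (\<integral>\<^sup>+ x. norm (f x - t x) \<partial>M)"
    using borel_measurable_norm_diff_simple[OF f st(1)] borel_measurable_norm_diff_simple[OF f st(2)]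
    by (intro nn_integral_add) auto
  finally show ?thesis .
qed

text \<open>Integrability is given on \<open>{0..<1}\<close>, while the averages live on
  subintervals. The simple functions that work for \<open>M\<close> also work on \<open>B\<close>;
  their integrals there form a Cauchy sequence, and completeness supplies the limit.\<close>

lemma has_strong_integral_restrict_space:
  fixes f :: "'a \<Rightarrow> 'b::{real_normed_vector, complete_space}"
  assumes "has_strong_integral M f y" and B: "B \<in> sets M"
  shows "\<exists>z. has_strong_integral (restrict_space M B) f z"
proof -
  from assms(1) obtain s where f: "f \<in> borel_measurable M"
    and s: "\<And>i. strong_simple M (s i)"
    and lim: "(\<lambda>i. \<integral>\<^sup>+x. ennreal (norm (f x - s i x)) \<partial>M) \<longlonglongrightarrow> 0"
    unfolding has_strong_integral.simps by blast
  define N where "N = restrict_space M B"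
  have BM: "B \<inter> space M = B" using sets.sets_into_space[OF B] by auto
  have spN: "space N = B" using BM by (simp add: N_def space_restrict_space Int_commute)
  have setsN: "A \<in> sets N" if "A \<in> sets M" "A \<subseteq> B" for A
    unfolding N_def using that B BM by (subst sets_restrict_space_iff) auto
  have fN: "f \<in> borel_measurable N" unfolding N_def by (rule measurable_restrict_space1[OF f])
  have sN: "strong_simple N (s i)" for i
  proof
    have sf: "simple_function M (s i)" and fin: "emeasure M {y \<in> space M. s i y \<noteq> 0} \<noteq> \<infinity>"
      using s[of i] by (auto elim: simple_bochner_integrable.cases)
    have *: "s i -` {y} \<inter> B \<in> sets M" for y
    proof -
      have "s i -` {y} \<inter> B = (s i -` {y} \<inter> space M) \<inter> B" using BM by auto
      also have "\<dots> \<in> sets M" using sf B by (intro sets.Int simple_functionD(2)) auto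
      finally show ?thesis .
    qed
    show "simple_function N (s i)"
      unfolding simple_function_def spN
    proof (intro conjI ballI setsN *)
      show "finite (s i ` B)"
        using sf BM by (intro finite_subset[OF _ simple_functionD(1)[OF sf]]) auto
    qed auto
    have m: "{y \<in> space M. s i y \<noteq> 0} \<in> sets M"
    proof -
      have "{y \<in> space M. s i y \<noteq> 0} = s i -` (UNIV - {0}) \<inter> space M" by auto
      then show ?thesis using sf simple_functionD(2) by metis
    qed
    have "emeasure N {y \<in> space N. s i y \<noteq> 0} = emeasure M {y \<in> B. s i y \<noteq> 0}"
      unfolding spN unfolding N_def using B BM by (subst emeasure_restrict_space) auto
    also have "\<dots> \<le> emeasure M {y \<in> space M. s i y \<noteq> 0}"
      using m BM by (intro emeasure_mono) auto
    finally show "emeasure N {y \<in> space N. s i y \<noteq> 0} \<noteq> \<infinity>"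
      using fin by (auto simp: top_unique)
  qed
  have limN: "(\<lambda>i. \<integral>\<^sup>+x. ennreal (norm (f x - s i x)) \<partial>N) \<longlonglongrightarrow> 0"
  proof (rule tendsto_sandwich[OF _ _ tendsto_const lim])
    show "\<forall>\<^sub>F i in sequentially. (\<integral>\<^sup>+x. ennreal (norm (f x - s i x)) \<partial>N) \<le> (\<integral>\<^sup>+x. ennreal (norm (f x - s i x)) \<partial>M)"
      unfolding N_def using B BM
      by (subst nn_integral_restrict_space) (auto intro!: always_eventually nn_integral_mono simp: indicator_def)
  qed auto
  have "Cauchy (\<lambda>i. strong_simple_integral N (s i))"
  proof (rule metric_CauchyI)
    fix e :: real assume e: "0 < e"
    then have "eventually (\<lambda>i. (\<integral>\<^sup>+x. ennreal (norm (f x - s i x)) \<partial>N) < ennreal (e / 2)) sequentially"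
      by (intro order_tendstoD(2)[OF limN]) auto
    then obtain K where K: "\<And>i. K \<le> i \<Longrightarrow> (\<integral>\<^sup>+x. ennreal (norm (f x - s i x)) \<partial>N) < ennreal (e / 2)"
      by (auto simp: eventually_sequentially)
    show "\<exists>K. \<forall>m\<ge>K. \<forall>n\<ge>K. dist (strong_simple_integral N (s m)) (strong_simple_integral N (s n)) < e"
    proof (intro exI allI impI)
      fix m n assume "K \<le> m" "K \<le> n"
      then have "(\<integral>\<^sup>+x. ennreal (norm (f x - s m x)) \<partial>N) + (\<integral>\<^sup>+x. ennreal (norm (f x - s n x)) \<partial>N)
          < ennreal (e / 2) + ennreal (e / 2)"
        using K by (intro add_strict_mono) auto
      also have "\<dots> = ennreal e" using e by (simp flip: ennreal_plus)
      finally have "ennreal (dist (strong_simple_integral N (s m)) (strong_simple_integral N (s n))) < ennreal e"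
        using simple_bochner_integral_dist_le[OF fN sN sN, of m n] by (rule order.strict_trans1[rotated])
      then show "dist (strong_simple_integral N (s m)) (strong_simple_integral N (s n)) < e"
        by (simp add: ennreal_less_iff)
    qed
  qed
  then have "convergent (\<lambda>i. strong_simple_integral N (s i))"
    by (rule Cauchy_convergent)
  then obtain z where "(\<lambda>i. strong_simple_integral N (s i)) \<longlonglongrightarrow> z"
    by (auto simp: convergent_def)
  then show ?thesis
    using has_strong_integral.intros[of f N s z] fN sN limN unfolding N_def by blast
qed

text \<open>Used with an inner product, to reduce to real integrals, and with multiples of a fixed
  vector, to build examples.\<close>

lemma has_strong_integral_bounded_linear:
  fixes f :: "'a \<Rightarrow> 'b::real_normed_vector" and T :: "'b \<Rightarrow> 'c::real_normed_vector"
  assumes "has_strong_integral M f y" and T: "bounded_linear T"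
  shows "has_strong_integral M (\<lambda>x. T (f x)) (T y)"
proof -
  interpret T: bounded_linear T by fact
  from assms(1) obtain s where f: "f \<in> borel_measurable M"
    and s: "\<And>i. strong_simple M (s i)"
    and lim: "(\<lambda>i. \<integral>\<^sup>+x. ennreal (norm (f x - s i x)) \<partial>M) \<longlonglongrightarrow> 0"
    and y: "(\<lambda>i. strong_simple_integral M (s i)) \<longlonglongrightarrow> y"
    unfolding has_strong_integral.simps by blast
  obtain K where K: "0 \<le> K" "\<And>x. norm (T x) \<le> norm x * K" using T.nonneg_bounded by blast
  show ?thesis
  proof (rule has_strong_integral.intros[where s = "\<lambda>i x. T (s i x)"])
    show "(\<lambda>x. T (f x)) \<in> borel_measurable M"
      by (rule borel_measurable_continuous_on[OF _ f]) (rule T.continuous_on[OF continuous_on_id])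
    show "strong_simple M (\<lambda>x. T (s i x))" for i
      using s[of i] by (intro simple_bochner_integrable_compose2[where p = "\<lambda>x y. T x" and g = "s i"]) auto
    have "(\<lambda>i. strong_simple_integral M (\<lambda>x. T (s i x))) = (\<lambda>i. T (strong_simple_integral M (s i)))"
      using s by (intro ext simple_bochner_integral_linear T.linear_axioms)
    then show "(\<lambda>i. strong_simple_integral M (\<lambda>x. T (s i x))) \<longlonglongrightarrow> T y"
      using T.tendsto[OF y] by simp
    have "(\<lambda>i. ennreal K * (\<integral>\<^sup>+x. ennreal (norm (f x - s i x)) \<partial>M)) \<longlonglongrightarrow> ennreal K * 0"
      by (intro ennreal_tendsto_cmult lim) auto
    then have lim': "(\<lambda>i. ennreal K * (\<integral>\<^sup>+x. ennreal (norm (f x - s i x)) \<partial>M)) \<longlonglongrightarrow> 0" by simp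
    show "(\<lambda>i. \<integral>\<^sup>+x. ennreal (norm (T (f x) - T (s i x))) \<partial>M) \<longlonglongrightarrow> 0"
    proof (rule tendsto_sandwich[OF _ _ tendsto_const lim'])
      show "\<forall>\<^sub>F i in sequentially. (\<integral>\<^sup>+x. ennreal (norm (T (f x) - T (s i x))) \<partial>M)
          \<le> ennreal K * (\<integral>\<^sup>+x. ennreal (norm (f x - s i x)) \<partial>M)"
      proof (intro always_eventually allI)
        fix i
        have "simple_function M (s i)" using s[of i] by (auto elim: simple_bochner_integrable.cases)
        then have "(\<lambda>x. norm (f x - s i x)) \<in> borel_measurable M" by (rule borel_measurable_norm_diff_simple[OF f])
        then have "ennreal K * (\<integral>\<^sup>+x. ennreal (norm (f x - s i x)) \<partial>M) = (\<integral>\<^sup>+x. ennreal K * ennreal (norm (f x - s i x)) \<partial>M)"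
          by (intro nn_integral_cmult[symmetric]) auto
        moreover have "(\<integral>\<^sup>+x. ennreal (norm (T (f x) - T (s i x))) \<partial>M) \<le> (\<integral>\<^sup>+x. ennreal K * ennreal (norm (f x - s i x)) \<partial>M)"
        proof (intro nn_integral_mono)
          fix x
          have "norm (T (f x) - T (s i x)) \<le> K * norm (f x - s i x)"
            using K(2)[of "f x - s i x"] by (simp add: T.diff mult.commute)
          then show "ennreal (norm (T (f x) - T (s i x))) \<le> ennreal K * ennreal (norm (f x - s i x))"
            using K(1) by (simp add: ennreal_mult[symmetric] ennreal_leI)
        qed
        ultimately show "(\<integral>\<^sup>+x. ennreal (norm (T (f x) - T (s i x))) \<partial>M)
          \<le> ennreal K * (\<integral>\<^sup>+x. ennreal (norm (f x - s i x)) \<partial>M)" by simp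
      qed
    qed auto
  qed
qed

lemma has_bochner_integral_inner_strong:
  fixes f :: "'a \<Rightarrow> 'b::real_inner"
  assumes "has_strong_integral M f y"
  shows "has_bochner_integral M (\<lambda>x. f x \<bullet> v) (y \<bullet> v)"
  using has_strong_integral_bounded_linear[OF assms bounded_linear_inner_left[of v]]
  by (simp add: has_strong_integral_iff_has_bochner_integral)

text \<open>Tested against every vector \<open>v\<close>, uniqueness becomes that of real Bochner
  integrals.\<close>

lemma strong_integral_eq:
  fixes f :: "'a \<Rightarrow> 'b::real_inner"
  assumes "has_strong_integral M f y"
  shows "strong_integral M f = y"
  unfolding strong_integral_def
proof (rule the_equality[where P = "has_strong_integral M f", OF assms])
  fix z assume "has_strong_integral M f z"
  then have "z \<bullet> v = y \<bullet> v" for v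
    using has_bochner_integral_eq has_bochner_integral_inner_strong assms by blast
  then show "z = y" by (metis vector_eq_rdot)
qed

lemma average_inner:
  fixes f :: "real \<Rightarrow> 'b::{real_inner, complete_space}"
  assumes f: "strong_integrable (lebesgue_on A) f" and A: "A \<in> sets lebesgue" and B: "B \<in> sets lebesgue" "B \<subseteq> A"
  shows "set_integrable lebesgue B (\<lambda>x. f x \<bullet> v)"
    and "average B f \<bullet> v = (LINT x:B|lebesgue. f x \<bullet> v) / measure lebesgue B"
proof -
  have BA: "lebesgue_on B = restrict_space (lebesgue_on A) B"
    using B by (simp add: restrict_restrict_space A Int_absorb1 inf.absorb2)
  have "B \<in> sets (lebesgue_on A)" using A B by (subst sets_restrict_space_iff) auto
  then obtain z where z: "has_strong_integral (lebesgue_on B) f z"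
    using has_strong_integral_restrict_space f unfolding BA strong_integrable_def by blast
  have i: "has_bochner_integral (lebesgue_on B) (\<lambda>x. f x \<bullet> v) (z \<bullet> v)"
    by (rule has_bochner_integral_inner_strong[OF z])
  then show "set_integrable lebesgue B (\<lambda>x. f x \<bullet> v)"
    using B by (simp add: has_bochner_integral_iff integrable_restrict_space set_integrable_def)
  have "z \<bullet> v = (LINT x:B|lebesgue. f x \<bullet> v)"
    using i B by (simp add: has_bochner_integral_iff integral_restrict_space set_lebesgue_integral_def)
  then show "average B f \<bullet> v = (LINT x:B|lebesgue. f x \<bullet> v) / measure lebesgue B"
    by (simp add: average_def strong_integral_eq[OF z])
qed

lemma powr_ge_tangent:
  fixes a m p :: real
  assumes "1 < p" "0 < m" "0 \<le> a"
  shows "m powr p + p * m powr (p - 1) * (a - m) \<le> a powr p"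
proof -
  define q where "q = p / (p - 1)"
  have q: "1 < q" "1 / p + 1 / q = 1" "(p - 1) * q = p" "1 / q = (p - 1) / p"
    using assms by (auto simp: q_def field_simps)
  have "a * m powr (p - 1) \<le> a powr p / p + (m powr (p - 1)) powr q / q"
    using assms q by (intro Youngs_inequality) auto
  also have "(m powr (p - 1)) powr q / q = (p - 1) * m powr p / p"
    using q(3) q(4) by (simp add: powr_powr divide_inverse)
  finally have "p * (a * m powr (p - 1)) \<le> a powr p + (p - 1) * m powr p"
    using assms by (simp add: field_simps)
  moreover have "m powr p = m powr (p - 1) * m" using assms by (simp add: powr_one_mult)
  ultimately show ?thesis by (simp add: algebra_simps)
qed

text \<open>Jensen's inequality by duality: pairing with the unit vector \<open>e\<close> along the
  average gives a real integral, and the tangent of the power at \<open>m\<close> bounds the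
  integrand.\<close>

lemma norm_average_powr_le:
  fixes f :: "real \<Rightarrow> 'b::{real_inner, complete_space}"
  assumes f: "strong_integrable (lebesgue_on A) f" and A: "A \<in> sets lebesgue" and B: "B \<in> lmeasurable" "B \<subseteq> A"
    and pos: "0 < measure lebesgue B" and p: "1 < p" and int: "set_integrable lebesgue B (\<lambda>x. norm (f x) powr p)"
  shows "norm (average B f) powr p \<le> (LINT x:B|lebesgue. norm (f x) powr p) / measure lebesgue B"
proof (cases "average B f = 0")
  case True
  have "0 \<le> (LINT x:B|lebesgue. norm (f x) powr p)"
    unfolding set_lebesgue_integral_def by (intro integral_nonneg_AE) auto
  then show ?thesis using True p by simp
next
  case False
  define m where "m = norm (average B f)"
  define e where "e = (1 / m) *\<^sub>R average B f"
  have m: "0 < m" using False by (simp add: m_def)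
  have e: "norm e = 1" "average B f \<bullet> e = m"
    using m by (simp_all add: e_def m_def power2_norm_eq_inner[symmetric] power2_eq_square)
  have Bs: "B \<in> sets lebesgue" using B by (auto dest: fmeasurableD)
  note av = average_inner[OF f A Bs B(2), of e]
  define k where "k = p * m powr (p - 1)"
  have const: "set_integrable lebesgue B (\<lambda>x. c)" for c :: real
    using B(1) by (auto simp: set_integrable_def fmeasurable_def intro!: integrable_real_indicator integrable_mult_left)
  have const_eq: "(LINT x:B|lebesgue. c) = c * measure lebesgue B" for c :: real
    using B(1) by (simp add: set_lebesgue_integral_def fmeasurable_def)
  have "(LINT x:B|lebesgue. (m powr p - k * m) + k * (f x \<bullet> e)) \<le> (LINT x:B|lebesgue. norm (f x) powr p)"
  proof (intro set_integral_mono set_integral_add set_integrable_mult_right const av int)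
    fix x
    have "m powr p + k * (norm (f x) - m) \<le> norm (f x) powr p"
      unfolding k_def using m p by (intro powr_ge_tangent) auto
    moreover have "k * (f x \<bullet> e) \<le> k * norm (f x)"
      using norm_cauchy_schwarz[of "f x" e] e p unfolding k_def by (intro mult_left_mono) auto
    ultimately show "(m powr p - k * m) + k * (f x \<bullet> e) \<le> norm (f x) powr p" by (simp add: algebra_simps)
  qed
  moreover have "(LINT x:B|lebesgue. (m powr p - k * m) + k * (f x \<bullet> e)) =
      (m powr p - k * m) * measure lebesgue B + k * (LINT x:B|lebesgue. f x \<bullet> e)"
    by (subst set_integral_add) (auto intro!: const av simp: const_eq)
  moreover have "(LINT x:B|lebesgue. f x \<bullet> e) = m * measure lebesgue B"
    using av(2) e(2) pos by (simp add: field_simps)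
  ultimately have "m powr p * measure lebesgue B \<le> (LINT x:B|lebesgue. norm (f x) powr p)"
    by (simp add: algebra_simps)
  then show ?thesis using pos by (simp add: m_def pos_le_divide_eq)
qed

section \<open>The upper bound\<close>

lemma dyadic_zero: "dyadic 0 0 = {0..<1}"
  by (simp add: dyadic_def)

lemma dyadic_split:
  "dyadic n k = dyadic (n + 1) (2 * k) \<union> dyadic (n + 1) (2 * k + 1)"
  "dyadic (n + 1) (2 * k) \<inter> dyadic (n + 1) (2 * k + 1) = {}"
proof -
  define d :: real where "d = 2 ^ n"
  have d: "0 < d" by (simp add: d_def)
  have "real k / d = real (2 * k) / (2 * d)" "real (k + 1) / d = real (2 * k + 1 + 1) / (2 * d)"
    by (simp_all add: add_divide_distrib)
  moreover have "real (2 * k) / (2 * d) \<le> real (2 * k + 1) / (2 * d)" "real (2 * k + 1) / (2 * d) \<le> real (2 * k + 1 + 1) / (2 * d)"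
    using d by (simp_all add: field_simps)
  ultimately show "dyadic n k = dyadic (n + 1) (2 * k) \<union> dyadic (n + 1) (2 * k + 1)"
    "dyadic (n + 1) (2 * k) \<inter> dyadic (n + 1) (2 * k + 1) = {}"
    unfolding dyadic_def power_add power_one_right mult.commute[of _ 2] d_def[symmetric] by auto
qed

lemma dyadic_subset:
  assumes "k < 2 ^ n"
  shows "dyadic n k \<subseteq> {0..<1}"
proof -
  have "real (k + 1) \<le> 2 ^ n" using assms by (metis Suc_eq_plus1 Suc_leI of_nat_le_iff of_nat_numeral of_nat_power)
  then have "real (k + 1) / 2 ^ n \<le> 1" by (simp add: divide_le_eq_1)
  then show ?thesis by (auto simp: dyadic_def intro: order.trans[rotated] order.strict_trans2)
qed

lemma dyadic_mean_split:
  fixes h :: "real \<Rightarrow> real"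
  assumes "set_integrable lebesgue (dyadic n k) h"
  shows "2 * ((LINT x:dyadic n k|lebesgue. h x) / measure lebesgue (dyadic n k)) =
     (LINT x:dyadic (n + 1) (2 * k)|lebesgue. h x) / measure lebesgue (dyadic (n + 1) (2 * k))
   + (LINT x:dyadic (n + 1) (2 * k + 1)|lebesgue. h x) / measure lebesgue (dyadic (n + 1) (2 * k + 1))"
proof -
  have "(LINT x:dyadic n k|lebesgue. h x) = (LINT x:dyadic (n + 1) (2 * k)|lebesgue. h x) + (LINT x:dyadic (n + 1) (2 * k + 1)|lebesgue. h x)"
    unfolding dyadic_split(1)[of n k] using dyadic_split[of n k] assms
    by (intro set_integral_Un) (auto intro: set_integrable_subset simp: lebesgue_dyadic)
  then show ?thesis by (simp add: lebesgue_dyadic algebra_simps)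
qed

lemma average_dyadic_split:
  fixes f :: "real \<Rightarrow> 'b::{real_inner, complete_space}"
  assumes f: "strong_integrable (lebesgue_on {0..<1}) f" and k: "k < 2 ^ n"
  shows "2 *\<^sub>R average (dyadic n k) f = average (dyadic (n + 1) (2 * k)) f + average (dyadic (n + 1) (2 * k + 1)) f"
proof -
  have k': "2 * k < 2 ^ (n + 1)" "2 * k + 1 < 2 ^ (n + 1)" using k by auto
  note av = average_inner[OF f _ lebesgue_dyadic(1)]
  have "(2 *\<^sub>R average (dyadic n k) f) \<bullet> v = (average (dyadic (n + 1) (2 * k)) f + average (dyadic (n + 1) (2 * k + 1)) f) \<bullet> v" for v
    using dyadic_mean_split[OF av(1)[OF _ dyadic_subset[OF k]], of v]
    by (simp add: inner_add_left av(2)[OF _ dyadic_subset[OF k]] av(2)[OF _ dyadic_subset[OF k'(1)]]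
        av(2)[OF _ dyadic_subset[OF k'(2)]] del: One_nat_def add_Suc_right)
  then show ?thesis by (metis vector_eq_rdot)
qed

lemma strong_integrable_powr_integrable:
  fixes f :: "real \<Rightarrow> 'b::{real_inner, complete_space}"
  assumes f: "strong_integrable (lebesgue_on {0..<1}) f" and Z: "0 \<le> Z"
    and le: "(\<integral>\<^sup>+x. ennreal (norm (f x) powr p) \<partial>lebesgue_on {0..<1}) \<le> ennreal Z"
  shows "set_integrable lebesgue {0..<1} (\<lambda>x. norm (f x) powr p)"
    and "(LINT x:{0..<1}|lebesgue. norm (f x) powr p) \<le> Z"
proof -
  have "f \<in> borel_measurable (lebesgue_on {0..<1})"
    using f by (auto simp: strong_integrable_def has_strong_integral.simps)
  then have "(\<lambda>x. norm (f x)) \<in> borel_measurable (lebesgue_on {0..<1})"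
    by (rule borel_measurable_continuous_on[rotated]) (auto intro!: continuous_intros)
  then have m: "(\<lambda>x. norm (f x) powr p) \<in> borel_measurable (lebesgue_on {0..<1})" by measurable
  have i: "integrable (lebesgue_on {0..<1}) (\<lambda>x. norm (f x) powr p)"
    using le by (intro integrableI_bounded m) (auto simp: order_le_less_trans)
  then show "set_integrable lebesgue {0..<1} (\<lambda>x. norm (f x) powr p)"
    by (simp add: integrable_restrict_space set_integrable_def)
  have "ennreal (integral\<^sup>L (lebesgue_on {0..<1}) (\<lambda>x. norm (f x) powr p)) \<le> ennreal Z"
    using le by (subst nn_integral_eq_integral[symmetric]) (auto intro: i)
  then show "(LINT x:{0..<1}|lebesgue. norm (f x) powr p) \<le> Z"
    using Z by (simp add: integral_restrict_space set_lebesgue_integral_def)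
qed

lemma norm_average_dyadic_powr_le:
  fixes f :: "real \<Rightarrow> 'b::{real_inner, complete_space}"
  assumes f: "strong_integrable (lebesgue_on {0..<1}) f" and p: "1 < p" and k: "k < 2 ^ n"
    and i: "set_integrable lebesgue {0..<1} (\<lambda>x. norm (f x) powr p)"
  shows "norm (average (dyadic n k) f) powr p
     \<le> (LINT x:dyadic n k|lebesgue. norm (f x) powr p) / measure lebesgue (dyadic n k)"
proof (rule norm_average_powr_le[OF f _ _ dyadic_subset[OF k] _ p])
  show "dyadic n k \<in> lmeasurable" by (simp add: fmeasurable_def lebesgue_dyadic)
  show "set_integrable lebesgue (dyadic n k) (\<lambda>x. norm (f x) powr p)"
    using dyadic_subset[OF k] by (intro set_integrable_subset[OF i]) (auto simp: lebesgue_dyadic)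
qed (auto simp: lebesgue_dyadic)

text \<open>Everything is reduced to choosing \<open>U\<close>, the start \<open>g\<close> and the
  Young weights. The estimate of a finite tree does not depend on its depth, so it passes to the
  infinite sum.\<close>

lemma bellman_sup_le:
  fixes \<zeta> \<eta> g :: "'b::{real_inner, complete_space}"
  assumes p: "1 < p" and q: "1 < q" and ZH: "0 \<le> Z" "0 \<le> H"
    and U: "zigzag_concave U"
    and maj: "\<And>x y. norm y powr p - c * norm x powr p \<le> U x y"
    and young: "\<And>a b. 0 \<le> a \<Longrightarrow> 0 \<le> b \<Longrightarrow> a * b \<le> \<kappa> * a powr p + \<mu> * b powr q"
    and nonneg: "0 \<le> c" "0 \<le> \<kappa>" "0 \<le> \<mu>"
  shows "bellman_sup p q \<zeta> \<eta> Z H \<le> ennreal (\<kappa> * (U \<zeta> g + c * Z) + \<mu> * H - g \<bullet> \<eta>)"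
proof -
  define B where "B = \<kappa> * (U \<zeta> g + c * Z) + \<mu> * H - g \<bullet> \<eta>"
  have "haar_sum \<phi> \<psi> \<le> ennreal (4 * B)"
    if "(\<phi>, \<psi>) \<in> admissible p q \<zeta> \<eta> Z H" for \<phi> \<psi>
  proof (rule dyadic_infsum_le)
    fix N
    have \<phi>: "strong_integrable (lebesgue_on {0..<1}) \<phi>" and \<psi>: "strong_integrable (lebesgue_on {0..<1}) \<psi>"
      and av: "average {0..<1} \<phi> = \<zeta>" "average {0..<1} \<psi> = \<eta>"
      and \<phi>Z: "(\<integral>\<^sup>+x. ennreal (norm (\<phi> x) powr p) \<partial>lebesgue_on {0..<1}) \<le> ennreal Z"
      and \<psi>H: "(\<integral>\<^sup>+x. ennreal (norm (\<psi> x) powr q) \<partial>lebesgue_on {0..<1}) \<le> ennreal H"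
      using that by (auto simp: admissible_def)
    note i\<phi> = strong_integrable_powr_integrable[OF \<phi> ZH(1) \<phi>Z]
    note i\<psi> = strong_integrable_powr_integrable[OF \<psi> ZH(2) \<psi>H]
    define Zf where "Zf = (\<lambda>n k. (LINT x:dyadic n k|lebesgue. norm (\<phi> x) powr p) / measure lebesgue (dyadic n k))"
    define Hf where "Hf = (\<lambda>n k. (LINT x:dyadic n k|lebesgue. norm (\<psi> x) powr q) / measure lebesgue (dyadic n k))"
    have "tree_sum (\<lambda>n k. average (dyadic n k) \<phi>) (\<lambda>n k. average (dyadic n k) \<psi>) N 0 0 / 4 + g \<bullet> average (dyadic 0 0) \<psi>
       \<le> \<kappa> * (U (average (dyadic 0 0) \<phi>) g + c * Zf 0 0) + \<mu> * Hf 0 0"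
    proof (rule tree_sum_upper_bound[OF U maj young nonneg, where Zf = Zf and Hf = Hf])
      fix n k :: nat assume k: "k < 2 ^ n"
      show "2 * Zf n k = Zf (n + 1) (2 * k) + Zf (n + 1) (2 * k + 1)"
        unfolding Zf_def using dyadic_subset[OF k]
        by (intro dyadic_mean_split set_integrable_subset[OF i\<phi>(1)]) (auto simp: lebesgue_dyadic)
      show "2 * Hf n k = Hf (n + 1) (2 * k) + Hf (n + 1) (2 * k + 1)"
        unfolding Hf_def using dyadic_subset[OF k]
        by (intro dyadic_mean_split set_integrable_subset[OF i\<psi>(1)]) (auto simp: lebesgue_dyadic)
      show "norm (average (dyadic n k) \<phi>) powr p \<le> Zf n k"
        unfolding Zf_def by (rule norm_average_dyadic_powr_le[OF \<phi> p k i\<phi>(1)])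
      show "norm (average (dyadic n k) \<psi>) powr q \<le> Hf n k"
        unfolding Hf_def by (rule norm_average_dyadic_powr_le[OF \<psi> q k i\<psi>(1)])
    qed (auto intro: average_dyadic_split \<phi> \<psi> simp del: One_nat_def add_Suc_right)
    moreover have "Zf 0 0 \<le> Z" "Hf 0 0 \<le> H"
      using i\<phi>(2) i\<psi>(2) by (simp_all add: Zf_def Hf_def dyadic_zero)
    then have "\<kappa> * (U \<zeta> g + c * Zf 0 0) + \<mu> * Hf 0 0 \<le> \<kappa> * (U \<zeta> g + c * Z) + \<mu> * H"
      using nonneg by (intro add_mono mult_left_mono) auto
    ultimately show "tree_sum (\<lambda>n k. average (dyadic n k) \<phi>) (\<lambda>n k. average (dyadic n k) \<psi>) N 0 0 \<le> 4 * B"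
      unfolding dyadic_zero av B_def by argo
  qed
  then have "(SUP (\<phi>, \<psi>) \<in> admissible p q \<zeta> \<eta> Z H.
        haar_sum \<phi> \<psi>) \<le> ennreal (4 * B)"
    by (auto intro!: SUP_least)
  then have "bellman_sup p q \<zeta> \<eta> Z H \<le> ennreal (1 / 4) * ennreal (4 * B)"
    unfolding bellman_sup_def by (intro mult_left_mono) auto
  also have "\<dots> = ennreal B" by (subst ennreal_mult'[symmetric]) auto
  finally show ?thesis by (simp add: B_def)
qed

section \<open>Optimising the weights in Young's inequality\<close>

lemma scaled_young:
  fixes p q \<kappa> a b :: real
  assumes "1 < p" "q = p / (p - 1)" "0 < \<kappa>" "0 \<le> a" "0 \<le> b"
  shows "a * b \<le> \<kappa> / p * a powr p + \<kappa> powr (1 - q) / q * b powr q"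
proof -
  have q: "1 < q" "1 / p + 1 / q = 1" "(1 / p) * q = q - 1"
    unfolding assms(2) using assms(1) by (simp_all add: divide_simps)
  define k where "k = \<kappa> powr (1 / p)"
  have k: "0 < k" "k powr p = \<kappa>" "(1 / k) powr q = \<kappa> powr (1 - q)"
  proof -
    show "0 < k" "k powr p = \<kappa>" using assms by (simp_all add: k_def powr_powr)
    have "(1 / k) powr q = (\<kappa> powr (- (1 / p))) powr q" using powr_minus_divide[of \<kappa> "1 / p"] by (simp add: k_def)
    also have "\<dots> = \<kappa> powr (1 - q)" using q(3) by (simp add: powr_powr)
    finally show "(1 / k) powr q = \<kappa> powr (1 - q)" .
  qed
  have "(k * a) * ((1 / k) * b) \<le> (k * a) powr p / p + ((1 / k) * b) powr q / q"
    using assms q k by (intro Youngs_inequality) auto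
  moreover have "(k * a) powr p = \<kappa> * a powr p" using assms k by (simp add: powr_mult)
  moreover have "((1 / k) * b) powr q = \<kappa> powr (1 - q) * b powr q"
    using assms k by (subst powr_mult) auto
  ultimately show ?thesis using k by simp
qed

lemma conjugate_exponent:
  fixes p q :: real
  assumes "1 < p" "q = p / (p - 1)"
  shows "1 < q" "1 / p + 1 / q = 1" "q / p = q - 1" "p / q = p - 1" "(p - 1) * q = p" "(q - 1) * p = q"
    "(1 - q) / q = - (1 / p)" "1 / (p - 1) * p = q"
  unfolding assms(2) using assms(1) by (simp_all add: divide_simps)

lemma ennreal_le_epsilon_real:
  assumes "\<And>e. 0 < e \<Longrightarrow> b \<le> ennreal (t + e)"
  shows "b \<le> ennreal t"
proof (cases "0 \<le> t")
  case True
  show ?thesis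
  proof (rule ennreal_le_epsilon)
    fix e :: real assume "0 < e"
    then show "b \<le> ennreal t + ennreal e" using assms[of e] True by (simp add: ennreal_plus)
  qed
next
  case False
  then show ?thesis using assms[of "-t"] by simp
qed

text \<open>For positive \<open>A\<close> and \<open>H\<close> the chosen weight gives equality in
  Young's inequality. If exactly one of them vanishes, the infimum is 0 but not attained, hence the
  \<open>e\<close>.\<close>

lemma weighted_young_inf:
  fixes p q A H e :: real
  assumes p: "1 < p" and q: "q = p / (p - 1)" and "0 \<le> A" "0 \<le> H" "0 < e"
  shows "\<exists>\<kappa>>0. \<kappa> / p * A + \<kappa> powr (1 - q) / q * H \<le> A powr (1 / p) * H powr (1 / q) + e"
proof -
  note c = conjugate_exponent[OF p q]
  consider "0 < A" "0 < H" | "H = 0" | "A = 0" using assms by linarith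
  then show ?thesis
  proof cases
    case 1
    define \<kappa> where "\<kappa> = (H / A) powr (1 / q)"
    have "\<kappa> * A = H powr (1 / q) * (A powr (1 / q + 1 / p) / A powr (1 / q))"
      using 1 c(2) by (simp add: \<kappa>_def powr_divide add.commute)
    also have "\<dots> = A powr (1 / p) * H powr (1 / q)" using 1 by (simp add: powr_add)
    finally have a: "\<kappa> * A = A powr (1 / p) * H powr (1 / q)" .
    have "\<kappa> powr (1 - q) = (H / A) powr (- (1 / p))"
      using c(7) by (simp add: \<kappa>_def powr_powr)
    then have "\<kappa> powr (1 - q) * H = A powr (1 / p) * (H powr (1 / q + 1 / p) / H powr (1 / p))"
      using 1 c(2) by (simp add: powr_minus_divide powr_divide add.commute)
    also have "\<dots> = A powr (1 / p) * H powr (1 / q)" using 1 by (simp add: powr_add)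
    finally have b: "\<kappa> powr (1 - q) * H = A powr (1 / p) * H powr (1 / q)" .
    have "\<kappa> / p * A + \<kappa> powr (1 - q) / q * H = (1 / p) * (\<kappa> * A) + (1 / q) * (\<kappa> powr (1 - q) * H)" by simp
    also have "\<dots> = (1 / p + 1 / q) * (A powr (1 / p) * H powr (1 / q))" unfolding a b by (simp add: algebra_simps)
    finally show ?thesis using 1 assms c(2) by (intro exI[of _ \<kappa>]) (auto simp: \<kappa>_def)
  next
    case 2
    have "p * e / (A + 1) / p * A \<le> e" using assms by (simp add: divide_simps)
    then show ?thesis using 2 assms by (intro exI[of _ "p * e / (A + 1)"]) auto
  next
    case 3
    define \<kappa> where "\<kappa> = (e * q / (H + 1)) powr (1 / (1 - q))"
    have "\<kappa> powr (1 - q) = e * q / (H + 1)" using assms c(1) by (simp add: \<kappa>_def powr_powr)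
    then have "\<kappa> powr (1 - q) / q * H = e * (H / (H + 1))" using c(1) by simp
    also have "\<dots> \<le> e * 1" using assms by (intro mult_left_mono) auto
    finally have "\<kappa> powr (1 - q) / q * H \<le> e" by simp
    then show ?thesis using 3 assms c(1) by (intro exI[of _ \<kappa>]) (auto simp: \<kappa>_def)
  qed
qed

lemma le_of_weighted_young:
  fixes b :: ennreal
  assumes p: "1 < p" and q: "q = p / (p - 1)" and "0 \<le> A" "0 \<le> H"
    and le: "\<And>\<kappa>. 0 < \<kappa> \<Longrightarrow> b \<le> ennreal (\<kappa> / p * A + \<kappa> powr (1 - q) / q * H - D)"
  shows "b \<le> ennreal (A powr (1 / p) * H powr (1 / q) - D)"
proof (rule ennreal_le_epsilon_real)
  fix e :: real assume "0 < e"
  then obtain \<kappa> where "0 < \<kappa>" "\<kappa> / p * A + \<kappa> powr (1 - q) / q * H \<le> A powr (1 / p) * H powr (1 / q) + e"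
    using weighted_young_inf[OF p q] assms by blast
  then show "b \<le> ennreal (A powr (1 / p) * H powr (1 / q) - D + e)"
    by (intro order.trans[OF le[of \<kappa>]] ennreal_leI) auto
qed

section \<open>Upper bounds in the two regimes\<close>

context
  fixes p q Z H :: real and \<zeta> \<eta> :: "'a::{real_inner, complete_space}"
  assumes p: "1 < p" "p < 2" and q: "q = p / (p - 1)" and ZH: "0 \<le> Z" "0 \<le> H"
begin

lemmas conj_facts = conjugate_exponent[OF p(1) q]

lemma bellman_sup_le_burkholder:
  assumes g: "0 < g" and \<kappa>: "0 < \<kappa>"
  shows "bellman_sup p q \<zeta> \<eta> Z H \<le>
     ennreal (\<kappa> / p * (burk_const p g * burkholder p \<zeta> v + young_const p g * Z) + \<kappa> powr (1 - q) / q * H - v \<bullet> \<eta>)"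
proof (rule bellman_sup_le[OF p(1) conj_facts(1) ZH])
  show "zigzag_concave (\<lambda>x y. burk_const p g * burkholder p x y)"
    by (intro zigzag_concave_cmult zigzag_concave_burkholder p) (simp add: burk_const_def)
  show "norm y powr p - young_const p g * norm x powr p \<le> burk_const p g * burkholder p x y" for x y :: 'a
    by (rule burkholder_majorant[OF p g])
  show "0 \<le> young_const p g" using p g by (simp add: young_const_def)
qed (use scaled_young[OF p(1) q] p conj_facts(1) \<kappa> in auto)

text \<open>The start has length \<open>Y * norm \<zeta>\<close> and points along
  \<open>\<eta>\<close>, so that the subtracted inner product is as large as possible. Every pair
  satisfying the first equation gives a bound.\<close>

lemma bellman_sup_le_inner_regime:
  assumes g: "0 < g" and Y: "0 \<le> Y"
    and eq: "Z * ((1 - (p - 1) * g) * (1 + g) powr (p - 1)) = norm \<zeta> powr p * ((1 - (p - 1) * Y) * (1 + Y) powr (p - 1))"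
  shows "bellman_sup p q \<zeta> \<eta> Z H \<le> ennreal (g * Z powr (1 / p) * H powr (1 / q) - norm \<zeta> * norm \<eta> * Y)"
proof -
  obtain v where v: "norm v = norm (Y *\<^sub>R \<zeta>)" "v \<bullet> \<eta> = norm (Y *\<^sub>R \<zeta>) * norm \<eta>"
    using exists_aligned[of "Y *\<^sub>R \<zeta>" \<eta>] by blast
  have "burkholder p \<zeta> v = (norm \<zeta> * (1 + Y)) powr (p - 1) * (norm \<zeta> * (Y - 1 / (p - 1)))"
    using Y by (simp add: burkholder_def v algebra_simps)
  also have "\<dots> = norm \<zeta> powr p * ((1 + Y) powr (p - 1) * (Y - 1 / (p - 1)))"
    using Y powr_one_mult[of "norm \<zeta>" p] by (simp add: powr_mult)
  finally have A: "burk_const p g * burkholder p \<zeta> v + young_const p g * Z = g powr p * Z"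
    using burkholder_start_value[OF p g eq] by simp
  have "bellman_sup p q \<zeta> \<eta> Z H \<le> ennreal ((g powr p * Z) powr (1 / p) * H powr (1 / q) - v \<bullet> \<eta>)"
    using bellman_sup_le_burkholder[OF g, of _ v] ZH unfolding A
    by (intro le_of_weighted_young[OF p(1) q]) auto
  moreover have "(g powr p * Z) powr (1 / p) = g * Z powr (1 / p)"
    using g ZH p by (simp add: powr_mult powr_powr)
  ultimately show ?thesis using Y by (simp add: v mult_ac)
qed

lemma bellman_sup_eq_0:
  assumes "Z = norm \<zeta> powr p"
  shows "bellman_sup p q \<zeta> \<eta> Z H = 0"
proof -
  have "bellman_sup p q \<zeta> \<eta> Z H \<le> ennreal 0"
  proof (rule ennreal_le_epsilon_real)
    fix e :: real assume e: "0 < e"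
    define T where "T = Z powr (1 / p) * H powr (1 / q) - norm \<zeta> * norm \<eta>"
    \<comment> \<open>For \<open>Z = norm \<zeta> powr p\<close> the first equation holds whenever
      \<open>Y = g\<close>, so \<open>g\<close> may tend to 0; this choice makes the bound at most
      \<open>e\<close>.\<close>
    define g where "g = e / (\<bar>T\<bar> + 1)"
    have g: "0 < g" using e by (simp add: g_def)
    have "bellman_sup p q \<zeta> \<eta> Z H \<le> ennreal (g * Z powr (1 / p) * H powr (1 / q) - norm \<zeta> * norm \<eta> * g)"
      using g assms by (intro bellman_sup_le_inner_regime) auto
    also have "g * Z powr (1 / p) * H powr (1 / q) - norm \<zeta> * norm \<eta> * g = g * T"
      by (simp add: T_def algebra_simps)
    also have "ennreal (g * T) \<le> ennreal (0 + e)"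
    proof (rule ennreal_leI)
      have "g * T \<le> g * (\<bar>T\<bar> + 1)" using g by (intro mult_left_mono) auto
      also have "\<dots> = e" by (simp add: g_def)
      finally show "g * T \<le> 0 + e" by simp
    qed
    finally show "bellman_sup p q \<zeta> \<eta> Z H \<le> ennreal (0 + e)" .
  qed
  then show ?thesis by simp
qed

text \<open>The link between \<open>\<kappa>\<close> and \<open>t\<close> is the equality case of
  \<open>scaled_young\<close> for \<open>t * norm \<eta>\<close>. The terms at the start then cancel
  the inner product, and only the surpluses of \<open>Z\<close> and \<open>H\<close> over their
  minimal values remain.\<close>

lemma bellman_sup_le_exit:
  assumes t: "0 < t" and x: "norm \<zeta> \<le> (p - 1) * t" and \<kappa>: "0 < \<kappa>" "norm \<eta> = \<kappa> * t powr (p - 1)"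
  shows "bellman_sup p q \<zeta> \<eta> Z H \<le>
     ennreal (\<kappa> / p * ((p - 1) powr (- p) * (Z - norm \<zeta> powr p)) + \<kappa> powr (1 - q) / q * (H - norm \<eta> powr q))"
proof -
  obtain U :: "'a \<Rightarrow> 'a \<Rightarrow> real" where U: "zigzag_concave U"
    and maj: "\<And>x y. norm y powr p - (p - 1) powr (- p) * norm x powr p \<le> U x y"
    and eq: "\<And>x y. norm x = norm \<zeta> \<Longrightarrow> norm y = t \<Longrightarrow> U x y = t powr p - (p - 1) powr (- p) * norm \<zeta> powr p"
    using exit_majorant[OF p t norm_ge_zero x] by blast
  have y: "0 < norm \<eta>" using \<kappa> t by simp
  define v where "v = (t / norm \<eta>) *\<^sub>R \<eta>"
  have v: "norm v = t" "v \<bullet> \<eta> = t * norm \<eta>"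
    using t y by (auto simp: v_def power2_norm_eq_inner[symmetric] power2_eq_square)
  have "bellman_sup p q \<zeta> \<eta> Z H \<le> ennreal (\<kappa> / p * (U \<zeta> v + (p - 1) powr (- p) * Z) + \<kappa> powr (1 - q) / q * H - v \<bullet> \<eta>)"
    by (rule bellman_sup_le[OF p(1) conj_facts(1) ZH U maj]) (use scaled_young[OF p(1) q] p conj_facts(1) \<kappa> in auto)
  also have "\<kappa> / p * (U \<zeta> v + (p - 1) powr (- p) * Z) + \<kappa> powr (1 - q) / q * H - v \<bullet> \<eta>
    = \<kappa> / p * ((p - 1) powr (- p) * (Z - norm \<zeta> powr p)) + \<kappa> powr (1 - q) / q * (H - norm \<eta> powr q)"
  proof -
    have "norm \<eta> powr q = \<kappa> powr q * t powr p" using \<kappa> t conj_facts(5) by (simp add: powr_mult powr_powr)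
    moreover have "\<kappa> powr (1 - q) * \<kappa> powr q = \<kappa>" using \<kappa> by (simp add: powr_add[symmetric])
    ultimately have 1: "\<kappa> powr (1 - q) / q * norm \<eta> powr q = (1 / q) * (\<kappa> * t powr p)" by simp
    have "t * norm \<eta> = (1 / p + 1 / q) * (\<kappa> * t powr p)"
      using t powr_one_mult[of t p] conj_facts(2) by (simp add: \<kappa>(2) mult.commute[of t])
    then have 2: "\<kappa> / p * t powr p + \<kappa> powr (1 - q) / q * norm \<eta> powr q = t * norm \<eta>"
      unfolding 1 by (simp add: algebra_simps)
    show ?thesis using 2 by (simp add: eq[OF refl v(1)] v(2) algebra_simps diff_divide_distrib)
  qed
  finally show ?thesis .
qed

lemma bellman_sup_le_outer_regime:
  assumes xZ: "norm \<zeta> powr p \<le> Z" and yH: "norm \<eta> powr q \<le> H"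
    and regime: "norm \<zeta> powr p * H \<le> norm \<eta> powr q * Z"
  shows "bellman_sup p q \<zeta> \<eta> Z H \<le> ennreal ((H - norm \<eta> powr q) powr (1 / q) * (Z - norm \<zeta> powr p) powr (1 / p) / (p - 1))"
proof -
  define C where "C = (p - 1) powr (- p)"
  have C: "0 < C" "C powr (1 / p) = 1 / (p - 1)"
    using p powr_minus_divide[of "p - 1" 1] by (simp_all add: C_def powr_powr)
  consider "\<eta> = 0" | "\<eta> \<noteq> 0" "Z = norm \<zeta> powr p" | "\<eta> \<noteq> 0" "H = norm \<eta> powr q"
    | "\<eta> \<noteq> 0" "norm \<zeta> powr p < Z" "norm \<eta> powr q < H"
    using xZ yH by fastforce
  then show ?thesis
  proof cases
    case 1
    \<comment> \<open>For \<open>\<eta> = 0\<close> no positive \<open>t\<close> satisfies the link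
      to \<open>\<kappa>\<close>; Burkholder's function at the limiting slope, started at 0,
      replaces the truncated one.\<close>
    have g: "0 < 1 / (p - 1)" using p by simp
    have "bellman_sup p q \<zeta> \<eta> Z H \<le> ennreal ((C * Z) powr (1 / p) * H powr (1 / q) - 0)"
    proof (rule le_of_weighted_young[OF p(1) q])
      fix \<kappa> :: real assume \<kappa>: "0 < \<kappa>"
      have "burkholder p \<zeta> 0 \<le> 0" using p by (simp add: burkholder_def mult_le_0_iff)
      then have "burk_const p (1 / (p - 1)) * burkholder p \<zeta> 0 \<le> 0" by (simp add: burk_const_def mult_le_0_iff)
      then have "\<kappa> / p * (burk_const p (1 / (p - 1)) * burkholder p \<zeta> 0 + young_const p (1 / (p - 1)) * Z) \<le> \<kappa> / p * (C * Z)"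
        unfolding burk_const_endpoint(2)[OF p(1)] C_def using \<kappa> p by (intro mult_left_mono) auto
      then show "bellman_sup p q \<zeta> \<eta> Z H \<le> ennreal (\<kappa> / p * (C * Z) + \<kappa> powr (1 - q) / q * H - 0)"
        using bellman_sup_le_burkholder[OF g \<kappa>, of 0] by (elim order.trans) (intro ennreal_leI, simp)
    qed (use C ZH in auto)
    also have "(C * Z) powr (1 / p) * H powr (1 / q) - 0 = (H - norm \<eta> powr q) powr (1 / q) * (Z - norm \<zeta> powr p) powr (1 / p) / (p - 1)"
    proof -
      \<comment> \<open>The regime forces \<open>\<zeta> = 0\<close> or \<open>H = 0\<close>; the
        two expressions agree in either case.\<close>
      have "norm \<zeta> powr p * H = 0" using regime 1 conj_facts(1) ZH by (smt (verit) mult_eq_0_iff norm_zero powr_0 powr_ge_zero mult_nonneg_nonneg)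
      then show ?thesis using 1 conj_facts(1) ZH C by (auto simp: powr_mult)
    qed
    finally show ?thesis .
  next
    case 2
    show ?thesis unfolding bellman_sup_eq_0[OF 2(2)] by simp
  next
    case 3
    have "bellman_sup p q \<zeta> \<eta> Z H \<le> ennreal 0"
    proof (rule ennreal_le_epsilon_real)
      fix e :: real assume e: "0 < e"
      define T where "T = C * (Z - norm \<zeta> powr p)"
      have T: "0 \<le> T" using C xZ by (simp add: T_def)
      define s where "s = norm \<eta> * ((p - 1) / (norm \<zeta> + 1)) powr (p - 1)"
      \<comment> \<open>A small weight serves twice: the first entry makes \<open>t\<close> large
        enough for \<open>norm \<zeta> \<le> (p - 1) * t\<close>, the second makes the remaining
        term at most \<open>e\<close>.\<close>
      define \<kappa> where "\<kappa> = min s (p * e / (T + 1))"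
      have n: "0 < norm \<zeta> + 1" by (simp add: add_nonneg_pos)
      have s: "0 < s" using 3 p n by (simp add: s_def)
      then have \<kappa>: "0 < \<kappa>" using e T p by (simp add: \<kappa>_def)
      define t where "t = (norm \<eta> / \<kappa>) powr (1 / (p - 1))"
      have t: "0 < t" using 3 \<kappa> by (simp add: t_def)
      have "norm \<eta> / s \<le> norm \<eta> / \<kappa>" using \<kappa> s by (intro divide_left_mono) (auto simp: \<kappa>_def)
      moreover have "norm \<eta> / s = ((norm \<zeta> + 1) / (p - 1)) powr (p - 1)"
        using 3 p n by (simp add: s_def powr_divide)
      ultimately have "(((norm \<zeta> + 1) / (p - 1)) powr (p - 1)) powr (1 / (p - 1)) \<le> t"
        unfolding t_def using p by (intro powr_mono2) auto
      then have "(norm \<zeta> + 1) / (p - 1) \<le> t" using p n by (simp add: powr_powr)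
      then have x: "norm \<zeta> \<le> (p - 1) * t" using p by (simp add: field_simps)
      have "norm \<eta> = \<kappa> * t powr (p - 1)" using \<kappa> p by (simp add: t_def powr_powr)
      then have "bellman_sup p q \<zeta> \<eta> Z H \<le> ennreal (\<kappa> / p * T + \<kappa> powr (1 - q) / q * (H - norm \<eta> powr q))"
        using bellman_sup_le_exit[OF t x \<kappa>] by (simp add: T_def C_def)
      also have "\<dots> \<le> ennreal (0 + e)"
      proof (rule ennreal_leI)
        have "\<kappa> / p * T \<le> (p * e / (T + 1)) / p * T"
          using p T by (intro mult_right_mono divide_right_mono) (auto simp: \<kappa>_def)
        also have "\<dots> \<le> e" using p T e by (simp add: divide_simps)
        finally show "\<kappa> / p * T + \<kappa> powr (1 - q) / q * (H - norm \<eta> powr q) \<le> 0 + e" using 3 by simp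
      qed
      finally show "bellman_sup p q \<zeta> \<eta> Z H \<le> ennreal (0 + e)" .
    qed
    then show ?thesis by simp
  next
    case 4
    define x where "x = norm \<zeta> powr p"
    define y where "y = norm \<eta> powr q"
    define A where "A = C * (Z - x)"
    have A: "0 < A" using C 4 by (simp add: A_def x_def)
    have Hy: "0 < H - y" using 4 by (simp add: y_def)
    \<comment> \<open>The minimiser of Young's bound for \<open>A\<close> and \<open>H - y\<close>;
      the link then dictates \<open>t\<close>.\<close>
    define \<kappa> where "\<kappa> = ((H - y) / A) powr (1 / q)"
    have \<kappa>: "0 < \<kappa>" "\<kappa> powr q = (H - y) / A" using A Hy conj_facts(1) by (simp_all add: \<kappa>_def powr_powr)
    define t where "t = (norm \<eta> / \<kappa>) powr (1 / (p - 1))"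
    have t: "0 < t" using 4 \<kappa> by (simp add: t_def)
    have \<eta>: "norm \<eta> = \<kappa> * t powr (p - 1)" using \<kappa> p by (simp add: t_def powr_powr)
    have "t powr p = (norm \<eta> / \<kappa>) powr q" using conj_facts(8) by (simp add: t_def powr_powr)
    also have "\<dots> = y * A / (H - y)" using \<kappa> by (simp add: powr_divide y_def)
    finally have tp: "t powr p = C * (y * (Z - x) / (H - y))" by (simp add: A_def)
    \<comment> \<open>In terms of \<open>t\<close>, the regime condition says exactly
      \<open>norm \<zeta> \<le> (p - 1) * t\<close>.\<close>
    have "x * (H - y) \<le> y * (Z - x)" using regime by (simp add: x_def y_def algebra_simps)
    then have "x \<le> y * (Z - x) / (H - y)" using Hy by (simp add: pos_le_divide_eq)
    moreover have "y * (Z - x) / (H - y) = ((p - 1) * t) powr p"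
    proof -
      have "(p - 1) powr p * C = 1" using p by (simp add: C_def powr_add[symmetric])
      then show ?thesis using p t tp by (simp add: powr_mult)
    qed
    ultimately have xt: "norm \<zeta> powr p \<le> ((p - 1) * t) powr p" by (simp add: x_def)
    have x': "norm \<zeta> \<le> (p - 1) * t"
    proof (rule ccontr)
      assume "\<not> norm \<zeta> \<le> (p - 1) * t"
      then have "((p - 1) * t) powr p < norm \<zeta> powr p" using p t by (intro powr_less_mono2) auto
      then show False using xt by simp
    qed
    have "bellman_sup p q \<zeta> \<eta> Z H \<le> ennreal (\<kappa> / p * A + \<kappa> powr (1 - q) / q * (H - y))"
      using bellman_sup_le_exit[OF t x' \<kappa>(1) \<eta>] by (simp add: A_def C_def x_def y_def)
    also have "\<kappa> / p * A + \<kappa> powr (1 - q) / q * (H - y) = A powr (1 / p) * (H - y) powr (1 / q)"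
    proof -
      have "\<kappa> powr (1 - q) * (H - y) = \<kappa> powr (1 - q) * (\<kappa> powr q * A)" using \<kappa>(2) A by simp
      also have "\<dots> = \<kappa> * A" using \<kappa>(1) by (simp add: powr_add[symmetric] mult.assoc[symmetric])
      finally have "\<kappa> / p * A + \<kappa> powr (1 - q) / q * (H - y) = (1 / p + 1 / q) * (\<kappa> * A)" by (simp add: algebra_simps)
      also have "\<dots> = (H - y) powr (1 / q) * (A powr (1 / p + 1 / q) / A powr (1 / q))"
        unfolding conj_facts(2) using A Hy by (simp add: \<kappa>_def powr_divide)
      also have "\<dots> = A powr (1 / p) * (H - y) powr (1 / q)" using A by (simp add: powr_add)
      finally show ?thesis .
    qed
    also have "A powr (1 / p) = (Z - x) powr (1 / p) / (p - 1)" using C 4 by (simp add: A_def powr_mult x_def)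
    finally show ?thesis by (simp add: x_def y_def mult_ac)
  qed
qed

end

section \<open>The system for the second regime\<close>

definition level_fun :: "real \<Rightarrow> real \<Rightarrow> real" where
  "level_fun p y = (1 - (p - 1) * y) * (1 + y) powr (p - 1)"

definition slope_fun :: "real \<Rightarrow> real \<Rightarrow> real" where
  "slope_fun p y = y * (1 + y) powr (p - 2)"

text \<open>The link between the two equations of the system: up to a constant, the function in the
  second is the derivative of the one in the first.\<close>

lemma level_fun_deriv:
  assumes "-1 < y"
  shows "(level_fun p has_real_derivative - (p * (p - 1) * slope_fun p y)) (at y)"
proof -
  have e: "(1 + y) powr (p - 1) = (1 + y) powr (p - 2) * (1 + y)"
    using assms powr_add[of "1 + y" "p - 2" 1] by simp
  have "(level_fun p has_real_derivative
      (- (p - 1) * (1 + y) powr (p - 1) + (1 - (p - 1) * y) * ((p - 1) * (1 + y) powr (p - 2)))) (at y)"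
    unfolding level_fun_def using assms by (auto intro!: derivative_eq_intros)
  also have "- (p - 1) * (1 + y) powr (p - 1) + (1 - (p - 1) * y) * ((p - 1) * (1 + y) powr (p - 2))
      = - (p * (p - 1) * slope_fun p y)"
    unfolding e slope_fun_def by (simp add: algebra_simps)
  finally show ?thesis .
qed

lemma slope_fun_deriv:
  assumes "-1 < y"
  shows "(slope_fun p has_real_derivative (1 + (p - 1) * y) * (1 + y) powr (p - 3)) (at y)"
proof -
  have e: "(1 + y) powr (p - 2) = (1 + y) powr (p - 3) * (1 + y)"
    using assms powr_add[of "1 + y" "p - 3" 1] by simp
  have "(slope_fun p has_real_derivative
      ((1 + y) powr (p - 2) + y * ((p - 2) * (1 + y) powr (p - 3)))) (at y)"
    unfolding slope_fun_def using assms by (auto intro!: derivative_eq_intros)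
  also have "(1 + y) powr (p - 2) + y * ((p - 2) * (1 + y) powr (p - 3)) = (1 + (p - 1) * y) * (1 + y) powr (p - 3)"
    unfolding e by (simp add: algebra_simps)
  finally show ?thesis .
qed

lemma level_fun_continuous: "0 \<le> a \<Longrightarrow> continuous_on {a..b} (level_fun p)"
  by (intro continuous_at_imp_continuous_on ballI DERIV_isCont[OF level_fun_deriv]) auto

lemma slope_fun_continuous: "0 \<le> a \<Longrightarrow> continuous_on {a..b} (slope_fun p)"
  by (intro continuous_at_imp_continuous_on ballI DERIV_isCont[OF slope_fun_deriv]) auto

lemma slope_fun_pos: "0 < y \<Longrightarrow> 0 < slope_fun p y"
  by (simp add: slope_fun_def)

lemma slope_fun_0 [simp]: "slope_fun p 0 = 0"
  by (simp add: slope_fun_def)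

lemma level_fun_0 [simp]: "level_fun p 0 = 1"
  by (simp add: level_fun_def)

lemma level_fun_pos: "1 < p \<Longrightarrow> 0 \<le> y \<Longrightarrow> y < 1 / (p - 1) \<Longrightarrow> 0 < level_fun p y"
  by (auto simp: level_fun_def less_divide_eq mult.commute intro!: mult_pos_pos)

lemma level_fun_strict_antimono:
  assumes "1 < p" "0 \<le> a" "a < b"
  shows "level_fun p b < level_fun p a"
proof (rule DERIV_neg_imp_decreasing_open[OF assms(3) _ level_fun_continuous[OF assms(2)]])
  fix x assume "a < x" "x < b"
  then show "\<exists>y. (level_fun p has_real_derivative y) (at x) \<and> y < 0"
    using assms level_fun_deriv[of x p] slope_fun_pos[of x p]
    by (intro exI[of _ "- (p * (p - 1) * slope_fun p x)"]) auto
qed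

lemma slope_fun_strict_mono:
  assumes "1 < p" "0 \<le> a" "a < b"
  shows "slope_fun p a < slope_fun p b"
proof (rule DERIV_pos_imp_increasing_open[OF assms(3) _ slope_fun_continuous[OF assms(2)]])
  fix x assume "a < x" "x < b"
  then show "\<exists>y. (slope_fun p has_real_derivative y) (at x) \<and> y > 0"
    using assms slope_fun_deriv[of x p]
    by (intro exI[of _ "(1 + (p - 1) * x) * (1 + x) powr (p - 3)"]) (auto intro!: mult_pos_pos add_pos_nonneg)
qed

lemma slope_fun_less_iff:
  assumes "1 < p" "0 \<le> a" "0 \<le> b"
  shows "slope_fun p a < slope_fun p b \<longleftrightarrow> a < b"
  using slope_fun_strict_mono[OF assms(1), of a b] slope_fun_strict_mono[OF assms(1), of b a] assms
  by (cases a b rule: linorder_cases) auto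

text \<open>
  As a function of \<open>slope_fun p y\<close> the function \<open>level_fun p y\<close> is concave; its slope is, up to the
  factor \<open>- p * (p - 1)\<close>, the quantity \<open>level_ratio p y\<close>.
\<close>

definition level_ratio :: "real \<Rightarrow> real \<Rightarrow> real" where
  "level_ratio p y = y * (1 + y) / (1 + (p - 1) * y)"

lemma level_ratio_mono:
  assumes "1 < p" "0 \<le> a" "a \<le> b"
  shows "level_ratio p a \<le> level_ratio p b"
proof -
  have "0 \<le> (b - a) * (1 + a + b + (p - 1) * (a * b))" using assms by (intro mult_nonneg_nonneg) auto
  also have "\<dots> = b * (1 + b) * (1 + (p - 1) * a) - a * (1 + a) * (1 + (p - 1) * b)"
    by (simp add: algebra_simps)
  finally have "a * (1 + a) * (1 + (p - 1) * b) \<le> b * (1 + b) * (1 + (p - 1) * a)" by simp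
  moreover have "0 < 1 + (p - 1) * a" "0 < 1 + (p - 1) * b" using assms by (auto intro!: add_pos_nonneg)
  ultimately show ?thesis
    by (simp add: level_ratio_def pos_divide_le_eq pos_le_divide_eq)
qed

text \<open>Cauchy's mean value theorem with \<open>slope_fun p\<close> as independent variable; the
  quotient of the derivatives simplifies to a multiple of \<open>level_ratio\<close>.\<close>

lemma level_fun_diff:
  assumes p: "1 < p" and ab: "0 \<le> a" "a \<le> b"
  shows "\<exists>c. a \<le> c \<and> c \<le> b \<and> level_fun p a - level_fun p b = p * (p - 1) * level_ratio p c * (slope_fun p b - slope_fun p a)"
proof (cases "a = b")
  case True
  then show ?thesis by auto
next
  case False
  have "\<exists>c. a < c \<and> c < b \<and> (level_fun p b - level_fun p a) * ((1 + (p - 1) * c) * (1 + c) powr (p - 3)) = (slope_fun p b - slope_fun p a) * - (p * (p - 1) * slope_fun p c)"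
    using False ab by (intro GMVT') (auto intro!: level_fun_deriv slope_fun_deriv DERIV_isCont[OF level_fun_deriv] DERIV_isCont[OF slope_fun_deriv])
  then obtain c where c: "a < c" "c < b"
    "(level_fun p b - level_fun p a) * ((1 + (p - 1) * c) * (1 + c) powr (p - 3)) = (slope_fun p b - slope_fun p a) * - (p * (p - 1) * slope_fun p c)"
    by blast
  define P where "P = (1 + c) powr (p - 3)"
  have P: "0 < P" using c ab by (simp add: P_def)
  have d: "0 < 1 + (p - 1) * c" using c ab p by (intro add_pos_nonneg) auto
  have "slope_fun p c = c * (1 + c) * P"
    using powr_add[of "1 + c" "p - 3" 1] c ab by (simp add: slope_fun_def P_def)
  then have "(level_fun p a - level_fun p b) * (1 + (p - 1) * c) * P = (slope_fun p b - slope_fun p a) * (p * (p - 1)) * (c * (1 + c)) * P"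
    using c(3) unfolding P_def[symmetric] by (simp add: algebra_simps)
  then have "(level_fun p a - level_fun p b) * (1 + (p - 1) * c) = (slope_fun p b - slope_fun p a) * (p * (p - 1)) * (c * (1 + c))"
    using P by simp
  also have "c * (1 + c) = level_ratio p c * (1 + (p - 1) * c)" using d by (simp add: level_ratio_def)
  finally have "(level_fun p a - level_fun p b) * (1 + (p - 1) * c)
      = (p * (p - 1) * level_ratio p c * (slope_fun p b - slope_fun p a)) * (1 + (p - 1) * c)"
    by (simp only: mult_ac)
  then have "level_fun p a - level_fun p b = p * (p - 1) * level_ratio p c * (slope_fun p b - slope_fun p a)"
    using d by (simp only: mult_right_cancel[OF less_imp_neq[OF d, symmetric]])
  then show ?thesis using c by (intro exI[of _ c]) auto
qed

text \<open>In the variable \<open>slope_fun p\<close> the interval from \<open>Y1\<close> to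
  \<open>Y2\<close> is no longer than the one from \<open>g1\<close> to \<open>g2\<close>, because
  \<open>\<rho> < 1\<close>, and it lies further left; concavity makes the drop of the level smaller
  there.\<close>

lemma level_fun_drop_le:
  assumes p: "1 < p" and \<rho>: "0 \<le> \<rho>" "\<rho> < 1"
    and Y: "0 \<le> Y1" "0 \<le> Y2" and g: "Y1 \<le> g1" "Y2 \<le> g2" "g1 < g2"
    and s: "slope_fun p Y1 = \<rho> * slope_fun p g1" "slope_fun p Y2 = \<rho> * slope_fun p g2"
  shows "level_fun p Y1 - level_fun p Y2 \<le> level_fun p g1 - level_fun p g2"
proof -
  have sg: "slope_fun p g1 < slope_fun p g2" using slope_fun_strict_mono[OF p, of g1 g2] Y g by auto
  have "\<rho> * (slope_fun p g2 - slope_fun p g1) \<le> 1 * (slope_fun p g2 - slope_fun p g1)"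
    using \<rho> sg by (intro mult_right_mono) auto
  then have W: "slope_fun p Y2 - slope_fun p Y1 \<le> slope_fun p g2 - slope_fun p g1"
    unfolding s right_diff_distrib by simp
  have W': "slope_fun p Y1 \<le> slope_fun p Y2"
    unfolding s using \<rho> sg by (intro mult_left_mono) auto
  have Y12: "Y1 \<le> Y2" using W' slope_fun_less_iff[OF p Y(2,1)] by linarith
  have drop: "level_fun p u - level_fun p u' \<le> level_fun p v - level_fun p v'"
    if "0 \<le> u" "u \<le> u'" "u' \<le> v" "v \<le> v'" "slope_fun p u' - slope_fun p u \<le> slope_fun p v' - slope_fun p v" for u u' v v'
  proof -
    note h = that
    obtain c where c: "u \<le> c" "c \<le> u'" "level_fun p u - level_fun p u' = p * (p - 1) * level_ratio p c * (slope_fun p u' - slope_fun p u)"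
      using level_fun_diff[OF p h(1,2)] by blast
    have v: "0 \<le> v" using h by linarith
    obtain c' where c': "v \<le> c'" "c' \<le> v'" "level_fun p v - level_fun p v' = p * (p - 1) * level_ratio p c' * (slope_fun p v' - slope_fun p v)"
      using level_fun_diff[OF p v h(4)] by blast
    have "0 \<le> slope_fun p u' - slope_fun p u" using that slope_fun_less_iff[OF p, of u' u] by linarith
    moreover have "level_ratio p c \<le> level_ratio p c'" using that c c' p by (intro level_ratio_mono) auto
    moreover have "0 \<le> level_ratio p c" using that c p by (simp add: level_ratio_def)
    moreover have "0 \<le> level_ratio p c'" using that c c' p by (simp add: level_ratio_def)
    ultimately show ?thesis unfolding c(3) c'(3) using that p by (intro mult_mono) auto
  qed
  show ?thesis
  proof (cases "Y2 \<le> g1")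
    case True
    then show ?thesis using drop[of Y1 Y2 g1 g2] Y Y12 g W by simp
  next
    \<comment> \<open>If the intervals overlap, the inequality is rearranged to compare
      \<open>[Y1, g1]\<close> with \<open>[Y2, g2]\<close>, which do not.\<close>
    case False
    then show ?thesis using drop[of Y1 g1 Y2 g2] Y Y12 g W by simp
  qed
qed

text \<open>If \<open>g1 < g2\<close>, the level equations turn \<open>level_fun_drop_le\<close>
  into \<open>z * d \<le> d\<close> for the positive drop \<open>d\<close> between \<open>g1\<close>
  and \<open>g2\<close>, which contradicts \<open>1 < z\<close>.\<close>

lemma level_slope_system_unique:
  assumes p: "1 < p" and z: "1 < z" and \<rho>: "0 \<le> \<rho>" "\<rho> < 1"
    and Y: "0 \<le> Y1" "0 \<le> Y2" and g: "Y1 < g1" "Y2 < g2"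
    and l: "level_fun p Y1 = z * level_fun p g1" "level_fun p Y2 = z * level_fun p g2"
    and s: "slope_fun p Y1 = \<rho> * slope_fun p g1" "slope_fun p Y2 = \<rho> * slope_fun p g2"
  shows "g1 = g2 \<and> Y1 = Y2"
proof -
  have no: "\<not> u1 < u2" if "0 \<le> V1" "0 \<le> V2" "V1 < u1" "V2 < u2"
    "level_fun p V1 = z * level_fun p u1" "level_fun p V2 = z * level_fun p u2"
    "slope_fun p V1 = \<rho> * slope_fun p u1" "slope_fun p V2 = \<rho> * slope_fun p u2" for u1 u2 V1 V2
  proof
    assume u: "u1 < u2"
    have "z * (level_fun p u1 - level_fun p u2) \<le> level_fun p u1 - level_fun p u2"
      using level_fun_drop_le[OF p \<rho> that(1,2) _ _ u that(7,8)] that by (simp add: algebra_simps)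
    moreover have "0 < level_fun p u1 - level_fun p u2" using level_fun_strict_antimono[OF p _ u] that by simp
    ultimately show False using z by simp
  qed
  have "g1 = g2" using no[OF Y g l s] no[OF Y(2,1) g(2,1) l(2,1) s(2,1)] by simp
  moreover from this have "slope_fun p Y1 = slope_fun p Y2" using s by simp
  then have "Y1 = Y2" using slope_fun_less_iff[OF p, of Y1 Y2] slope_fun_less_iff[OF p, of Y2 Y1] Y by linarith
  ultimately show ?thesis by simp
qed

text \<open>Inverting \<open>slope_fun p\<close> makes \<open>Y\<close> a continuous function of
  \<open>g\<close>. The other equation is then an intermediate value problem: its defect
  \<open>K\<close> is \<open>1 - z < 0\<close> at 0 and positive at \<open>1 / (p - 1)\<close>,
  where \<open>level_fun p\<close> vanishes.\<close>

lemma level_slope_system_exists: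
  assumes p: "1 < p" and z: "1 < z" and \<rho>: "0 \<le> \<rho>" "\<rho> < 1"
  shows "\<exists>g Y. 0 \<le> Y \<and> Y < g \<and> g < 1 / (p - 1) \<and> level_fun p Y = z * level_fun p g \<and> slope_fun p Y = \<rho> * slope_fun p g"
proof -
  define G where "G = 1 / (p - 1)"
  have G: "0 < G" using p by (simp add: G_def)
  define sinv where "sinv = the_inv_into {0..G} (slope_fun p)"
  have inj: "inj_on (slope_fun p) {0..G}"
  proof (rule inj_onI)
    fix x y assume "x \<in> {0..G}" "y \<in> {0..G}" "slope_fun p x = slope_fun p y"
    then show "x = y" using slope_fun_less_iff[OF p, of x y] slope_fun_less_iff[OF p, of y x] by simp
  qed
  have im: "slope_fun p ` {0..G} = {0..slope_fun p G}"
  proof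
    show "slope_fun p ` {0..G} \<subseteq> {0..slope_fun p G}"
    proof
      fix w assume "w \<in> slope_fun p ` {0..G}"
      then obtain x where x: "0 \<le> x" "x \<le> G" "w = slope_fun p x" by auto
      then have "\<not> slope_fun p G < slope_fun p x" using slope_fun_less_iff[OF p, of G x] by simp
      moreover have "0 \<le> slope_fun p x" using x by (simp add: slope_fun_def)
      ultimately show "w \<in> {0..slope_fun p G}" using x by simp
    qed
    show "{0..slope_fun p G} \<subseteq> slope_fun p ` {0..G}"
    proof
      fix w assume "w \<in> {0..slope_fun p G}"
      then have "\<exists>x\<ge>0. x \<le> G \<and> slope_fun p x = w"
        using G by (intro IVT' slope_fun_continuous) auto
      then show "w \<in> slope_fun p ` {0..G}" by auto
    qed
  qed
  have "continuous_on (slope_fun p ` {0..G}) sinv"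
  proof (rule continuous_on_inv)
    show "\<forall>x\<in>{0..G}. sinv (slope_fun p x) = x" by (simp add: sinv_def the_inv_into_f_f[OF inj])
  qed (simp_all add: slope_fun_continuous)
  then have cont_inv: "continuous_on {0..slope_fun p G} sinv" unfolding im .
  have sl: "\<rho> * slope_fun p g \<in> {0..slope_fun p G}" if "0 \<le> g" "g \<le> G" for g
  proof -
    have s: "0 \<le> slope_fun p g" using that by (simp add: slope_fun_def)
    have "\<rho> * slope_fun p g \<le> 1 * slope_fun p g" using \<rho> s by (intro mult_right_mono) auto
    moreover have "\<not> slope_fun p G < slope_fun p g" using slope_fun_less_iff[OF p, of G g] that by simp
    ultimately show ?thesis using \<rho> s by simp
  qed
  have sinv: "0 \<le> sinv (\<rho> * slope_fun p g)" "sinv (\<rho> * slope_fun p g) \<le> G" "slope_fun p (sinv (\<rho> * slope_fun p g)) = \<rho> * slope_fun p g"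
    if "0 \<le> g" "g \<le> G" for g
  proof -
    have m: "\<rho> * slope_fun p g \<in> slope_fun p ` {0..G}" unfolding im by (rule sl[OF that])
    show "0 \<le> sinv (\<rho> * slope_fun p g)" "sinv (\<rho> * slope_fun p g) \<le> G"
      using the_inv_into_into[OF inj m order_refl] by (simp_all add: sinv_def)
    show "slope_fun p (sinv (\<rho> * slope_fun p g)) = \<rho> * slope_fun p g"
      unfolding sinv_def by (rule f_the_inv_into_f[OF inj m])
  qed
  have less: "sinv (\<rho> * slope_fun p g) < g" if "0 < g" "g \<le> G" for g
  proof -
    have "\<rho> * slope_fun p g < 1 * slope_fun p g" using \<rho> slope_fun_pos[OF that(1)] by (intro mult_strict_right_mono) auto
    then show ?thesis using sinv[of g] that slope_fun_less_iff[OF p, of "sinv (\<rho> * slope_fun p g)" g] by simp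
  qed
  define K where "K = (\<lambda>g. level_fun p (sinv (\<rho> * slope_fun p g)) - z * level_fun p g)"
  have "continuous_on {0..G} (\<lambda>g. sinv (\<rho> * slope_fun p g))"
    by (rule continuous_on_compose2[OF cont_inv]) (use sl in \<open>auto intro!: continuous_intros slope_fun_continuous\<close>)
  then have "continuous_on {0..G} (\<lambda>g. level_fun p (sinv (\<rho> * slope_fun p g)))"
    by (rule continuous_on_compose2[OF level_fun_continuous[OF order_refl, of G]]) (use sinv in auto)
  then have cont: "continuous_on {0..G} K"
    unfolding K_def by (intro continuous_intros level_fun_continuous) auto
  have "sinv 0 = 0" using sinv[of 0] G slope_fun_less_iff[OF p, of 0 "sinv 0"] by simp
  then have K0: "K 0 < 0" using z by (simp add: K_def)
  have "level_fun p G = 0" using p by (simp add: level_fun_def G_def)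
  then have KG: "0 < K G"
    using less[of G] sinv[of G] G p unfolding K_def by (simp add: level_fun_pos G_def)
  have "\<exists>g\<ge>0. g \<le> G \<and> K g = 0"
    using K0 KG G by (intro IVT' cont) auto
  then obtain g where g: "0 \<le> g" "g \<le> G" "K g = 0" by blast
  have "0 < g" "g < G" using g K0 KG by (metis less_irrefl order_le_less)+
  then show ?thesis
    using less[of g] sinv[of g] g unfolding K_def G_def by (intro exI[of _ g] exI[of _ "sinv (\<rho> * slope_fun p g)"]) auto
qed

lemma bellman_system_iff:
  fixes \<zeta> \<eta> :: "'a::real_normed_vector"
  assumes p: "1 < p"
  shows "bellman_system p q \<zeta> \<eta> Z H g Y \<longleftrightarrow> 0 \<le> Y \<and> Y < g \<and> g < 1 / (p - 1) \<and>
     level_fun p Y = Z / norm \<zeta> powr p * level_fun p g \<and>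
     slope_fun p Y = ((norm \<eta> powr q * Z) / (norm \<zeta> powr p * H)) powr (1 / q) * slope_fun p g"
proof -
  have "0 < level_fun p g" "0 < slope_fun p g" if "0 \<le> Y" "Y < g" "g < 1 / (p - 1)"
    using that level_fun_pos[OF p, of g] slope_fun_pos[of g p] by auto
  then show ?thesis
    unfolding bellman_system_def level_fun_def[symmetric] slope_fun_def[symmetric]
    by (auto simp: nonzero_divide_eq_eq)
qed

lemma bellman_system_ex1:
  fixes \<zeta> \<eta> :: "'a::real_normed_vector"
  assumes p: "1 < p" and q: "1 < q" and regime: "norm \<eta> powr q * Z < norm \<zeta> powr p * H" and Z: "norm \<zeta> powr p < Z"
  shows "\<exists>!(g, Y). bellman_system p q \<zeta> \<eta> Z H g Y"
proof -
  have "0 \<le> norm \<eta> powr q * Z" using Z powr_ge_zero[of "norm \<zeta>" p] by (intro mult_nonneg_nonneg powr_ge_zero) linarith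
  then have "0 < norm \<zeta> powr p * H" using regime by linarith
  then have \<zeta>: "0 < norm \<zeta> powr p" by (simp add: zero_less_mult_iff)
  define z where "z = Z / norm \<zeta> powr p"
  define \<rho> where "\<rho> = ((norm \<eta> powr q * Z) / (norm \<zeta> powr p * H)) powr (1 / q)"
  have z: "1 < z" using Z \<zeta> by (simp add: z_def)
  have "0 \<le> (norm \<eta> powr q * Z) / (norm \<zeta> powr p * H)" "(norm \<eta> powr q * Z) / (norm \<zeta> powr p * H) < 1"
    using \<open>0 < norm \<zeta> powr p * H\<close> regime \<open>0 \<le> norm \<eta> powr q * Z\<close> by auto
  then have \<rho>: "0 \<le> \<rho>" "\<rho> < 1"
    using q powr_less_mono2[of "1 / q" "(norm \<eta> powr q * Z) / (norm \<zeta> powr p * H)" 1] by (simp_all add: \<rho>_def)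
  obtain g Y where "0 \<le> Y" "Y < g" "g < 1 / (p - 1)" "level_fun p Y = z * level_fun p g" "slope_fun p Y = \<rho> * slope_fun p g"
    using level_slope_system_exists[OF p z \<rho>] by blast
  then have ex: "bellman_system p q \<zeta> \<eta> Z H g Y" unfolding bellman_system_iff[OF p] z_def \<rho>_def by simp
  have uniq: "g' = g \<and> Y' = Y" if "bellman_system p q \<zeta> \<eta> Z H g' Y'" for g' Y'
    using that ex unfolding bellman_system_iff[OF p] z_def[symmetric] \<rho>_def[symmetric]
    by (elim conjE, intro level_slope_system_unique[OF p z \<rho>]) assumption+
  show ?thesis
  proof (rule ex1I[of _ "(g, Y)"])
    show "case (g, Y) of (g, Y) \<Rightarrow> bellman_system p q \<zeta> \<eta> Z H g Y" using ex by simp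
    fix x assume "case x of (g, Y) \<Rightarrow> bellman_system p q \<zeta> \<eta> Z H g Y"
    then show "x = (g, Y)" using uniq[of "fst x" "snd x"] by (cases x) simp
  qed
qed

lemma bellman_system_obtain:
  fixes \<zeta> \<eta> :: "'a::real_normed_vector"
  assumes p: "1 < p" and q: "1 < q" and regime: "norm \<eta> powr q * Z < norm \<zeta> powr p * H" and Z: "norm \<zeta> powr p < Z"
  obtains g Y where "bellman_system p q \<zeta> \<eta> Z H g Y"
    and "bellman_explicit p q \<zeta> \<eta> Z H = g * Z powr (1 / p) * H powr (1 / q) - norm \<zeta> * norm \<eta> * Y"
proof -
  note ex1 = bellman_system_ex1[OF assms]
  then obtain g Y where gY: "bellman_system p q \<zeta> \<eta> Z H g Y" by auto
  then have "(THE (g, Y). bellman_system p q \<zeta> \<eta> Z H g Y) = (g, Y)"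
    by (intro the1_equality[OF ex1]) auto
  then show ?thesis using gY regime Z by (intro that[of g Y]) (auto simp: bellman_explicit_def)
qed

section \<open>Step functions and the lower bound\<close>

definition bounded_borel :: "(real \<Rightarrow> real) \<Rightarrow> bool" where
  "bounded_borel h \<longleftrightarrow> h \<in> borel_measurable borel \<and> (\<exists>C. \<forall>t. \<bar>h t\<bar> \<le> C)"

definition glue :: "(real \<Rightarrow> real) \<Rightarrow> (real \<Rightarrow> real) \<Rightarrow> real \<Rightarrow> real" where
  "glue h1 h2 t = (if t < 1 / 2 then h1 (2 * t) else h2 (2 * t - 1))"

definition dyadic_mean :: "(real \<Rightarrow> real) \<Rightarrow> nat \<Rightarrow> nat \<Rightarrow> real" where
  "dyadic_mean h n k = 2 ^ n * (LINT t|lborel. indicator (dyadic n k) t * h t)"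

lemma bounded_borel_const: "bounded_borel (\<lambda>t. c)"
  by (auto simp: bounded_borel_def)

lemma bounded_borel_glue:
  assumes "bounded_borel h1" "bounded_borel h2"
  shows "bounded_borel (glue h1 h2)"
proof -
  obtain C1 C2 where C: "\<And>t. \<bar>h1 t\<bar> \<le> C1" "\<And>t. \<bar>h2 t\<bar> \<le> C2"
    and [measurable]: "h1 \<in> borel_measurable borel" "h2 \<in> borel_measurable borel"
    using assms by (auto simp: bounded_borel_def)
  have "glue h1 h2 \<in> borel_measurable borel"
    unfolding glue_def[abs_def] by measurable
  moreover have "\<bar>glue h1 h2 t\<bar> \<le> max C1 C2" for t
    using C(1)[of "2 * t"] C(2)[of "2 * t - 1"] by (auto simp: glue_def)
  ultimately show ?thesis by (auto simp: bounded_borel_def)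
qed

lemma bounded_borel_abs_powr:
  assumes "bounded_borel h" "0 \<le> p"
  shows "bounded_borel (\<lambda>t. \<bar>h t\<bar> powr p)"
proof -
  obtain C where C: "\<And>t. \<bar>h t\<bar> \<le> C" and [measurable]: "h \<in> borel_measurable borel"
    using assms by (auto simp: bounded_borel_def)
  have "\<bar>\<bar>h t\<bar> powr p\<bar> \<le> C powr p" for t using C[of t] assms by (simp add: powr_mono2)
  moreover have "(\<lambda>t. \<bar>h t\<bar> powr p) \<in> borel_measurable borel" by measurable
  ultimately show ?thesis by (auto simp: bounded_borel_def)
qed

lemma glue_abs_powr: "(\<lambda>t. \<bar>glue h1 h2 t\<bar> powr p) = glue (\<lambda>t. \<bar>h1 t\<bar> powr p) (\<lambda>t. \<bar>h2 t\<bar> powr p)"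
  by (auto simp: glue_def)

lemma dyadic_lborel: "dyadic n k \<in> sets borel" "emeasure lborel (dyadic n k) < \<infinity>"
proof -
  have "real k / 2 ^ n \<le> real (k + 1) / 2 ^ n" by (simp add: divide_right_mono)
  then show "emeasure lborel (dyadic n k) < \<infinity>" by (simp add: dyadic_def)
qed (simp add: dyadic_def)

lemma bounded_borel_integrable:
  assumes "bounded_borel h"
  shows "integrable lborel (\<lambda>t. indicator (dyadic n k) t * h t)"
proof -
  obtain C where C: "\<And>t. \<bar>h t\<bar> \<le> C" and [measurable]: "h \<in> borel_measurable borel"
    using assms by (auto simp: bounded_borel_def)
  have [measurable]: "dyadic n k \<in> sets borel" by (rule dyadic_lborel)
  show ?thesis
  proof (rule Bochner_Integration.integrable_bound)
    show "integrable lborel (\<lambda>t. indicator (dyadic n k) t * C)"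
      using dyadic_lborel[of n k] by (intro integrable_mult_left integrable_real_indicator) auto
    show "AE t in lborel. norm (indicator (dyadic n k) t * h t) \<le> norm (indicator (dyadic n k) t * C)"
    proof (intro always_eventually allI)
      fix t show "norm (indicator (dyadic n k) t * h t) \<le> norm (indicator (dyadic n k) t * C)"
        using C[of t] by (auto simp: indicator_def)
    qed
  qed measurable
qed

lemma dyadic_mean_glue:
  assumes "k < 2 ^ n"
  shows "dyadic_mean (glue h1 h2) (n + 1) k = dyadic_mean h1 n k"
    and "dyadic_mean (glue h1 h2) (n + 1) (2 ^ n + k) = dyadic_mean h2 n k"
proof -
  have sc: "0 / 2 + 1 / 2 * u \<in> dyadic (n + 1) k \<longleftrightarrow> u \<in> dyadic n k"
    "1 / 2 + 1 / 2 * u \<in> dyadic (n + 1) (2 ^ n + k) \<longleftrightarrow> u \<in> dyadic n k" for u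
    by (auto simp: dyadic_def field_simps)
  have rng: "0 \<le> u" "u < 1" if "u \<in> dyadic n k" for u using that dyadic_subset[OF assms] by auto
  have "(LINT t|lborel. indicator (dyadic (n + 1) k) t * glue h1 h2 t)
      = 1 / 2 * (LINT u|lborel. indicator (dyadic (n + 1) k) (0 / 2 + 1 / 2 * u) * glue h1 h2 (0 / 2 + 1 / 2 * u))"
    by (subst lborel_integral_real_affine[where c = "1 / 2" and t = "0 / 2"]) auto
  also have "(\<lambda>u. indicator (dyadic (n + 1) k) (0 / 2 + 1 / 2 * u) * glue h1 h2 (0 / 2 + 1 / 2 * u))
      = (\<lambda>u. indicator (dyadic n k) u * h1 u)"
  proof
    fix u show "indicator (dyadic (n + 1) k) (0 / 2 + 1 / 2 * u) * glue h1 h2 (0 / 2 + 1 / 2 * u) = indicator (dyadic n k) u * h1 u"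
      using sc(1)[of u] rng[of u] by (cases "u \<in> dyadic n k") (auto simp: glue_def)
  qed
  finally show "dyadic_mean (glue h1 h2) (n + 1) k = dyadic_mean h1 n k"
    by (simp add: dyadic_mean_def)
  have "(LINT t|lborel. indicator (dyadic (n + 1) (2 ^ n + k)) t * glue h1 h2 t)
      = 1 / 2 * (LINT u|lborel. indicator (dyadic (n + 1) (2 ^ n + k)) (1 / 2 + 1 / 2 * u) * glue h1 h2 (1 / 2 + 1 / 2 * u))"
    by (subst lborel_integral_real_affine[where c = "1 / 2" and t = "1 / 2"]) auto
  also have "(\<lambda>u. indicator (dyadic (n + 1) (2 ^ n + k)) (1 / 2 + 1 / 2 * u) * glue h1 h2 (1 / 2 + 1 / 2 * u))
      = (\<lambda>u. indicator (dyadic n k) u * h2 u)"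
  proof
    fix u show "indicator (dyadic (n + 1) (2 ^ n + k)) (1 / 2 + 1 / 2 * u) * glue h1 h2 (1 / 2 + 1 / 2 * u) = indicator (dyadic n k) u * h2 u"
      using sc(2)[of u] rng[of u] by (cases "u \<in> dyadic n k") (auto simp: glue_def)
  qed
  finally show "dyadic_mean (glue h1 h2) (n + 1) (2 ^ n + k) = dyadic_mean h2 n k"
    by (simp add: dyadic_mean_def)
qed

lemma dyadic_mean_root:
  assumes "bounded_borel h"
  shows "dyadic_mean h 0 0 = (dyadic_mean h 1 0 + dyadic_mean h 1 1) / 2"
proof -
  have "(\<lambda>t. indicator (dyadic 0 0) t * h t) = (\<lambda>t. indicator (dyadic 1 0) t * h t + indicator (dyadic 1 1) t * h t)"
    using dyadic_split[of 0 0] by (auto simp: fun_eq_iff indicator_def)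
  then show ?thesis
    unfolding dyadic_mean_def
    by (simp add: Bochner_Integration.integral_add[OF bounded_borel_integrable[OF assms] bounded_borel_integrable[OF assms]] del: One_nat_def)
qed

lemma dyadic_mean_glue_root:
  assumes "bounded_borel h1" "bounded_borel h2"
  shows "dyadic_mean (glue h1 h2) 0 0 = (dyadic_mean h1 0 0 + dyadic_mean h2 0 0) / 2"
  using dyadic_mean_glue[of 0 0 h1 h2] dyadic_mean_root[OF bounded_borel_glue[OF assms]] by simp

lemma dyadic_mean_const: "dyadic_mean (\<lambda>t. c) 0 0 = c"
  by (simp add: dyadic_mean_def dyadic_zero)

lemma tree_sum_mono: "N \<le> M \<Longrightarrow> tree_sum F G N n k \<le> tree_sum F G M n k"
proof (induction N arbitrary: M n k)
  case 0
  have "0 \<le> tree_sum F G M n k" for M n k by (induction M arbitrary: n k) auto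
  then show ?case by simp
next
  case (Suc N)
  then obtain M' where M: "M = Suc M'" "N \<le> M'" by (cases M) auto
  then show ?case using Suc.IH[OF M(2)] by (auto intro!: add_mono divide_right_mono)
qed

text \<open>\<open>d = 0\<close> and \<open>d = 1\<close> give the left and right subtree of the
  root, reindexed as trees of their own.\<close>

lemma tree_sum_shift:
  assumes "\<And>n k. k < 2 ^ n \<Longrightarrow> F (n + 1) (2 ^ n * d + k) = F' n k"
    and "\<And>n k. k < 2 ^ n \<Longrightarrow> G (n + 1) (2 ^ n * d + k) = G' n k"
    and "k < 2 ^ n"
  shows "tree_sum F G N (n + 1) (2 ^ n * d + k) = tree_sum F' G' N n k"
  using assms(3)
proof (induction N arbitrary: n k)
  case (Suc N)
  have k: "2 * k < 2 ^ (n + 1)" "2 * k + 1 < 2 ^ (n + 1)" using Suc.prems by auto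
  have e: "2 * (2 ^ n * d + k) = 2 ^ (n + 1) * d + 2 * k" by (simp add: algebra_simps)
  show ?case
    unfolding tree_sum.simps e add.assoc[of "2 ^ (n + 1) * d" "2 * k" 1]
      assms(1)[OF k(1)] assms(1)[OF k(2)] assms(2)[OF k(1)] assms(2)[OF k(2)] Suc.IH[OF k(1)] Suc.IH[OF k(2)] ..
qed simp

text \<open>
  The sums attained by real step functions on finite dyadic trees. At a leaf both functions are
  constant, and \<open>Z\<close>, \<open>H\<close> are upper bounds for the moments rather than their exact values.
\<close>

inductive tree_value :: "real \<Rightarrow> real \<Rightarrow> real \<Rightarrow> real \<Rightarrow> real \<Rightarrow> real \<Rightarrow> real \<Rightarrow> bool" for p q where
  leaf: "\<bar>x\<bar> powr p \<le> Z \<Longrightarrow> \<bar>y\<bar> powr q \<le> H \<Longrightarrow> tree_value p q x y Z H 0"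
| node: "tree_value p q x1 y1 Z1 H1 v1 \<Longrightarrow> tree_value p q x2 y2 Z2 H2 v2 \<Longrightarrow>
    tree_value p q ((x1 + x2) / 2) ((y1 + y2) / 2) ((Z1 + Z2) / 2) ((H1 + H2) / 2)
      ((v1 + v2) / 2 + \<bar>x1 - x2\<bar> * \<bar>y1 - y2\<bar> / 4)"

text \<open>Nodes are realised by \<open>glue\<close>. The subtrees may have different depths; as
  partial sums grow with the depth, both are read at the larger one, hence an inequality.\<close>

lemma tree_value_realized:
  assumes "tree_value p q x y Z H v" "0 \<le> p" "0 \<le> q"
  shows "\<exists>f g N. bounded_borel f \<and> bounded_borel g \<and> dyadic_mean f 0 0 = x \<and> dyadic_mean g 0 0 = y \<and>
    dyadic_mean (\<lambda>t. \<bar>f t\<bar> powr p) 0 0 \<le> Z \<and> dyadic_mean (\<lambda>t. \<bar>g t\<bar> powr q) 0 0 \<le> H \<and>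
    4 * v \<le> tree_sum (dyadic_mean f) (dyadic_mean g) N 0 0"
  using assms
proof (induction rule: tree_value.induct)
  case (leaf x Z y H)
  then show ?case
    by (intro exI[of _ "\<lambda>_. x"] exI[of _ "\<lambda>_. y"] exI[of _ 0]) (auto simp: bounded_borel_const dyadic_mean_const)
next
  case (node x1 y1 Z1 H1 v1 x2 y2 Z2 H2 v2)
  then obtain f1 g1 N1 where 1: "bounded_borel f1" "bounded_borel g1" "dyadic_mean f1 0 0 = x1" "dyadic_mean g1 0 0 = y1"
    "dyadic_mean (\<lambda>t. \<bar>f1 t\<bar> powr p) 0 0 \<le> Z1" "dyadic_mean (\<lambda>t. \<bar>g1 t\<bar> powr q) 0 0 \<le> H1"
    "4 * v1 \<le> tree_sum (dyadic_mean f1) (dyadic_mean g1) N1 0 0" by blast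
  from node obtain f2 g2 N2 where 2: "bounded_borel f2" "bounded_borel g2" "dyadic_mean f2 0 0 = x2" "dyadic_mean g2 0 0 = y2"
    "dyadic_mean (\<lambda>t. \<bar>f2 t\<bar> powr p) 0 0 \<le> Z2" "dyadic_mean (\<lambda>t. \<bar>g2 t\<bar> powr q) 0 0 \<le> H2"
    "4 * v2 \<le> tree_sum (dyadic_mean f2) (dyadic_mean g2) N2 0 0" by blast
  define f where "f = glue f1 f2"
  define g where "g = glue g1 g2"
  define N where "N = max N1 N2"
  have left: "tree_sum (dyadic_mean f) (dyadic_mean g) N 1 0 = tree_sum (dyadic_mean f1) (dyadic_mean g1) N 0 0"
    using tree_sum_shift[where d = 0 and n = 0 and k = 0 and F = "dyadic_mean f" and G = "dyadic_mean g"
        and F' = "dyadic_mean f1" and G' = "dyadic_mean g1" and N = N] by (simp add: f_def g_def dyadic_mean_glue del: One_nat_def)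
  have right: "tree_sum (dyadic_mean f) (dyadic_mean g) N 1 1 = tree_sum (dyadic_mean f2) (dyadic_mean g2) N 0 0"
    using tree_sum_shift[where d = 1 and n = 0 and k = 0 and F = "dyadic_mean f" and G = "dyadic_mean g"
        and F' = "dyadic_mean f2" and G' = "dyadic_mean g2" and N = N] by (simp add: f_def g_def dyadic_mean_glue del: One_nat_def)
  have top: "dyadic_mean f 1 0 = x1" "dyadic_mean f 1 1 = x2" "dyadic_mean g 1 0 = y1" "dyadic_mean g 1 1 = y2"
    using dyadic_mean_glue[of 0 0 f1 f2] dyadic_mean_glue[of 0 0 g1 g2] 1 2 by (simp_all add: f_def g_def)
  have "4 * v1 \<le> tree_sum (dyadic_mean f1) (dyadic_mean g1) N 0 0"
    using 1(7) tree_sum_mono[of N1 N "dyadic_mean f1" "dyadic_mean g1" 0 0] by (simp add: N_def)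
  moreover have "4 * v2 \<le> tree_sum (dyadic_mean f2) (dyadic_mean g2) N 0 0"
    using 2(7) tree_sum_mono[of N2 N "dyadic_mean f2" "dyadic_mean g2" 0 0] by (simp add: N_def)
  moreover have "tree_sum (dyadic_mean f) (dyadic_mean g) (Suc N) 0 0 = \<bar>x1 - x2\<bar> * \<bar>y1 - y2\<bar>
      + (tree_sum (dyadic_mean f1) (dyadic_mean g1) N 0 0 + tree_sum (dyadic_mean f2) (dyadic_mean g2) N 0 0) / 2"
    using left right top by (simp add: abs_minus_commute)
  ultimately have "4 * ((v1 + v2) / 2 + \<bar>x1 - x2\<bar> * \<bar>y1 - y2\<bar> / 4) \<le> tree_sum (dyadic_mean f) (dyadic_mean g) (Suc N) 0 0"
    by (simp add: field_simps)
  moreover have "dyadic_mean (\<lambda>t. \<bar>f t\<bar> powr p) 0 0 \<le> (Z1 + Z2) / 2" "dyadic_mean (\<lambda>t. \<bar>g t\<bar> powr q) 0 0 \<le> (H1 + H2) / 2"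
    unfolding f_def g_def glue_abs_powr using 1 2 node.prems
    by (simp_all add: dyadic_mean_glue_root bounded_borel_abs_powr)
  moreover have "bounded_borel f" "bounded_borel g" "dyadic_mean f 0 0 = (x1 + x2) / 2" "dyadic_mean g 0 0 = (y1 + y2) / 2"
    using 1 2 by (simp_all add: f_def g_def bounded_borel_glue dyadic_mean_glue_root)
  ultimately show ?case by blast
qed

section \<open>From scalar trees to admissible pairs\<close>

lemma has_strong_integral_scaled:
  fixes e :: "'b::real_inner"
  assumes f: "bounded_borel f"
  shows "has_strong_integral (lebesgue_on (dyadic n k)) (\<lambda>t. f t *\<^sub>R e) ((dyadic_mean f n k / 2 ^ n) *\<^sub>R e)"
proof -
  have [measurable]: "f \<in> borel_measurable borel" "dyadic n k \<in> sets borel" using f dyadic_lborel by (auto simp: bounded_borel_def)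
  have "has_bochner_integral lborel (\<lambda>t. indicator (dyadic n k) t * f t) (dyadic_mean f n k / 2 ^ n)"
    using bounded_borel_integrable[OF f] by (simp add: has_bochner_integral_iff dyadic_mean_def)
  then have "has_bochner_integral lebesgue (\<lambda>t. indicator (dyadic n k) t * f t) (dyadic_mean f n k / 2 ^ n)"
    by (simp add: has_bochner_integral_iff integrable_completion integral_completion)
  then have "has_bochner_integral (lebesgue_on (dyadic n k)) f (dyadic_mean f n k / 2 ^ n)"
    using lebesgue_dyadic(1)[of n k] by (simp add: has_bochner_integral_iff integrable_restrict_space integral_restrict_space)
  then have "has_strong_integral (lebesgue_on (dyadic n k)) f (dyadic_mean f n k / 2 ^ n)"
    by (simp add: has_strong_integral_iff_has_bochner_integral)
  then show ?thesis
    by (rule has_strong_integral_bounded_linear) (rule bounded_linear_scaleR_left)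
qed

lemma average_scaled:
  fixes e :: "'b::real_inner"
  assumes f: "bounded_borel f"
  shows "average (dyadic n k) (\<lambda>t. f t *\<^sub>R e) = dyadic_mean f n k *\<^sub>R e"
  by (simp add: average_def strong_integral_eq[OF has_strong_integral_scaled[OF f]] lebesgue_dyadic)

lemma nn_integral_scaled_powr:
  fixes e :: "'b::real_inner"
  assumes f: "bounded_borel f" and e: "norm e = 1" and p: "0 \<le> p"
  shows "(\<integral>\<^sup>+t. ennreal (norm (f t *\<^sub>R e) powr p) \<partial>lebesgue_on {0..<1}) = ennreal (dyadic_mean (\<lambda>t. \<bar>f t\<bar> powr p) 0 0)"
proof -
  have "has_bochner_integral (lebesgue_on {0..<1}) (\<lambda>t. \<bar>f t\<bar> powr p) (dyadic_mean (\<lambda>t. \<bar>f t\<bar> powr p) 0 0)"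
    using has_strong_integral_scaled[OF bounded_borel_abs_powr[OF f p], of 0 0 "1::real"]
    by (simp add: has_strong_integral_iff_has_bochner_integral dyadic_zero)
  then show ?thesis
    using e by (subst nn_integral_eq_integral[symmetric, THEN sym]) (auto simp: has_bochner_integral_iff)
qed

text \<open>The angle between \<open>e1\<close> and \<open>e2\<close> is immaterial, since jumps
  enter the sum only through their norms.\<close>

lemma tree_value_le_bellman_sup:
  fixes e1 e2 :: "'b::real_inner"
  assumes v: "tree_value p q x y Z H v" and e: "norm e1 = 1" "norm e2 = 1" and pq: "0 \<le> p" "0 \<le> q"
  shows "ennreal v \<le> bellman_sup p q (x *\<^sub>R e1) (y *\<^sub>R e2) Z H"
proof -
  obtain f g N where f: "bounded_borel f" and g: "bounded_borel g"
    and xy: "dyadic_mean f 0 0 = x" "dyadic_mean g 0 0 = y"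
    and ZH: "dyadic_mean (\<lambda>t. \<bar>f t\<bar> powr p) 0 0 \<le> Z" "dyadic_mean (\<lambda>t. \<bar>g t\<bar> powr q) 0 0 \<le> H"
    and N: "4 * v \<le> tree_sum (dyadic_mean f) (dyadic_mean g) N 0 0"
    using tree_value_realized[OF v pq] by blast
  define \<phi> where "\<phi> = (\<lambda>t. f t *\<^sub>R e1)"
  define \<psi> where "\<psi> = (\<lambda>t. g t *\<^sub>R e2)"
  have adm: "(\<phi>, \<psi>) \<in> admissible p q (x *\<^sub>R e1) (y *\<^sub>R e2) Z H"
    unfolding admissible_def
  proof (clarsimp, intro conjI)
    show "strong_integrable (lebesgue_on {0..<1}) \<phi>" "strong_integrable (lebesgue_on {0..<1}) \<psi>"
      using has_strong_integral_scaled[OF f, of 0 0 e1] has_strong_integral_scaled[OF g, of 0 0 e2]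
      by (auto simp: strong_integrable_def \<phi>_def \<psi>_def dyadic_zero)
    show "average {0..<1} \<phi> = x *\<^sub>R e1" "average {0..<1} \<psi> = y *\<^sub>R e2"
      using average_scaled[OF f, of 0 0 e1] average_scaled[OF g, of 0 0 e2] xy by (simp_all add: \<phi>_def \<psi>_def dyadic_zero)
    show "(\<integral>\<^sup>+t. ennreal (norm (\<phi> t) powr p) \<partial>lebesgue_on {0..<1}) \<le> ennreal Z"
      "(\<integral>\<^sup>+t. ennreal (norm (\<psi> t) powr q) \<partial>lebesgue_on {0..<1}) \<le> ennreal H"
      unfolding \<phi>_def \<psi>_def nn_integral_scaled_powr[OF f e(1) pq(1)] nn_integral_scaled_powr[OF g e(2) pq(2)]
      using ZH by (auto intro: ennreal_leI)
  qed
  have "tree_sum (\<lambda>n k. average (dyadic n k) \<phi>) (\<lambda>n k. average (dyadic n k) \<psi>) N n k = tree_sum (dyadic_mean f) (dyadic_mean g) N n k" for n k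
    unfolding \<phi>_def \<psi>_def average_scaled[OF f] average_scaled[OF g]
    by (induction N arbitrary: n k) (simp_all add: e flip: scaleR_diff_left)
  then have "ennreal (4 * v) \<le> haar_sum \<phi> \<psi>"
    using dyadic_infsum_ge[of \<phi> \<psi> N] N by (auto intro: order.trans ennreal_leI)
  also have "\<dots> \<le> (SUP (\<phi>, \<psi>) \<in> admissible p q (x *\<^sub>R e1) (y *\<^sub>R e2) Z H.
        haar_sum \<phi> \<psi>)"
    by (rule SUP_upper2[OF adm]) simp
  finally have "ennreal (1 / 4) * ennreal (4 * v) \<le> bellman_sup p q (x *\<^sub>R e1) (y *\<^sub>R e2) Z H"
    unfolding bellman_sup_def by (intro mult_left_mono) auto
  moreover have "ennreal (1 / 4) * ennreal (4 * v) = ennreal v" by (subst ennreal_mult'[symmetric]) auto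
  ultimately show ?thesis by simp
qed

section \<open>The best tree value and its concavity along segments\<close>

lemma abs_powr_convex:
  fixes x1 x2 l p :: real
  assumes p: "1 < p" and l: "0 \<le> l" "l \<le> 1"
  shows "\<bar>l * x1 + (1 - l) * x2\<bar> powr p \<le> l * \<bar>x1\<bar> powr p + (1 - l) * \<bar>x2\<bar> powr p"
proof (cases "l * x1 + (1 - l) * x2 = 0")
  case True
  then show ?thesis using l by simp
next
  case False
  define m where "m = \<bar>l * x1 + (1 - l) * x2\<bar>"
  define k where "k = p * m powr (p - 1)"
  have m: "0 < m" using False by (simp add: m_def)
  have k: "0 \<le> k" using p by (simp add: k_def)
  have tri: "m \<le> l * \<bar>x1\<bar> + (1 - l) * \<bar>x2\<bar>"
    unfolding m_def using l abs_triangle_ineq[of "l * x1" "(1 - l) * x2"] by (simp add: abs_mult)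
  have "l * (m powr p + k * (\<bar>x1\<bar> - m)) + (1 - l) * (m powr p + k * (\<bar>x2\<bar> - m)) \<le> l * \<bar>x1\<bar> powr p + (1 - l) * \<bar>x2\<bar> powr p"
    unfolding k_def using l p m by (intro add_mono mult_left_mono powr_ge_tangent) auto
  moreover have "l * (m powr p + k * (\<bar>x1\<bar> - m)) + (1 - l) * (m powr p + k * (\<bar>x2\<bar> - m))
      = m powr p + k * (l * \<bar>x1\<bar> + (1 - l) * \<bar>x2\<bar> - m)" by (simp add: algebra_simps)
  moreover have "0 \<le> k * (l * \<bar>x1\<bar> + (1 - l) * \<bar>x2\<bar> - m)" using tri k by (intro mult_nonneg_nonneg) auto
  ultimately show ?thesis by (simp add: m_def)
qed

text \<open>The infimum \<open>m\<close> of \<open>k\<close> satisfies \<open>m \<ge> m / 2\<close>.\<close>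

lemma nonneg_of_halving:
  fixes k :: "real \<Rightarrow> real"
  assumes bound: "\<And>t. 0 \<le> t \<Longrightarrow> t \<le> 1 \<Longrightarrow> - M \<le> k t"
    and left: "\<And>t. 0 \<le> t \<Longrightarrow> t \<le> 1 / 2 \<Longrightarrow> k (2 * t) / 2 \<le> k t"
    and right: "\<And>t. 1 / 2 \<le> t \<Longrightarrow> t \<le> 1 \<Longrightarrow> k (2 * t - 1) / 2 \<le> k t"
    and t: "0 \<le> t" "t \<le> 1"
  shows "0 \<le> k t"
proof -
  define m where "m = Inf (k ` {0..1})"
  have bdd: "bdd_below (k ` {0..1})" using bound by (auto intro!: bdd_belowI[of _ "- M"])
  have le: "m \<le> k s" if "0 \<le> s" "s \<le> 1" for s
    unfolding m_def using that by (intro cInf_lower bdd) auto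
  have "m / 2 \<le> k s" if "0 \<le> s" "s \<le> 1" for s
    using that le[of "2 * s"] le[of "2 * s - 1"] left[of s] right[of s] by (cases "s \<le> 1 / 2") auto
  then have "m / 2 \<le> m" unfolding m_def by (intro cInf_greatest) auto
  then show ?thesis using le[OF t] by simp
qed

definition tree_bellman :: "real \<Rightarrow> real \<Rightarrow> real \<Rightarrow> real \<Rightarrow> real \<Rightarrow> real \<Rightarrow> real" where
  "tree_bellman p q x y Z H = Sup {v. tree_value p q x y Z H v}"

text \<open>The surplus at a node is handed to both children and so travels down to the leaves,
  which only ask for upper bounds.\<close>

lemma tree_value_mono:
  assumes "tree_value p q x y Z H v" "Z \<le> Z'" "H \<le> H'"
  shows "tree_value p q x y Z' H' v"
  using assms
proof (induction arbitrary: Z' H' rule: tree_value.induct)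
  case (leaf x Z y H)
  then show ?case by (intro tree_value.leaf) auto
next
  case (node x1 y1 Z1 H1 v1 x2 y2 Z2 H2 v2)
  define a where "a = Z' - (Z1 + Z2) / 2"
  define b where "b = H' - (H1 + H2) / 2"
  have "tree_value p q ((x1 + x2) / 2) ((y1 + y2) / 2) (((Z1 + a) + (Z2 + a)) / 2) (((H1 + b) + (H2 + b)) / 2)
      ((v1 + v2) / 2 + \<bar>x1 - x2\<bar> * \<bar>y1 - y2\<bar> / 4)"
    using node.prems by (intro tree_value.node node.IH) (auto simp: a_def b_def)
  moreover have "((Z1 + a) + (Z2 + a)) / 2 = Z'" "((H1 + b) + (H2 + b)) / 2 = H'" by (simp_all add: a_def b_def field_simps)
  ultimately show ?case by simp
qed

lemma tree_value_scale:
  assumes "tree_value p q x y Z H v" "0 \<le> s" "0 \<le> t"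
  shows "tree_value p q (s * x) (t * y) (s powr p * Z) (t powr q * H) (s * t * v)"
  using assms
proof (induction rule: tree_value.induct)
  case (leaf x Z y H)
  then have "tree_value p q (s * x) (t * y) (s powr p * Z) (t powr q * H) 0"
    by (intro tree_value.leaf) (auto simp: abs_mult powr_mult intro!: mult_left_mono)
  then show ?case by simp
next
  case (node x1 y1 Z1 H1 v1 x2 y2 Z2 H2 v2)
  have "tree_value p q ((s * x1 + s * x2) / 2) ((t * y1 + t * y2) / 2) ((s powr p * Z1 + s powr p * Z2) / 2)
     ((t powr q * H1 + t powr q * H2) / 2) ((s * t * v1 + s * t * v2) / 2 + \<bar>s * x1 - s * x2\<bar> * \<bar>t * y1 - t * y2\<bar> / 4)"
    using node by (intro tree_value.node) auto
  moreover have "\<bar>s * x1 - s * x2\<bar> * \<bar>t * y1 - t * y2\<bar> = s * t * (\<bar>x1 - x2\<bar> * \<bar>y1 - y2\<bar>)"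
    using node.prems by (simp add: abs_mult flip: right_diff_distrib)
  ultimately show ?case by (simp add: algebra_simps)
qed

locale bellman_exponents =
  fixes p q :: real
  assumes p: "1 < p" "p < 2" and q: "q = p / (p - 1)"
begin

lemmas conj = conjugate_exponent[OF p(1) q]

abbreviation "T \<equiv> tree_bellman p q"

definition feasible :: "real \<Rightarrow> real \<Rightarrow> real \<Rightarrow> real \<Rightarrow> bool" where
  "feasible x y Z H \<longleftrightarrow> \<bar>x\<bar> powr p \<le> Z \<and> \<bar>y\<bar> powr q \<le> H"

lemma tree_value_nonneg: "tree_value p q x y Z H v \<Longrightarrow> 0 \<le> Z \<and> 0 \<le> H"
  by (induction rule: tree_value.induct) (auto intro: order.trans[OF powr_ge_zero])

text \<open>The upper bound already proved, for the Hilbert space of reals, makes the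
  \<open>Sup\<close> in \<open>tree_bellman\<close> meaningful. The values chosen for its free
  parameters are arbitrary.\<close>

lemma tree_value_bdd_above: "bdd_above {v. tree_value p q x y Z H v}"
proof (cases "{v. tree_value p q x y Z H v} = {}")
  case False
  then have ZH: "0 \<le> Z" "0 \<le> H" using tree_value_nonneg by blast+
  define B where "B = 1 / p * (burk_const p 1 * burkholder p x 0 + young_const p 1 * Z) + 1 powr (1 - q) / q * H - 0 \<bullet> y"
  have "v \<le> max 0 B" if "tree_value p q x y Z H v" for v
  proof -
    have "ennreal v \<le> bellman_sup p q (x *\<^sub>R (1::real)) (y *\<^sub>R (1::real)) Z H"
      using p conj by (intro tree_value_le_bellman_sup[OF that]) auto
    also have "\<dots> \<le> ennreal B"
      using bellman_sup_le_burkholder[OF p q ZH, of 1 1 x y 0] by (simp add: B_def)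
    finally show ?thesis by (auto simp: ennreal_le_iff2 le_max_iff_disj)
  qed
  then show ?thesis by (auto intro!: bdd_aboveI)
next
  case True
  then show ?thesis by (simp only:) simp
qed

lemma le_tree_bellman: "tree_value p q x y Z H v \<Longrightarrow> v \<le> T x y Z H"
  unfolding tree_bellman_def by (intro cSup_upper tree_value_bdd_above) simp

lemma tree_bellman_leI:
  assumes "feasible x y Z H" "\<And>v. tree_value p q x y Z H v \<Longrightarrow> v \<le> b"
  shows "T x y Z H \<le> b"
  unfolding tree_bellman_def
  using assms tree_value.leaf[of x p Z y q H] by (intro cSup_least) (auto simp: feasible_def)

lemma tree_bellman_nonneg: "feasible x y Z H \<Longrightarrow> 0 \<le> T x y Z H"
  using le_tree_bellman tree_value.leaf by (auto simp: feasible_def)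

lemma tree_bellman_midpoint:
  assumes "feasible x1 y1 Z1 H1" "feasible x2 y2 Z2 H2"
  shows "(T x1 y1 Z1 H1 + T x2 y2 Z2 H2) / 2 + \<bar>x1 - x2\<bar> * \<bar>y1 - y2\<bar> / 4
    \<le> T ((x1 + x2) / 2) ((y1 + y2) / 2) ((Z1 + Z2) / 2) ((H1 + H2) / 2)"
proof -
  let ?T = "T ((x1 + x2) / 2) ((y1 + y2) / 2) ((Z1 + Z2) / 2) ((H1 + H2) / 2)"
  let ?d = "\<bar>x1 - x2\<bar> * \<bar>y1 - y2\<bar> / 4"
  have "T x1 y1 Z1 H1 \<le> 2 * (?T - ?d) - T x2 y2 Z2 H2"
  proof (rule tree_bellman_leI[OF assms(1)])
    fix v1 assume v1: "tree_value p q x1 y1 Z1 H1 v1"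
    have "T x2 y2 Z2 H2 \<le> 2 * (?T - ?d) - v1"
    proof (rule tree_bellman_leI[OF assms(2)])
      fix v2 assume "tree_value p q x2 y2 Z2 H2 v2"
      from le_tree_bellman[OF tree_value.node[OF v1 this]]
      show "v2 \<le> 2 * (?T - ?d) - v1" by (simp add: field_simps)
    qed
    then show "v1 \<le> 2 * (?T - ?d) - T x2 y2 Z2 H2" by simp
  qed
  then show ?thesis by (simp add: field_simps)
qed

lemma tree_bellman_mono:
  assumes "feasible x y Z H" "Z \<le> Z'" "H \<le> H'"
  shows "T x y Z H \<le> T x y Z' H'"
  using assms by (intro tree_bellman_leI le_tree_bellman) (auto intro: tree_value_mono)

lemma tree_bellman_scale:
  assumes "feasible x y Z H" "0 < s" "0 < t"
  shows "s * t * T x y Z H \<le> T (s * x) (t * y) (s powr p * Z) (t powr q * H)"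
proof -
  have "T x y Z H \<le> T (s * x) (t * y) (s powr p * Z) (t powr q * H) / (s * t)"
  proof (rule tree_bellman_leI[OF assms(1)])
    fix v assume "tree_value p q x y Z H v"
    then have "s * t * v \<le> T (s * x) (t * y) (s powr p * Z) (t powr q * H)"
      using assms by (intro le_tree_bellman tree_value_scale) auto
    then show "v \<le> T (s * x) (t * y) (s powr p * Z) (t powr q * H) / (s * t)"
      using assms by (simp add: pos_le_divide_eq mult.commute)
  qed
  then show ?thesis using assms by (simp add: pos_le_divide_eq mult.commute)
qed

lemma feasible_convex:
  assumes "feasible x1 y1 Z1 H1" "feasible x2 y2 Z2 H2" "0 \<le> l" "l \<le> 1"
  shows "feasible (l * x1 + (1 - l) * x2) (l * y1 + (1 - l) * y2) (l * Z1 + (1 - l) * Z2) (l * H1 + (1 - l) * H2)"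
  unfolding feasible_def
proof
  show "\<bar>l * x1 + (1 - l) * x2\<bar> powr p \<le> l * Z1 + (1 - l) * Z2"
    by (rule order.trans[OF abs_powr_convex[OF p(1) assms(3,4)]]) (use assms in \<open>auto simp: feasible_def intro!: add_mono mult_left_mono\<close>)
  show "\<bar>l * y1 + (1 - l) * y2\<bar> powr q \<le> l * H1 + (1 - l) * H2"
    by (rule order.trans[OF abs_powr_convex[OF conj(1) assms(3,4)]]) (use assms in \<open>auto simp: feasible_def intro!: add_mono mult_left_mono\<close>)
qed

text \<open>All real \<open>l\<close> are reached without continuity: each is the midpoint of an
  endpoint and another point of \<open>[0, 1]\<close>, and the gain \<open>l * (1 - l) * d\<close>
  is exactly compatible with midpoints. So the difference \<open>k\<close> of the two sides at least
  halves in this way, and \<open>nonneg_of_halving\<close> applies, nonnegativity of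
  \<open>T\<close> giving the lower bound.\<close>

lemma tree_bellman_line:
  assumes D1: "feasible x1 y1 Z1 H1" and D2: "feasible x2 y2 Z2 H2" and l: "0 \<le> l" "l \<le> 1"
  shows "l * T x1 y1 Z1 H1 + (1 - l) * T x2 y2 Z2 H2 + l * (1 - l) * (\<bar>x1 - x2\<bar> * \<bar>y1 - y2\<bar>)
    \<le> T (l * x1 + (1 - l) * x2) (l * y1 + (1 - l) * y2) (l * Z1 + (1 - l) * Z2) (l * H1 + (1 - l) * H2)"
proof -
  define A B where "A = T x1 y1 Z1 H1" and "B = T x2 y2 Z2 H2"
  define d where "d = \<bar>x1 - x2\<bar> * \<bar>y1 - y2\<bar>"
  define F where "F = (\<lambda>l. T (l * x1 + (1 - l) * x2) (l * y1 + (1 - l) * y2) (l * Z1 + (1 - l) * Z2) (l * H1 + (1 - l) * H2))"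
  define k where "k = (\<lambda>l. F l - (l * A + (1 - l) * B + l * (1 - l) * d))"
  have AB: "0 \<le> A" "0 \<le> B" "0 \<le> d" using tree_bellman_nonneg D1 D2 by (auto simp: A_def B_def d_def)
  have mid: "(F s + F t) / 2 + (s - t)\<^sup>2 * d / 4 \<le> F ((s + t) / 2)" if st: "0 \<le> s" "s \<le> 1" "0 \<le> t" "t \<le> 1" for s t
  proof -
    have e: "((s * u + (1 - s) * w) + (t * u + (1 - t) * w)) / 2 = ((s + t) / 2) * u + (1 - (s + t) / 2) * w" for u w :: real
      by (simp add: field_simps)
    have "\<bar>(s * u + (1 - s) * w) - (t * u + (1 - t) * w)\<bar> = \<bar>s - t\<bar> * \<bar>u - w\<bar>" for u w :: real
    proof -
      have "(s * u + (1 - s) * w) - (t * u + (1 - t) * w) = (s - t) * (u - w)" by (simp add: algebra_simps)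
      then show ?thesis by (simp add: abs_mult)
    qed
    then have "\<bar>(s * x1 + (1 - s) * x2) - (t * x1 + (1 - t) * x2)\<bar> * \<bar>(s * y1 + (1 - s) * y2) - (t * y1 + (1 - t) * y2)\<bar> = (s - t)\<^sup>2 * d"
      by (simp add: d_def power2_eq_square)
    then show ?thesis
      using tree_bellman_midpoint[OF feasible_convex[OF D1 D2 st(1,2)] feasible_convex[OF D1 D2 st(3,4)]]
      unfolding e F_def by simp
  qed
  have F01: "F 0 = B" "F 1 = A" by (simp_all add: F_def A_def B_def)
  have "0 \<le> k l"
  proof (rule nonneg_of_halving[where k = k and M = "A + B + d"])
    fix t :: real assume t: "0 \<le> t" "t \<le> 1"
    have "0 \<le> F t" unfolding F_def by (intro tree_bellman_nonneg feasible_convex D1 D2 t)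
    moreover have "t * A \<le> A" "(1 - t) * B \<le> B" using t AB by (auto intro: mult_left_le_one_le)
    moreover have "t * (1 - t) * d \<le> d" using t AB by (intro mult_left_le_one_le) (auto intro: mult_le_one)
    ultimately show "- (A + B + d) \<le> k t" by (simp add: k_def)
  next
    fix t :: real assume t: "0 \<le> t" "t \<le> 1 / 2"
    show "k (2 * t) / 2 \<le> k t"
      using mid[of "2 * t" 0] t unfolding k_def by (simp add: F01 power2_eq_square field_simps)
  next
    fix t :: real assume t: "1 / 2 \<le> t" "t \<le> 1"
    have "(2 * t - 1 + 1) / 2 = t" by simp
    then show "k (2 * t - 1) / 2 \<le> k t"
      using mid[of "2 * t - 1" 1] t unfolding k_def by (simp add: F01 power2_eq_square field_simps)
  qed (use l in auto)
  then show ?thesis by (simp add: k_def F_def A_def B_def d_def)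
qed

end

section \<open>Values on the axis where the second mean vanishes\<close>

context bellman_exponents
begin

lemma axis_scale_le: 
  assumes "1 \<le> Z" "0 < H"
  shows "T 1 0 Z H \<le> H powr (1 / q) * T 1 0 Z 1"
proof -
  define t where "t = H powr (- (1 / q))"
  have t: "0 < t" using assms by (simp add: t_def)
  have "t powr q = H powr (- (1 / q) * q)" unfolding t_def by (rule powr_powr)
  then have tq: "t powr q = 1 / H" using assms conj powr_minus_divide[of H 1] by simp
  have "1 * t * T 1 0 Z H \<le> T (1 * 1) (t * 0) (1 powr p * Z) (t powr q * H)"
    using assms t conj by (intro tree_bellman_scale) (auto simp: feasible_def)
  then have "t * T 1 0 Z H \<le> T 1 0 Z 1" using assms by (simp add: tq)
  moreover have "t = 1 / H powr (1 / q)" using assms by (simp add: t_def powr_minus_divide)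
  ultimately show ?thesis using assms by (simp add: pos_divide_le_eq mult.commute)
qed

lemma axis_scale_ge:
  assumes "1 \<le> Z" "0 < H" "0 < r"
  shows "r * H powr (1 / q) * T 1 0 Z 1 \<le> T r 0 (r powr p * Z) H"
proof -
  have "r * H powr (1 / q) * T 1 0 Z 1 \<le> T (r * 1) (H powr (1 / q) * 0) (r powr p * Z) ((H powr (1 / q)) powr q * 1)"
    using assms by (intro tree_bellman_scale) (auto simp: feasible_def)
  then show ?thesis using assms conj by (simp add: powr_powr)
qed

text \<open>
  One step of a self-similar splitting: from \<open>(1, 0)\<close> the tree goes with probability \<open>w\<close> each to the
  stopping points \<open>(a, \<plusminus> s)\<close>, and otherwise to \<open>(r, 0)\<close>, which is \<open>(1, 0)\<close> up to scaling.
\<close>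

lemma axis_split:
  assumes a: "0 < a" "a < 1" and s: "0 < s" and Z: "1 \<le> Z" and w: "0 < w" "w < 1 / 2"
    and r: "r = (1 - 2 * w * a) / (1 - 2 * w)"
    and Zr: "2 * w * a powr p + (1 - 2 * w) * (r powr p * Z) \<le> Z"
  shows "(1 - 2 * w * a) * T 1 0 Z 1 + 2 * w * (1 - 2 * w) * (1 - a) * s
    \<le> T 1 0 Z (1 + 2 * w * (s powr q - 1))"
proof -
  \<comment> \<open>Two binary splits: first \<open>(a, - s)\<close> with weight \<open>w\<close>,
    then \<open>(a, s)\<close> with conditional weight \<open>w / (1 - w)\<close>, so that both have
    total weight \<open>w\<close>. \<open>Mx\<close>, \<open>My\<close>, \<open>MZ\<close>,
    \<open>MH\<close> describe the node in between.\<close>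
  define \<mu> where "\<mu> = w / (1 - w)"
  have \<mu>: "0 < \<mu>" "\<mu> < 1" "1 - \<mu> = (1 - 2 * w) / (1 - w)" "(1 - w) * \<mu> = w" using w by (simp_all add: \<mu>_def field_simps)
  have r1: "1 < r" using w a by (simp add: r pos_less_divide_eq)
  define Z1 where "Z1 = r powr p * Z"
  have dr: "feasible r 0 Z1 1" using r1 Z conj by (simp add: feasible_def Z1_def)
  have ds: "feasible a s (a powr p) (s powr q)" "feasible a (- s) (a powr p) (s powr q)" using a s by (simp_all add: feasible_def)
  define Mx My MZ MH where "Mx = \<mu> * a + (1 - \<mu>) * r" and "My = \<mu> * s + (1 - \<mu>) * 0"
    and "MZ = \<mu> * a powr p + (1 - \<mu>) * Z1" and "MH = \<mu> * s powr q + (1 - \<mu>) * 1"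
  have dM: "feasible Mx My MZ MH" unfolding Mx_def My_def MZ_def MH_def using \<mu> by (intro feasible_convex ds dr) auto
  have M: "(1 - \<mu>) * T r 0 Z1 1 + \<mu> * (1 - \<mu>) * ((r - a) * s) \<le> T Mx My MZ MH"
  proof -
    have "0 \<le> \<mu> * T a s (a powr p) (s powr q)" using \<mu> tree_bellman_nonneg[OF ds(1)] by simp
    moreover have d: "\<bar>a - r\<bar> * \<bar>s - 0\<bar> = (r - a) * s" using r1 a s by simp
    have "\<mu> * T a s (a powr p) (s powr q) + (1 - \<mu>) * T r 0 Z1 1 + \<mu> * (1 - \<mu>) * ((r - a) * s) \<le> T Mx My MZ MH"
      using tree_bellman_line[OF ds(1) dr, of \<mu>] \<mu>(1,2)
      unfolding Mx_def[symmetric] My_def[symmetric] MZ_def[symmetric] MH_def[symmetric] d by simp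
    ultimately show ?thesis by linarith
  qed
  have x1: "w * a + (1 - w) * Mx = 1"
  proof -
    have "(1 - w) * Mx = (1 - w) * \<mu> * a + (1 - w) * (1 - \<mu>) * r" by (simp add: Mx_def algebra_simps)
    also have "\<dots> = w * a + (1 - 2 * w) * r" unfolding \<mu>(3) \<mu>(4) using w by simp
    also have "(1 - 2 * w) * r = 1 - 2 * w * a" using w by (simp add: r)
    finally show ?thesis by simp
  qed
  have y0: "w * (- s) + (1 - w) * My = 0"
  proof -
    have "(1 - w) * My = (1 - w) * \<mu> * s" by (simp add: My_def)
    then show ?thesis unfolding \<mu>(4) by simp
  qed
  have ww: "(1 - w) * (1 - \<mu>) = 1 - 2 * w" unfolding \<mu>(3) using w by simp
  have Z0: "w * a powr p + (1 - w) * MZ \<le> Z"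
  proof -
    have "(1 - w) * MZ = (1 - w) * \<mu> * a powr p + (1 - w) * (1 - \<mu>) * Z1" by (simp add: MZ_def algebra_simps)
    then show ?thesis using Zr unfolding \<mu>(4) ww Z1_def by simp
  qed
  have H0: "w * s powr q + (1 - w) * MH = 1 + 2 * w * (s powr q - 1)"
  proof -
    have "(1 - w) * MH = (1 - w) * \<mu> * s powr q + (1 - w) * (1 - \<mu>)" by (simp add: MH_def algebra_simps)
    then show ?thesis unfolding \<mu>(4) ww by (simp add: algebra_simps)
  qed
  \<comment> \<open>Each split gains at least \<open>w * (1 - 2 * w) * (1 - a) * s\<close>; to first
    order in \<open>w\<close> nothing is lost.\<close>
  have gain1: "w * (1 - 2 * w) * (1 - a) * s \<le> w * (1 - w) * ((Mx - a) * (My + s))"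
  proof -
    have "1 \<le> Mx"
    proof -
      have "w * a \<le> w * 1" using w a by (intro mult_left_mono) auto
      moreover define P where "P = (1 - w) * Mx"
      then have "w * a + P = 1" using x1 by simp
      ultimately have "(1 - w) * 1 \<le> (1 - w) * Mx" unfolding P_def[symmetric] by simp
      then show ?thesis using w mult_le_cancel_left_pos[of "1 - w" 1 Mx] by linarith
    qed
    moreover have "0 \<le> My" using \<mu> s by (simp add: My_def)
    ultimately have m1: "(1 - a) * s \<le> (Mx - a) * (My + s)" using a s by (intro mult_mono) auto
    have m2: "w * (1 - 2 * w) \<le> w * (1 - w)" using w by (intro mult_left_mono) auto
    have "(w * (1 - 2 * w)) * ((1 - a) * s) \<le> (w * (1 - w)) * ((Mx - a) * (My + s))"
      using w a s by (intro mult_mono[OF m2 m1]) auto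
    then show ?thesis by (simp only: mult.assoc)
  qed
  have gain2: "w * (1 - 2 * w) * (1 - a) * s \<le> (1 - w) * (\<mu> * (1 - \<mu>) * ((r - a) * s))"
  proof -
    have "1 - 2 * w \<le> 1 - \<mu>" unfolding \<mu>(3) using w by (simp add: pos_le_divide_eq)
    moreover have "(1 - a) * s \<le> (r - a) * s" using r1 s by (intro mult_right_mono) auto
    ultimately have "(1 - 2 * w) * ((1 - a) * s) \<le> (1 - \<mu>) * ((r - a) * s)" using w a s \<mu> by (intro mult_mono) auto
    then have "w * ((1 - 2 * w) * ((1 - a) * s)) \<le> ((1 - w) * \<mu>) * ((1 - \<mu>) * ((r - a) * s))"
      unfolding \<mu>(4) using w by (intro mult_left_mono) auto
    then show ?thesis by (simp only: mult.assoc)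
  qed
  have "w * T a (- s) (a powr p) (s powr q) + (1 - w) * T Mx My MZ MH + w * (1 - w) * ((Mx - a) * (My + s))
     \<le> T 1 0 (w * a powr p + (1 - w) * MZ) (1 + 2 * w * (s powr q - 1))"
  proof -
    have "0 \<le> My" using \<mu> s by (simp add: My_def)
    moreover have "a \<le> Mx"
    proof -
      have "(1 - \<mu>) * a \<le> (1 - \<mu>) * r" using r1 a \<mu> by (intro mult_left_mono) auto
      then show ?thesis by (simp add: Mx_def algebra_simps)
    qed
    ultimately have "\<bar>a - Mx\<bar> = Mx - a" "\<bar>- s - My\<bar> = My + s" using s by auto
    then show ?thesis
      using tree_bellman_line[OF ds(2) dM, of w] w unfolding x1 y0 H0 by simp
  qed
  also have "\<dots> \<le> T 1 0 Z (1 + 2 * w * (s powr q - 1))"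
  proof (rule tree_bellman_mono[OF _ Z0 order_refl])
    show "feasible 1 0 (w * a powr p + (1 - w) * MZ) (1 + 2 * w * (s powr q - 1))"
      using feasible_convex[OF ds(2) dM, of w] w unfolding x1 y0 H0 by simp
  qed
  finally have "w * T a (- s) (a powr p) (s powr q) + (1 - w) * T Mx My MZ MH + w * (1 - w) * ((Mx - a) * (My + s))
     \<le> T 1 0 Z (1 + 2 * w * (s powr q - 1))" .
  moreover have "0 \<le> w * T a (- s) (a powr p) (s powr q)" using tree_bellman_nonneg[OF ds(2)] w by simp
  moreover have "(1 - w) * ((1 - \<mu>) * T r 0 Z1 1 + \<mu> * (1 - \<mu>) * ((r - a) * s)) \<le> (1 - w) * T Mx My MZ MH"
    using M w by (intro mult_left_mono) auto
  moreover have "(1 - w) * ((1 - \<mu>) * T r 0 Z1 1 + \<mu> * (1 - \<mu>) * ((r - a) * s))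
     = (1 - 2 * w) * T r 0 Z1 1 + (1 - w) * (\<mu> * (1 - \<mu>) * ((r - a) * s))"
    by (simp only: distrib_left mult.assoc[symmetric] ww)
  moreover have "(1 - 2 * w * a) * T 1 0 Z 1 \<le> (1 - 2 * w) * T r 0 Z1 1"
  proof -
    have "r * T 1 0 Z 1 \<le> T r 0 Z1 1" using axis_scale_ge[of Z 1 r] Z r1 by (simp add: Z1_def)
    then have "(1 - 2 * w) * (r * T 1 0 Z 1) \<le> (1 - 2 * w) * T r 0 Z1 1" using w by (intro mult_left_mono) auto
    moreover have "(1 - 2 * w) * r = 1 - 2 * w * a" using w by (simp add: r)
    ultimately show ?thesis by (simp only: mult.assoc[symmetric])
  qed
  ultimately show ?thesis using gain1 gain2 by linarith
qed

text \<open>Rescaling to \<open>r > 1\<close> costs moment, stopping at \<open>a < 1\<close> saves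
  some. The hypothesis says that the balance has positive derivative at \<open>w = 0\<close>, so
  small \<open>w\<close> stay within the budget \<open>Z\<close>.\<close>

lemma axis_split_room:
  assumes a: "0 < a" "a < 1" and less: "a powr p < Z * (1 - p * (1 - a))"
  shows "\<exists>d>0. \<forall>w. 0 < w \<longrightarrow> w < d \<longrightarrow>
    2 * w * a powr p + (1 - 2 * w) * (((1 - 2 * w * a) / (1 - 2 * w)) powr p * Z) \<le> Z"
proof -
  define \<phi> where "\<phi> = (\<lambda>w. Z - 2 * w * a powr p - (1 - 2 * w) powr (1 - p) * (1 - 2 * w * a) powr p * Z)"
  have der: "(\<phi> has_real_derivative 2 * (Z * (1 - p * (1 - a)) - a powr p)) (at 0)"
    unfolding \<phi>_def by (auto intro!: derivative_eq_intros simp: algebra_simps)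
  have "\<exists>d>0. \<forall>w>0. w < d \<longrightarrow> \<phi> 0 < \<phi> (0 + w)"
    by (rule DERIV_pos_inc_right[OF der]) (use less in simp)
  then obtain d where d: "0 < d" "\<And>w. 0 < w \<Longrightarrow> w < d \<Longrightarrow> \<phi> 0 < \<phi> (0 + w)" by blast
  have "2 * w * a powr p + (1 - 2 * w) * (((1 - 2 * w * a) / (1 - 2 * w)) powr p * Z) \<le> Z"
    if w: "0 < w" "w < min d (1 / 2)" for w
  proof -
    have "0 < 1 - 2 * w" using w by simp
    moreover have "0 < 1 - 2 * w * a" using w a mult_strict_mono[of "2 * w" 1 a 1] by simp
    ultimately have "(1 - 2 * w) * ((1 - 2 * w * a) / (1 - 2 * w)) powr p = (1 - 2 * w) powr (1 - p) * (1 - 2 * w * a) powr p"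
      by (simp add: powr_divide powr_diff)
    then show ?thesis using d(2)[of w] w unfolding \<phi>_def by (simp add: mult.assoc[symmetric])
  qed
  then show ?thesis using d(1) by (intro exI[of _ "min d (1 / 2)"]) auto
qed

text \<open>A fixed-point argument: \<open>axis_split\<close> bounds the value at a perturbed
  \<open>H\<close> from below by the value itself plus a gain, and scaling in \<open>H\<close> leads
  back. Comparing first-order terms in \<open>w\<close> leaves
  \<open>(1 - a) * s \<le> A * S\<close>.\<close>

lemma axis_lower_aux:
  assumes a: "0 < a" "a < 1" and pos: "0 < 1 - p * (1 - a)" and less: "a powr p < Z * (1 - p * (1 - a))" and Z: "1 \<le> Z"
  shows "(1 - a) * (1 - p * (1 - a)) powr (- (1 / p)) \<le> T 1 0 Z 1"
proof -
  define A where "A = T 1 0 Z 1"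
  define S where "S = 1 - p * (1 - a)"
  \<comment> \<open>For general \<open>s\<close> the argument yields the lower bound
    \<open>(1 - a) * s / ((s powr q - 1) / q + a)\<close> for \<open>A\<close>; it is largest at
    \<open>s powr q = S\<close>, where the denominator is \<open>S\<close>.\<close>
  define s where "s = S powr (1 / q)"
  have s: "0 < s" "s powr q = S" using pos conj by (simp_all add: s_def S_def powr_powr)
  have A: "0 \<le> A" unfolding A_def using Z by (intro tree_bellman_nonneg) (simp add: feasible_def)
  obtain d where d: "0 < d" "\<And>w. 0 < w \<Longrightarrow> w < d \<Longrightarrow>
    2 * w * a powr p + (1 - 2 * w) * (((1 - 2 * w * a) / (1 - 2 * w)) powr p * Z) \<le> Z"
    using axis_split_room[OF a less] by blast
  have step: "(1 - 2 * w) * (1 - a) * s \<le> A * S" if w: "0 < w" "w < min d (1 / 2)" for w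
  proof -
    define u where "u = 2 * w * (S - 1)"
    have S1: "S < 1" using a p by (simp add: S_def)
    have u: "- 1 < u"
    proof -
      have "2 * w * (1 - S) < 1 * 1" using w S1 pos by (intro mult_strict_mono) (auto simp: S_def)
      then show ?thesis by (simp add: u_def algebra_simps)
    qed
    have "(1 - 2 * w * a) * A + 2 * w * (1 - 2 * w) * (1 - a) * s \<le> T 1 0 Z (1 + u)"
      unfolding A_def u_def s(2)[symmetric] using w d(2)[of w] by (intro axis_split[OF a s(1) Z _ _ refl]) auto
    also have "\<dots> \<le> (1 + u) powr (1 / q) * A" unfolding A_def using u Z by (intro axis_scale_le) auto
    also have "\<dots> \<le> (1 + u / q) * A"
    proof (intro mult_right_mono A)
      have "(1 + u) powr (1 / q) * 1 powr (1 / p) \<le> 1 / q * (1 + u) + 1 / p * 1"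
        using u conj p by (intro Youngs_inequality_0) auto
      also have "\<dots> = 1 + u / q" using conj(2) by (simp add: add_divide_distrib)
      finally show "(1 + u) powr (1 / q) \<le> 1 + u / q" by simp
    qed
    finally have "2 * w * ((1 - 2 * w) * (1 - a) * s) \<le> 2 * w * (A * ((S - 1) / q + a))"
      by (simp add: u_def algebra_simps)
    then have "(1 - 2 * w) * (1 - a) * s \<le> A * ((S - 1) / q + a)" using w by simp
    moreover have "(S - 1) / q + a = S"
    proof -
      have "(S - 1) / q = - (p / q) * (1 - a)" by (simp add: S_def)
      then show ?thesis unfolding conj(4) by (simp add: S_def algebra_simps)
    qed
    ultimately show ?thesis by simp
  qed
  have "eventually (\<lambda>w. w \<in> {0<..<min d (1 / 2)}) (at_right (0::real))"
    using d(1) by (intro eventually_at_right_real) auto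
  then have "eventually (\<lambda>w. (1 - 2 * w) * (1 - a) * s \<le> A * S) (at_right (0::real))"
    by eventually_elim (rule step, auto)
  moreover have "((\<lambda>w. (1 - 2 * w) * (1 - a) * s) \<longlongrightarrow> (1 - 2 * 0) * (1 - a) * s) (at_right (0::real))"
    by (intro tendsto_intros)
  ultimately have "(1 - a) * s \<le> A * S"
    using tendsto_upperbound[of "\<lambda>w. (1 - 2 * w) * (1 - a) * s" _ "at_right 0" "A * S"] by simp
  then have "(1 - a) * (s / S) \<le> A" using pos by (simp add: S_def pos_divide_le_eq)
  moreover have "s / S = S powr (- (1 / p))"
  proof -
    have "s / S = S powr (1 / q) / S powr 1" using pos by (simp add: s_def S_def)
    also have "\<dots> = S powr (1 / q - 1)" by (simp only: powr_diff)
    also have "1 / q - 1 = - (1 / p)" using conj(2) by simp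
    finally show ?thesis .
  qed
  ultimately show ?thesis unfolding A_def S_def by (simp only:)
qed

text \<open>Stopping at \<open>a = 1 / (1 + h)\<close> with \<open>h < g\<close> leaves strict room
  in the moment budget, as \<open>level_fun p\<close> is strictly decreasing. The bound for
  \<open>g\<close> follows as \<open>h\<close> increases to \<open>g\<close>.\<close>

lemma axis_lower_unit:
  assumes g: "0 < g" "g < 1 / (p - 1)" and Z: "Z * level_fun p g = 1"
  shows "g * Z powr (1 / p) \<le> T 1 0 Z 1"
proof -
  have fg: "0 < level_fun p g" "level_fun p g < 1"
    using level_fun_pos[OF p(1), of g] level_fun_strict_antimono[OF p(1), of 0 g] g by auto
  have Z': "Z = 1 / level_fun p g" using Z fg by (simp add: field_simps)
  have Z1: "1 \<le> Z" using fg by (simp add: Z')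
  have less: "h * level_fun p h powr (- (1 / p)) \<le> T 1 0 Z 1" if h: "0 < h" "h < g" for h
  proof -
    define a where "a = 1 / (1 + h)"
    have a: "0 < a" "a < 1" "1 - a = h / (1 + h)" using h by (simp_all add: a_def field_simps)
    have fh: "level_fun p g < level_fun p h" "0 < level_fun p h"
      using level_fun_strict_antimono[OF p(1), of h g] level_fun_pos[OF p(1), of h] h g by auto
    have S: "1 - p * (1 - a) = level_fun p h * (1 + h) powr (- p)"
    proof -
      have "(1 + h) powr (p - 1) * (1 + h) powr (- p) = (1 + h) powr (-1)" by (simp only: powr_add[symmetric]) simp
      moreover have "(1 + h) powr (- 1) = 1 / (1 + h)" using h powr_minus_divide[of "1 + h" 1] by simp
      ultimately have "level_fun p h * (1 + h) powr (- p) = (1 - (p - 1) * h) * (1 / (1 + h))"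
        by (simp only: level_fun_def mult.assoc)
      then show ?thesis unfolding a(3) using h by (simp add: field_simps)
    qed
    have ap: "a powr p = (1 + h) powr (- p)" using h by (simp add: a_def powr_divide powr_minus_divide)
    have "(1 - a) * (1 - p * (1 - a)) powr (- (1 / p)) \<le> T 1 0 Z 1"
    proof (rule axis_lower_aux[OF a(1,2) _ _ Z1])
      show "0 < 1 - p * (1 - a)" unfolding S using fh h by simp
      have "1 < Z * level_fun p h" using fh fg by (simp add: Z' pos_less_divide_eq)
      then show "a powr p < Z * (1 - p * (1 - a))" unfolding S ap using h by (simp add: mult.assoc[symmetric])
    qed
    moreover have "(1 - a) * (1 - p * (1 - a)) powr (- (1 / p)) = h * level_fun p h powr (- (1 / p))"
    proof -
      have "((1 + h) powr (- p)) powr (- (1 / p)) = 1 + h" using h p by (simp add: powr_powr)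
      then have "(1 - p * (1 - a)) powr (- (1 / p)) = level_fun p h powr (- (1 / p)) * (1 + h)"
        unfolding S using fh h by (simp add: powr_mult)
      then show ?thesis unfolding a(3) using h by simp
    qed
    ultimately show ?thesis by simp
  qed
  have "((\<lambda>h. h * level_fun p h powr (- (1 / p))) \<longlongrightarrow> g * level_fun p g powr (- (1 / p))) (at_left g)"
  proof -
    have "isCont (level_fun p) g" using level_fun_deriv[of g p] g by (intro DERIV_isCont) auto
    then have "((level_fun p) \<longlongrightarrow> level_fun p g) (at_left g)"
      by (auto simp: isCont_def intro: tendsto_mono[OF at_le])
    then show ?thesis using fg by (intro tendsto_intros) auto
  qed
  moreover have "eventually (\<lambda>h. h * level_fun p h powr (- (1 / p)) \<le> T 1 0 Z 1) (at_left g)"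
    using eventually_at_left_real[OF g(1)] by eventually_elim (rule less, auto)
  ultimately have "g * level_fun p g powr (- (1 / p)) \<le> T 1 0 Z 1"
    by (intro tendsto_upperbound[where F = "at_left g"]) auto
  then show ?thesis using fg by (simp add: Z' powr_minus_divide powr_divide)
qed

lemma axis_lower:
  assumes g: "0 < g" "g < 1 / (p - 1)" and Z: "Z * level_fun p g = r powr p" and r: "0 < r" and H: "0 < H"
  shows "g * Z powr (1 / p) * H powr (1 / q) \<le> T r 0 Z H"
proof -
  define Z1 where "Z1 = Z / r powr p"
  have Z1: "Z1 * level_fun p g = 1" using Z r by (simp add: Z1_def)
  have fg: "0 < level_fun p g" "level_fun p g < 1"
    using level_fun_pos[OF p(1), of g] level_fun_strict_antimono[OF p(1), of 0 g] g by auto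
  have "Z1 = 1 / level_fun p g" using Z1 fg by (simp add: field_simps)
  then have Z1': "1 \<le> Z1" using fg by simp
  have e: "Z = r powr p * Z1" using r by (simp add: Z1_def)
  have "g * Z powr (1 / p) * H powr (1 / q) = r * H powr (1 / q) * (g * Z1 powr (1 / p))"
    unfolding e using r p Z1' by (simp add: powr_mult powr_powr)
  also have "\<dots> \<le> r * H powr (1 / q) * T 1 0 Z1 1"
    using r axis_lower_unit[OF g Z1] by (intro mult_left_mono) auto
  also have "\<dots> \<le> T r 0 (r powr p * Z1) H" by (rule axis_scale_ge[OF Z1' H r])
  finally show ?thesis by (simp add: e)
qed

end

section \<open>Lower bounds in both regimes and comparison with the formula\<close>

context bellman_exponents
begin

text \<open>The given point lies on the segment from the axis point \<open>(r, 0)\<close> with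
  moments \<open>Q\<close>, \<open>H / Z * Q\<close> to \<open>(a, b)\<close>, a stopping point of
  the limiting splitting at that axis point. The first equation of the system makes the moment
  \<open>Z\<close> fit, the second the mean \<open>y\<close>.\<close>

lemma inner_lower:
  assumes x: "0 < x" and y: "0 \<le> y" and Z: "0 < Z" and H: "0 < H"
    and g: "0 \<le> Y" "Y < g" "g < 1 / (p - 1)"
    and level: "level_fun p Y = Z / x powr p * level_fun p g"
    and slope: "slope_fun p Y = ((y powr q * Z) / (x powr p * H)) powr (1 / q) * slope_fun p g"
  shows "g * Z powr (1 / p) * H powr (1 / q) - x * y * Y \<le> T x y Z H"
proof -
  define r where "r = (1 + Y) * x"
  define a where "a = r / (1 + g)"
  define l where "l = Y * (1 + g) / (g * (1 + Y))"
  define k where "k = (H / Z) powr (1 / q)"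
  define b where "b = k * a powr (p - 1)"
  \<comment> \<open>The moment at which \<open>axis_lower\<close> applies at abscissa
    \<open>r\<close> with slope \<open>g\<close>.\<close>
  define Q where "Q = r powr p / level_fun p g"
  have r: "0 < r" and a: "0 < a" and g0: "0 < g" using x g by (simp_all add: r_def a_def)
  have k: "0 < k" "k powr q = H / Z" using Z H conj by (simp_all add: k_def powr_powr)
  have b: "0 \<le> b" using k by (simp add: b_def)
  have l: "0 \<le> l" "l < 1"
  proof -
    have "Y * (1 + g) < g * (1 + Y)" using g by (simp add: algebra_simps)
    then show "l < 1" using g by (simp add: l_def)
  qed (use g in \<open>simp add: l_def\<close>)
  have fg: "0 < level_fun p g" "level_fun p g < 1"
    using level_fun_pos[OF p(1), of g] level_fun_strict_antimono[OF p(1), of 0 g] g by auto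
  have Q: "0 < Q" using r fg by (simp add: Q_def)
  have ra: "r - a = g * a" using g by (simp add: a_def field_simps)
  have xl: "(1 - l) * r + l * a = x"
  proof -
    have "l * (g * a) = Y * x" using g0 g by (simp add: l_def a_def r_def)
    then have "l * (r - a) = r - x" unfolding ra by (simp add: r_def algebra_simps)
    then show ?thesis by (simp add: algebra_simps)
  qed
  have gal: "g * a * l = x * Y" using g0 g by (simp add: l_def a_def r_def)
  have ap: "a powr p = Q * ((1 - (p - 1) * g) / (1 + g))"
  proof -
    have "(1 + g) powr p = (1 + g) powr (p - 1) * (1 + g)" using g0 by (simp add: powr_one_mult)
    then have "a powr p = r powr p / ((1 + g) powr (p - 1) * (1 + g))"
      using r g0 by (simp add: a_def powr_divide)
    also have "\<dots> = Q * ((1 - (p - 1) * g) / (1 + g))"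
    proof -
      have "1 - (p - 1) * g \<noteq> 0" using fg by (auto simp: level_fun_def)
      then show ?thesis using g0 by (simp add: Q_def level_fun_def)
    qed
    finally show ?thesis .
  qed
  have ZQ: "Z = Q * ((1 - (p - 1) * Y) / (1 + Y))"
  proof -
    have "(1 + Y) powr p = (1 + Y) powr (p - 1) * (1 + Y)" using g by (simp add: powr_one_mult)
    then have rp: "r powr p = (1 + Y) powr (p - 1) * (1 + Y) * x powr p" using x g by (simp add: r_def powr_mult)
    have "Z * level_fun p g = x powr p * level_fun p Y" using level x by (simp add: field_simps)
    also have "\<dots> = r powr p * ((1 - (p - 1) * Y) / (1 + Y))"
      unfolding rp level_fun_def using g by simp
    finally have "Z = r powr p * ((1 - (p - 1) * Y) / (1 + Y)) / level_fun p g"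
      using fg by (subst nonzero_eq_divide_eq) simp_all
    then show ?thesis by (simp add: Q_def)
  qed
  have Zl: "(1 - l) * Q + l * a powr p = Z"
  proof -
    have "l * (1 - (1 - (p - 1) * g) / (1 + g)) = p * Y / (1 + Y)"
    proof -
      have "1 - (1 - (p - 1) * g) / (1 + g) = p * g / (1 + g)" using g0 by (simp add: field_simps)
      then show ?thesis using g0 g by (simp add: l_def)
    qed
    moreover have "1 - (1 - (p - 1) * Y) / (1 + Y) = p * Y / (1 + Y)" using g by (simp add: field_simps)
    ultimately have "l * (1 - (1 - (p - 1) * g) / (1 + g)) = 1 - (1 - (p - 1) * Y) / (1 + Y)" by simp
    then have "Q * (l * (1 - (1 - (p - 1) * g) / (1 + g))) = Q * (1 - (1 - (p - 1) * Y) / (1 + Y))" by simp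
    then show ?thesis unfolding ap by (subst ZQ) (simp add: algebra_simps)
  qed
  have lb: "l * b = y"
  proof -
    define \<rho> where "\<rho> = ((y powr q * Z) / (x powr p * H)) powr (1 / q)"
    have \<rho>: "k * x powr (p - 1) * \<rho> = y"
    proof -
      have "(x powr p) powr (1 / q) = x powr (p - 1)" using conj(4) by (simp add: powr_powr)
      moreover have "(y powr q) powr (1 / q) = y" using y conj by (simp add: powr_powr)
      ultimately have "\<rho> = y * Z powr (1 / q) / (x powr (p - 1) * H powr (1 / q))"
        using x y Z H by (simp add: \<rho>_def powr_mult powr_divide)
      then show ?thesis using x Z H by (simp add: k_def powr_divide)
    qed
    have e: "(1 + u) powr (p - 1) = (1 + u) powr (p - 2) * (1 + u)" if "0 \<le> u" for u
      using powr_add[of "1 + u" "p - 2" 1] that by simp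
    have "a powr (p - 1) = (1 + Y) powr (p - 1) * x powr (p - 1) / (1 + g) powr (p - 1)"
      using x g by (simp add: a_def r_def powr_mult powr_divide)
    moreover have "Y * v / (g * u) * (k * (P * u * X / (G * v))) = k * X * (Y * P / (g * G))"
      if "v \<noteq> 0" "u \<noteq> 0" for u v P G X :: real
      using that by simp
    ultimately have "l * b = k * x powr (p - 1) * (slope_fun p Y / slope_fun p g)"
      unfolding b_def l_def slope_fun_def e[OF g(1)] e[OF less_imp_le[OF g0]] using g g0 by simp
    also have "slope_fun p Y / slope_fun p g = \<rho>"
      using slope slope_fun_pos[OF g0, of p] by (simp add: \<rho>_def)
    finally show ?thesis using \<rho> by simp
  qed
  have bq: "b powr q = H / Z * a powr p"
    using k a conj by (simp add: b_def powr_mult powr_powr)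
  have Hl: "(1 - l) * (H / Z * Q) + l * b powr q = H"
  proof -
    have "(1 - l) * (H / Z * Q) + l * b powr q = H / Z * ((1 - l) * Q + l * a powr p)"
      unfolding bq by (simp add: algebra_simps diff_divide_distrib)
    then show ?thesis unfolding Zl using Z by simp
  qed
  have "r powr p \<le> Q" using fg r by (simp add: Q_def pos_le_divide_eq)
  then have dr: "feasible r 0 Q (H / Z * Q)" using r conj H Z Q by (simp add: feasible_def)
  have da: "feasible a b (a powr p) (b powr q)" using a b by (simp add: feasible_def)
  have "(1 - l) * T r 0 Q (H / Z * Q) + (1 - (1 - l)) * T a b (a powr p) (b powr q)
      + (1 - l) * (1 - (1 - l)) * (\<bar>r - a\<bar> * \<bar>0 - b\<bar>)
    \<le> T ((1 - l) * r + (1 - (1 - l)) * a) ((1 - l) * 0 + (1 - (1 - l)) * b)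
        ((1 - l) * Q + (1 - (1 - l)) * a powr p) ((1 - l) * (H / Z * Q) + (1 - (1 - l)) * b powr q)"
    using l by (intro tree_bellman_line dr da) auto
  moreover have "\<bar>r - a\<bar> * \<bar>0 - b\<bar> = g * a * b" unfolding ra using g0 a b by simp
  moreover have "1 - (1 - l) = l" by simp
  ultimately have "(1 - l) * T r 0 Q (H / Z * Q) + l * T a b (a powr p) (b powr q) + (1 - l) * l * (g * a * b) \<le> T x y Z H"
    by (simp only: xl Zl Hl lb mult_zero_right add_0)
  moreover have "0 \<le> l * T a b (a powr p) (b powr q)" using l tree_bellman_nonneg[OF da] by simp
  moreover have "(1 - l) * (g * (Q * k)) \<le> (1 - l) * T r 0 Q (H / Z * Q)"
  proof (rule mult_left_mono)
    have "g * Q powr (1 / p) * (H / Z * Q) powr (1 / q) \<le> T r 0 Q (H / Z * Q)"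
      using fg r Z H Q by (intro axis_lower[OF g0 g(3)]) (auto simp: Q_def)
    moreover have "Q powr (1 / p) * (H / Z * Q) powr (1 / q) = Q powr (1 / p + 1 / q) * k"
      using Q Z H unfolding k_def by (subst powr_mult) (auto simp: powr_add)
    ultimately show "g * (Q * k) \<le> T r 0 Q (H / Z * Q)" using Q conj(2) by (simp add: mult.assoc)
  qed (use l in simp)
  moreover have "(1 - l) * (g * (Q * k)) + (1 - l) * l * (g * a * b) = g * Z powr (1 / p) * H powr (1 / q) - x * y * Y"
  proof -
    have "l * a powr p * k = y * a"
    proof -
      have e: "a powr p * k = b * a" using a powr_one_mult[of a p] by (simp add: b_def)
      have "l * (a powr p * k) = y * a" unfolding e using lb by (simp only: mult.assoc[symmetric])
      then show ?thesis by (simp only: mult.assoc)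
    qed
    moreover have "(1 - l) * Q = Z - l * a powr p" using Zl by simp
    ultimately have "(1 - l) * Q * k = Z * k - y * a" by (simp add: left_diff_distrib)
    moreover have "(1 - l) * (g * (Q * k)) = g * ((1 - l) * Q * k)" by (simp only: mult_ac)
    ultimately have e1: "(1 - l) * (g * (Q * k)) = g * (Z * k) - g * a * y"
      by (simp add: right_diff_distrib mult_ac)
    have "(1 - l) * l * (g * a * b) = (1 - l) * (g * a) * (l * b)" by (simp only: mult_ac)
    then have e2: "(1 - l) * l * (g * a * b) = g * a * y - (g * a * l) * y"
      unfolding lb by (simp add: algebra_simps)
    have e3: "Z * k = Z powr (1 / p) * H powr (1 / q)"
    proof -
      have "Z * k = Z powr (1 / p + 1 / q) / Z powr (1 / q) * H powr (1 / q)"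
        unfolding conj(2) using Z H by (simp add: k_def powr_divide)
      then show ?thesis using Z by (simp add: powr_add)
    qed
    show ?thesis unfolding e1 e2 e3 gal by (simp add: algebra_simps)
  qed
  ultimately show ?thesis by linarith
qed

text \<open>The larger \<open>Z\<close>, the closer the slope with
  \<open>Z * level_fun p g = 1\<close> is to \<open>1 / (p - 1)\<close>; under this hypothesis it is
  at least \<open>h\<close>.\<close>

lemma axis_lower_large:
  assumes h: "0 < h" "h < 1 / (p - 1)" and Z: "1 \<le> Z * level_fun p h" and H: "0 < H"
  shows "h * (Z powr (1 / p) * H powr (1 / q)) \<le> T 1 0 Z H"
proof -
  have fh: "0 < level_fun p h" using level_fun_pos[OF p(1)] h by simp
  have Z0: "0 < Z" using Z fh by (smt (verit) mult_nonpos_nonneg)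
  have "level_fun p (1 / (p - 1)) = 0" using p by (simp add: level_fun_def)
  then have "\<exists>g\<ge>h. g \<le> 1 / (p - 1) \<and> level_fun p g = 1 / Z"
    using Z Z0 h by (intro IVT2' level_fun_continuous) (auto simp: pos_divide_le_eq mult.commute)
  then obtain g where g: "h \<le> g" "g \<le> 1 / (p - 1)" "level_fun p g = 1 / Z" by blast
  have "g \<noteq> 1 / (p - 1)" using g(3) \<open>level_fun p (1 / (p - 1)) = 0\<close> Z0 by auto
  then have g': "g < 1 / (p - 1)" using g by simp
  have "h * (Z powr (1 / p) * H powr (1 / q)) \<le> g * (Z powr (1 / p) * H powr (1 / q))"
    using g by (intro mult_right_mono) auto
  also have "\<dots> \<le> T 1 0 Z H" using axis_lower[of g Z 1 H] g g' h Z0 H by (simp add: mult.assoc)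
  finally show ?thesis .
qed

text \<open>A mass \<open>w\<close> at \<open>(1, 0)\<close> carries all surplus moments,
  concentrated to \<open>E w / w\<close> and \<open>F w / w\<close>; the rest is the constant
  \<open>(X, V)\<close> with minimal moments. The contribution of the small mass keeps its size as
  \<open>w\<close> tends to 0 because \<open>1 / p + 1 / q = 1\<close>; afterwards \<open>h\<close>
  tends to \<open>1 / (p - 1)\<close>.\<close>

lemma outer_lower:
  assumes Z: "\<bar>x\<bar> powr p < Z" and H: "\<bar>y\<bar> powr q < H"
  shows "(H - \<bar>y\<bar> powr q) powr (1 / q) * (Z - \<bar>x\<bar> powr p) powr (1 / p) / (p - 1) \<le> T x y Z H"
proof -
  define E where "E = (\<lambda>w. Z - (1 - w) * \<bar>(x - w) / (1 - w)\<bar> powr p)"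
  define F where "F = (\<lambda>w. H - (1 - w) * \<bar>y / (1 - w)\<bar> powr q)"
  have E: "(E \<longlongrightarrow> Z - \<bar>x\<bar> powr p) (at_right 0)"
  proof -
    have "((\<lambda>w. Z - (1 - w) * \<bar>(x - w) / (1 - w)\<bar> powr p) \<longlongrightarrow> Z - (1 - 0) * \<bar>(x - 0) / (1 - 0)\<bar> powr p) (at_right 0)"
      using p by (intro tendsto_intros tendsto_powr') auto
    then show ?thesis by (simp add: E_def)
  qed
  have F: "(F \<longlongrightarrow> H - \<bar>y\<bar> powr q) (at_right 0)"
  proof -
    have "((\<lambda>w. H - (1 - w) * \<bar>y / (1 - w)\<bar> powr q) \<longlongrightarrow> H - (1 - 0) * \<bar>y / (1 - 0)\<bar> powr q) (at_right 0)"
      using conj by (intro tendsto_intros tendsto_powr') auto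
    then show ?thesis by (simp add: F_def)
  qed
  have step: "h * (E w powr (1 / p) * F w powr (1 / q)) \<le> T x y Z H"
    if h: "0 < h" "h < 1 / (p - 1)" and w: "0 < w" "w < 1" and Ew: "w \<le> E w * level_fun p h" and Fw: "0 < F w" for h w
  proof -
    define X where "X = (x - w) / (1 - w)"
    define V where "V = y / (1 - w)"
    have fh: "0 < level_fun p h" "level_fun p h < 1"
      using level_fun_pos[OF p(1), of h] level_fun_strict_antimono[OF p(1), of 0 h] h by auto
    have E0: "0 < E w" using Ew w fh by (smt (verit) mult_nonpos_nonneg)
    have Z1: "1 \<le> E w / w * level_fun p h" using Ew w by (simp add: pos_le_divide_eq)
    have "E w / w * level_fun p h \<le> E w / w * 1" using E0 w fh by (intro mult_left_mono) auto
    then have "1 \<le> E w / w" using Z1 by simp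
    then have d1: "feasible 1 0 (E w / w) (F w / w)" using Fw w conj by (simp add: feasible_def)
    have d2: "feasible X V (\<bar>X\<bar> powr p) (\<bar>V\<bar> powr q)" by (simp add: feasible_def)
    have "w * T 1 0 (E w / w) (F w / w) + (1 - w) * T X V (\<bar>X\<bar> powr p) (\<bar>V\<bar> powr q) + w * (1 - w) * (\<bar>1 - X\<bar> * \<bar>0 - V\<bar>)
      \<le> T (w * 1 + (1 - w) * X) (w * 0 + (1 - w) * V) (w * (E w / w) + (1 - w) * \<bar>X\<bar> powr p) (w * (F w / w) + (1 - w) * \<bar>V\<bar> powr q)"
      using w by (intro tree_bellman_line d1 d2) auto
    moreover have "w * 1 + (1 - w) * X = x" "w * 0 + (1 - w) * V = y" "w * (E w / w) + (1 - w) * \<bar>X\<bar> powr p = Z"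
      "w * (F w / w) + (1 - w) * \<bar>V\<bar> powr q = H"
      using w by (simp_all add: X_def V_def E_def F_def)
    ultimately have "w * T 1 0 (E w / w) (F w / w) + (1 - w) * T X V (\<bar>X\<bar> powr p) (\<bar>V\<bar> powr q) + w * (1 - w) * (\<bar>1 - X\<bar> * \<bar>0 - V\<bar>) \<le> T x y Z H"
      by (simp only:)
    moreover have "0 \<le> (1 - w) * T X V (\<bar>X\<bar> powr p) (\<bar>V\<bar> powr q)" "0 \<le> w * (1 - w) * (\<bar>1 - X\<bar> * \<bar>0 - V\<bar>)"
      using w tree_bellman_nonneg[OF d2] by auto
    moreover have "w * (h * ((E w / w) powr (1 / p) * (F w / w) powr (1 / q))) \<le> w * T 1 0 (E w / w) (F w / w)"
      using w Fw by (intro mult_left_mono axis_lower_large[OF h Z1]) auto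
    moreover have "w * ((E w / w) powr (1 / p) * (F w / w) powr (1 / q)) = E w powr (1 / p) * F w powr (1 / q)"
    proof -
      have "(E w / w) powr (1 / p) * (F w / w) powr (1 / q) = E w powr (1 / p) * F w powr (1 / q) / w powr (1 / p + 1 / q)"
        using E0 Fw w by (simp add: powr_divide powr_add)
      then show ?thesis using w conj(2) by simp
    qed
    ultimately show ?thesis by (simp add: mult.left_commute)
  qed
  define K where "K = (Z - \<bar>x\<bar> powr p) powr (1 / p) * (H - \<bar>y\<bar> powr q) powr (1 / q)"
  have main: "h * K \<le> T x y Z H" if h: "0 < h" "h < 1 / (p - 1)" for h
  proof -
    have fh: "0 < level_fun p h" using level_fun_pos[OF p(1)] h by simp
    have lim: "((\<lambda>w. E w * level_fun p h - w) \<longlongrightarrow> (Z - \<bar>x\<bar> powr p) * level_fun p h - 0) (at_right 0)"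
      by (intro tendsto_intros E)
    then have "eventually (\<lambda>w. 0 < E w * level_fun p h - w) (at_right 0)"
      using order_tendstoD(1)[OF lim, of 0] Z fh by simp
    moreover have "eventually (\<lambda>w. 0 < F w) (at_right 0)" using H by (intro order_tendstoD(1)[OF F]) auto
    moreover have "eventually (\<lambda>w. w \<in> {0<..<1}) (at_right (0::real))" by (rule eventually_at_right_real) simp
    ultimately have "eventually (\<lambda>w. h * (E w powr (1 / p) * F w powr (1 / q)) \<le> T x y Z H) (at_right 0)"
      by eventually_elim (rule step[OF h], auto)
    moreover have "((\<lambda>w. h * (E w powr (1 / p) * F w powr (1 / q))) \<longlongrightarrow> h * K) (at_right 0)"
      unfolding K_def using Z H by (intro tendsto_intros E F) auto
    ultimately show ?thesis by (intro tendsto_upperbound[where F = "at_right (0::real)"]) auto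
  qed
  have "((\<lambda>h. h * K) \<longlongrightarrow> 1 / (p - 1) * K) (at_left (1 / (p - 1)))" by (intro tendsto_intros)
  moreover have "eventually (\<lambda>h. h * K \<le> T x y Z H) (at_left (1 / (p - 1)))"
    using eventually_at_left_real[of 0 "1 / (p - 1)"] p by (auto elim!: eventually_mono intro!: main)
  ultimately have "1 / (p - 1) * K \<le> T x y Z H"
    by (intro tendsto_upperbound[where F = "at_left (1 / (p - 1))"]) auto
  then show ?thesis by (simp add: K_def mult.commute)
qed

lemma bellman_explicit_le_tree:
  fixes \<zeta> \<eta> :: "'a::real_normed_vector"
  assumes Z: "norm \<zeta> powr p \<le> Z" and H: "norm \<eta> powr q \<le> H"
  shows "bellman_explicit p q \<zeta> \<eta> Z H \<le> T (norm \<zeta>) (norm \<eta>) Z H"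
proof -
  have T: "0 \<le> T (norm \<zeta>) (norm \<eta>) Z H" using Z H by (intro tree_bellman_nonneg) (simp add: feasible_def)
  consider "norm \<zeta> powr p * H \<le> norm \<eta> powr q * Z" "norm \<zeta> powr p < Z" "norm \<eta> powr q < H"
    | "norm \<zeta> powr p * H \<le> norm \<eta> powr q * Z" "Z = norm \<zeta> powr p \<or> H = norm \<eta> powr q"
    | "norm \<eta> powr q * Z < norm \<zeta> powr p * H" "norm \<zeta> powr p < Z"
    | "norm \<eta> powr q * Z < norm \<zeta> powr p * H" "Z = norm \<zeta> powr p"
    using Z H by fastforce
  then show ?thesis
  proof cases
    case 1
    then show ?thesis using outer_lower[of "norm \<zeta>" Z "norm \<eta>" H] by (simp add: bellman_explicit_def)
  next
    case 2
    then show ?thesis using T by (auto simp: bellman_explicit_def)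
  next
    case 3
    obtain g Y where gY: "bellman_system p q \<zeta> \<eta> Z H g Y"
      "bellman_explicit p q \<zeta> \<eta> Z H = g * Z powr (1 / p) * H powr (1 / q) - norm \<zeta> * norm \<eta> * Y"
      using bellman_system_obtain[OF p(1) conj(1) 3] by blast
    have "0 \<le> norm \<zeta> powr p" "0 \<le> norm \<eta> powr q" by auto
    then have Z0: "0 < Z" using 3 by linarith
    have "0 \<le> norm \<eta> powr q * Z" using Z0 by simp
    then have "0 < norm \<zeta> powr p * H" using 3 by linarith
    then have pos: "0 < norm \<zeta>" "0 < H" by (auto simp: zero_less_mult_iff)
    show ?thesis
      using 3 inner_lower[OF pos(1) norm_ge_zero Z0 pos(2), of Y g \<eta>] gY(1) unfolding bellman_system_iff[OF p(1)] gY(2)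
      by simp
  next
    case 4
    then show ?thesis using T by (simp add: bellman_explicit_def)
  qed
qed

text \<open>\<open>ennreal\<close> sends negative reals to 0, so the upper bound becomes a real
  inequality only with this. In the second regime it follows from \<open>Y < g\<close> and the two
  moment constraints.\<close>

lemma bellman_explicit_nonneg:
  fixes \<zeta> \<eta> :: "'a::real_normed_vector"
  assumes Z: "norm \<zeta> powr p \<le> Z" and H: "norm \<eta> powr q \<le> H"
  shows "0 \<le> bellman_explicit p q \<zeta> \<eta> Z H"
proof (cases "norm \<eta> powr q * Z < norm \<zeta> powr p * H \<and> norm \<zeta> powr p < Z")
  case True
  then have regime: "norm \<eta> powr q * Z < norm \<zeta> powr p * H" "norm \<zeta> powr p < Z" by auto
  obtain g Y where gY: "bellman_system p q \<zeta> \<eta> Z H g Y"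
    "bellman_explicit p q \<zeta> \<eta> Z H = g * Z powr (1 / p) * H powr (1 / q) - norm \<zeta> * norm \<eta> * Y"
    using bellman_system_obtain[OF p(1) conj(1) regime] by blast
  have Yg: "0 \<le> Y" "Y < g" using gY(1) by (auto simp: bellman_system_def)
  have "(norm \<zeta> powr p) powr (1 / p) \<le> Z powr (1 / p)" "(norm \<eta> powr q) powr (1 / q) \<le> H powr (1 / q)"
    using Z H p conj(1) by (auto intro!: powr_mono2)
  then have "norm \<zeta> \<le> Z powr (1 / p)" "norm \<eta> \<le> H powr (1 / q)"
    using p conj(1) by (simp_all add: powr_powr)
  then have "Y * (norm \<zeta> * norm \<eta>) \<le> g * (Z powr (1 / p) * H powr (1 / q))"
    using Yg by (intro mult_mono) auto
  then show ?thesis unfolding gY(2) by (simp add: mult_ac)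
next
  case False
  then show ?thesis using p by (auto simp: bellman_explicit_def)
qed

lemma bellman_sup_le_explicit:
  fixes \<zeta> \<eta> :: "'a::{real_inner, complete_space}"
  assumes Z: "norm \<zeta> powr p \<le> Z" and H: "norm \<eta> powr q \<le> H"
  shows "bellman_sup p q \<zeta> \<eta> Z H \<le> ennreal (bellman_explicit p q \<zeta> \<eta> Z H)"
proof -
  have ZH: "0 \<le> Z" "0 \<le> H" using Z H by (auto intro: order.trans[OF powr_ge_zero])
  consider "norm \<zeta> powr p * H \<le> norm \<eta> powr q * Z"
    | "norm \<eta> powr q * Z < norm \<zeta> powr p * H" "norm \<zeta> powr p < Z"
    | "norm \<eta> powr q * Z < norm \<zeta> powr p * H" "Z = norm \<zeta> powr p"
    using Z by fastforce
  then show ?thesis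
  proof cases
    case 1
    then show ?thesis using bellman_sup_le_outer_regime[OF p q ZH Z H 1] by (simp add: bellman_explicit_def)
  next
    case 2
    obtain g Y where gY: "bellman_system p q \<zeta> \<eta> Z H g Y"
      "bellman_explicit p q \<zeta> \<eta> Z H = g * Z powr (1 / p) * H powr (1 / q) - norm \<zeta> * norm \<eta> * Y"
      using bellman_system_obtain[OF p(1) conj(1) 2] by blast
    have "0 \<le> norm \<eta> powr q * Z" using ZH by simp
    then have "0 < norm \<zeta> powr p * H" using 2 by linarith
    then have pos: "0 < norm \<zeta> powr p" by (simp add: zero_less_mult_iff)
    have Yg: "0 \<le> Y" "Y < g" "level_fun p Y = Z / norm \<zeta> powr p * level_fun p g"
      using gY(1) unfolding bellman_system_iff[OF p(1)] by auto
    have "Z * level_fun p g = norm \<zeta> powr p * level_fun p Y" using Yg(3) pos by simp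
    then have "bellman_sup p q \<zeta> \<eta> Z H \<le> ennreal (g * Z powr (1 / p) * H powr (1 / q) - norm \<zeta> * norm \<eta> * Y)"
      using Yg unfolding level_fun_def by (intro bellman_sup_le_inner_regime[OF p q ZH]) auto
    then show ?thesis unfolding gY(2) .
  next
    case 3
    show ?thesis unfolding bellman_sup_eq_0[OF p q ZH 3(2)] by simp
  qed
qed

end

theorem mainTheorem2:
  fixes p q Z H :: real
    and \<zeta> \<eta> :: "'a::{real_inner, complete_space}"
  assumes "\<exists>v::'a. v \<noteq> 0"
    and "1 < p" and "p < 2" and "q = p / (p - 1)"
    and "Z \<ge> 0" and "H \<ge> 0"
    and "Z \<ge> norm \<zeta> powr p" and "H \<ge> norm \<eta> powr q"
  shows "enn2ereal (bellman_sup p q \<zeta> \<eta> Z H) = ereal (bellman_explicit p q \<zeta> \<eta> Z H)"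
proof -
  interpret bellman_exponents p q by standard (use assms in auto)
  have feasible: "feasible (norm \<zeta>) (norm \<eta>) Z H" using assms(7,8) by (simp add: feasible_def)
  \<comment> \<open>A direction for \<open>\<zeta> = 0\<close> or \<open>\<eta> = 0\<close>, where
    \<open>sgn\<close> is no unit vector.\<close>
  obtain u :: 'a where u: "norm u = 1"
    using assms(1) by (metis norm_sgn)
  have unit: "\<exists>e::'a. norm e = 1 \<and> norm x *\<^sub>R e = x" for x :: 'a
  proof (cases "x = 0")
    case True
    then show ?thesis using u by auto
  next
    case False
    then show ?thesis by (intro exI[of _ "sgn x"]) (simp add: norm_sgn sgn_div_norm)
  qed
  obtain e1 e2 :: 'a where e: "norm e1 = 1" "norm \<zeta> *\<^sub>R e1 = \<zeta>" "norm e2 = 1" "norm \<eta> *\<^sub>R e2 = \<eta>"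
    using unit by metis
  have up: "bellman_sup p q \<zeta> \<eta> Z H \<le> ennreal (bellman_explicit p q \<zeta> \<eta> Z H)"
    using assms by (intro bellman_sup_le_explicit)
  \<comment> \<open>\<open>enn2real\<close> loses nothing, the upper bound being finite; the
    comparison with \<open>tree_bellman\<close> can then take place in the reals.\<close>
  define b where "b = enn2real (bellman_sup p q \<zeta> \<eta> Z H)"
  have b: "bellman_sup p q \<zeta> \<eta> Z H = ennreal b" "0 \<le> b"
    using up by (auto simp: b_def ennreal_enn2real_if top_unique)
  have "tree_bellman p q (norm \<zeta>) (norm \<eta>) Z H \<le> b"
  proof (rule tree_bellman_leI[OF feasible])
    fix v assume "tree_value p q (norm \<zeta>) (norm \<eta>) Z H v"
    then have "ennreal v \<le> bellman_sup p q (norm \<zeta> *\<^sub>R e1) (norm \<eta> *\<^sub>R e2) Z H"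
      using e p conj by (intro tree_value_le_bellman_sup) auto
    then show "v \<le> b" using b e by (simp add: ennreal_le_iff)
  qed
  then have low: "bellman_explicit p q \<zeta> \<eta> Z H \<le> b"
    using bellman_explicit_le_tree[of \<zeta> Z \<eta> H] assms by simp
  have "b = bellman_explicit p q \<zeta> \<eta> Z H"
  proof (rule antisym[OF _ low])
    show "b \<le> bellman_explicit p q \<zeta> \<eta> Z H"
      using up assms(7,8) by (simp add: b(1) bellman_explicit_nonneg)
  qed
  then show ?thesis using b by simp
qed

end
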